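(* Let $d\geq 3$ and let $X(d)$ be the disjoint union of all finite graphs with maximal degree $\leq d$. Let $Y$ and $Z$ be bounded degree graphs which are quasi-isometric to $\mathbb{R}^2$ and $\mathbb{H}^2_{\mathbb{R}}$ respectively. For all sufficiently large $k$, we have $$\operatorname{wir}^k_{X(d)\to Y}(n)\simeq n^2\quad\text{and}\quad\exp(n^{1/2})\lesssim\operatorname{wir}^k_{X(d)\to Z}(n)\lesssim\exp(n).$$
   Context: $\mathbb{H}^2_{\mathbb{R}}$ is the real hyperbolic plane. The disjoint union defining $X(d)$ is over isomorphism classes. For functions $f,g:\mathbb{N}\to\mathbb{R}$, $f\lesssim g$ means there is a constant $C$ such that $f(n)\leq Cg(Cn)+C$ for all $n$; $f\simeq g$ means $f\lesssim g$ and $g\lesssim f$. A graph $\Gamma=(V\Gamma,E\Gamma)$ consists of a set $V\Gamma$ of vertices and a set $E\Gamma$ of unordered pairs of distinct vertices (edges). $\Gamma$ also denotes its topological realisation (one unit interval for each edge, with endpoints labelled by the same vertex identified). $|\Gamma|$ is the number of vertices, and $\Gamma\leq X$ means $\Gamma$ is a subgraph of $X$. A wiring of a graph $\Gamma$ into a graph $\Gamma'$ is a continuous map $f:\Gamma\to\Gamma'$ such that the image of each vertex is a vertex and the image of each edge is a walk in $\Gamma'$. It is a coarse $k$-wiring if (1) the preimage of each vertex of $\Gamma'$ contains at most $k$ vertices of $\Gamma$, and (2) each edge of $\Gamma'$ is contained in the image of at most $k$ edges of $\Gamma$. The image of a wiring is the subgraph of $\Gamma'$ consisting of all vertices in $f(V\Gamma)$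 and all walks which are images of edges; the volume of a wiring is the number of vertices in its image. For a finite graph $\Gamma$ and a graph $Y$, $\operatorname{wir}^k(\Gamma\to Y)$ is the minimal volume of a coarse $k$-wiring of $\Gamma$ into $Y$ ($+\infty$ if none exists). The $k$-wiring profile of $X$ into $Y$ is $\operatorname{wir}^k_{X\to Y}(n)=\max\{\operatorname{wir}^k(\Gamma\to Y) : \Gamma\leq X,\ |\Gamma|\leq n\}$. *)

theory Defs
  imports "HOL-Analysis.Analysis"
begin

section \<open>Graphs\<close>

record 'a graph =
  verts :: "'a set"
  edges :: "'a set set"

definition is_graph :: "'a graph \<Rightarrow> bool" where
  "is_graph G \<longleftrightarrow> (\<forall>e\<in>edges G. e \<subseteq> verts G \<and> card e = 2)"

definition subgraph :: "'a graph \<Rightarrow> 'a graph \<Rightarrow> bool" where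
  "subgraph H G \<longleftrightarrow> is_graph H \<and> verts H \<subseteq> verts G \<and> edges H \<subseteq> edges G"

text \<open>The finiteness requirement is needed because \<open>card\<close> is 0 on infinite sets.\<close>

definition degree_le :: "'a graph \<Rightarrow> nat \<Rightarrow> bool" where
  "degree_le G d \<longleftrightarrow>
     (\<forall>v\<in>verts G. finite {e \<in> edges G. v \<in> e} \<and> card {e \<in> edges G. v \<in> e} \<le> d)"

definition bounded_degree :: "'a graph \<Rightarrow> bool" where
  "bounded_degree G \<longleftrightarrow> (\<exists>d. degree_le G d)"

definition graph_iso :: "'a graph \<Rightarrow> 'b graph \<Rightarrow> bool" where
  "graph_iso G H \<longleftrightarrow>
     (\<exists>h. bij_betw h (verts G) (verts H) \<and> edges H = (\<lambda>e. h ` e) ` edges G)"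

text \<open>A walk is given by its list of vertices; a single vertex is a walk of length 0.\<close>

definition is_walk :: "'a graph \<Rightarrow> 'a list \<Rightarrow> bool" where
  "is_walk G w \<longleftrightarrow>
     w \<noteq> [] \<and> set w \<subseteq> verts G \<and> successively (\<lambda>u v. {u, v} \<in> edges G) w"

definition walk_graph :: "'a list \<Rightarrow> 'a graph" where
  "walk_graph w = \<lparr>verts = set w, edges = {{w ! i, w ! Suc i} |i. Suc i < length w}\<rparr>"


section \<open>The graph \<open>X(d)\<close>\<close>

text \<open>
  Every finite graph is isomorphic to one whose vertices are natural numbers.  As
  \<open>{H. graph_iso G H}\<close> depends only on the isomorphism class of \<open>G\<close>, so does
  \<open>iso_rep G\<close>; hence \<open>finite_graph_reps d\<close> contains exactly one graph from each
  isomorphism class of finite graphs of maximal degree at most \<open>d\<close>.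
\<close>

definition iso_rep :: "nat graph \<Rightarrow> nat graph" where
  "iso_rep G = (SOME H. graph_iso G H)"

definition finite_graph_reps :: "nat \<Rightarrow> nat graph set" where
  "finite_graph_reps d = iso_rep ` {G. is_graph G \<and> finite (verts G) \<and> degree_le G d}"

definition disjoint_union :: "'a graph set \<Rightarrow> ('a graph \<times> 'a) graph" where
  "disjoint_union \<G> =
     \<lparr>verts = {(G, v) |G v. G \<in> \<G> \<and> v \<in> verts G},
      edges = {Pair G ` e |G e. G \<in> \<G> \<and> e \<in> edges G}\<rparr>"

definition X_graph :: "nat \<Rightarrow> (nat graph \<times> nat) graph" where
  "X_graph d = disjoint_union (finite_graph_reps d)"


section \<open>Topological realisation\<close>

text \<open>
  Points of the realisation are written in barycentric coordinates, as functions from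
  vertices to reals: \<open>vertex_pt v\<close> is the vertex \<open>v\<close>, and the edge \<open>e = {u, v}\<close> is the
  segment \<open>cell e\<close> of all \<open>(1 - t) u + t v\<close>, \<open>0 \<le> t \<le> 1\<close>.  The topology is the one induced
  by the product topology on functions.  On locally finite graphs (the only ones that are
  used as source or target of a wiring below) this is the quotient topology obtained
  by glueing one unit interval for each edge along the vertices.
\<close>

definition vertex_pt :: "'a \<Rightarrow> 'a \<Rightarrow> real" where
  "vertex_pt v = indicator {v}"

definition cell :: "'a set \<Rightarrow> ('a \<Rightarrow> real) set" where
  "cell e = {p. (\<forall>x. 0 \<le> p x) \<and> (\<forall>x. x \<notin> e \<longrightarrow> p x = 0) \<and> (\<Sum>x\<in>e. p x) = 1}"

definition realisation :: "'a graph \<Rightarrow> ('a \<Rightarrow> real) set" where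
  "realisation G = vertex_pt ` verts G \<union> (\<Union>e\<in>edges G. cell e)"


section \<open>Wirings\<close>

definition wiring ::
    "'a graph \<Rightarrow> 'b graph \<Rightarrow> (('a \<Rightarrow> real) \<Rightarrow> ('b \<Rightarrow> real)) \<Rightarrow> bool" where
  "wiring G H f \<longleftrightarrow>
     continuous_on (realisation G) f \<and>
     f ` realisation G \<subseteq> realisation H \<and>
     (\<forall>v\<in>verts G. \<exists>v'\<in>verts H. f (vertex_pt v) = vertex_pt v') \<and>
     (\<forall>u v. {u, v} \<in> edges G \<longrightarrow>
        (\<exists>w. is_walk H w \<and>
             f (vertex_pt u) = vertex_pt (hd w) \<and> f (vertex_pt v) = vertex_pt (last w) \<and>
             f ` cell {u, v} = realisation (walk_graph w)))"

text \<open>The cardinalities below are meant for finite \<open>G\<close>.\<close>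

definition coarse_wiring ::
    "nat \<Rightarrow> 'a graph \<Rightarrow> 'b graph \<Rightarrow> (('a \<Rightarrow> real) \<Rightarrow> ('b \<Rightarrow> real)) \<Rightarrow> bool" where
  "coarse_wiring k G H f \<longleftrightarrow>
     wiring G H f \<and>
     (\<forall>v'\<in>verts H. card {v \<in> verts G. f (vertex_pt v) = vertex_pt v'} \<le> k) \<and>
     (\<forall>e'\<in>edges H. card {e \<in> edges G. cell e' \<subseteq> f ` cell e} \<le> k)"

definition wiring_image ::
    "'a graph \<Rightarrow> 'b graph \<Rightarrow> (('a \<Rightarrow> real) \<Rightarrow> ('b \<Rightarrow> real)) \<Rightarrow> 'b graph" where
  "wiring_image G H f =
     \<lparr>verts = {v' \<in> verts H. vertex_pt v' \<in> f ` realisation G},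
      edges = {e' \<in> edges H. \<exists>e\<in>edges G. cell e' \<subseteq> f ` cell e}\<rparr>"

definition volume ::
    "'a graph \<Rightarrow> 'b graph \<Rightarrow> (('a \<Rightarrow> real) \<Rightarrow> ('b \<Rightarrow> real)) \<Rightarrow> nat" where
  "volume G H f = card (verts (wiring_image G H f))"

text \<open>The infimum is attained, or is \<open>\<infinity>\<close> if there is no coarse \<open>k\<close>-wiring.\<close>

definition wir :: "nat \<Rightarrow> 'a graph \<Rightarrow> 'b graph \<Rightarrow> enat" where
  "wir k G H = (INF f\<in>{f. coarse_wiring k G H f}. enat (volume G H f))"

definition wir_profile :: "nat \<Rightarrow> 'a graph \<Rightarrow> 'b graph \<Rightarrow> nat \<Rightarrow> enat" where
  "wir_profile k X Y n =
     (SUP G\<in>{G. subgraph G X \<and> finite (verts G) \<and> card (verts G) \<le> n}. wir k G Y)"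


section \<open>Comparison of growth\<close>

text \<open>
  The functions take values in the extended reals since a wiring profile may take the value \<open>\<infinity>\<close>.
  If \<open>growth_le f g\<close> and \<open>g\<close> is finite, then so is \<open>f\<close>.
\<close>

definition growth_le :: "(nat \<Rightarrow> ereal) \<Rightarrow> (nat \<Rightarrow> ereal) \<Rightarrow> bool" where
  "growth_le f g \<longleftrightarrow> (\<exists>C::nat. \<forall>n. f n \<le> ereal (real C) * g (C * n) + ereal (real C))"

definition growth_eq :: "(nat \<Rightarrow> ereal) \<Rightarrow> (nat \<Rightarrow> ereal) \<Rightarrow> bool" where
  "growth_eq f g \<longleftrightarrow> growth_le f g \<and> growth_le g f"


section \<open>Quasi-isometries\<close>

definition quasi_isometric ::
    "'a set \<Rightarrow> ('a \<Rightarrow> 'a \<Rightarrow> real) \<Rightarrow> 'b set \<Rightarrow> ('b \<Rightarrow> 'b \<Rightarrow> real) \<Rightarrow> bool" where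
  "quasi_isometric M d M' d' \<longleftrightarrow>
     (\<exists>f\<in>M \<rightarrow> M'. \<exists>L\<ge>1. \<exists>C\<ge>0.
        (\<forall>x\<in>M. \<forall>y\<in>M. d x y / L - C \<le> d' (f x) (f y) \<and> d' (f x) (f y) \<le> L * d x y + C) \<and>
        (\<forall>z\<in>M'. \<exists>x\<in>M. d' (f x) z \<le> C))"

definition walk_between :: "'a graph \<Rightarrow> 'a \<Rightarrow> 'a \<Rightarrow> 'a list \<Rightarrow> bool" where
  "walk_between G u v w \<longleftrightarrow> is_walk G w \<and> hd w = u \<and> last w = v"

definition connected_graph :: "'a graph \<Rightarrow> bool" where
  "connected_graph G \<longleftrightarrow> (\<forall>u\<in>verts G. \<forall>v\<in>verts G. \<exists>w. walk_between G u v w)"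

definition graph_dist :: "'a graph \<Rightarrow> 'a \<Rightarrow> 'a \<Rightarrow> real" where
  "graph_dist G u v = real (LEAST n. \<exists>w. walk_between G u v w \<and> length w = Suc n)"

text \<open>
  A graph carries the shortest path metric.  Its vertex set is coarsely dense in its
  realisation, so it suffices to consider vertices.  A graph that is not connected has
  infinite distances and is not quasi-isometric to a metric space.
\<close>

definition graph_quasi_isometric_to ::
    "'a graph \<Rightarrow> 'b set \<Rightarrow> ('b \<Rightarrow> 'b \<Rightarrow> real) \<Rightarrow> bool" where
  "graph_quasi_isometric_to G M d \<longleftrightarrow>
     connected_graph G \<and> quasi_isometric (verts G) (graph_dist G) M d"

text \<open>The upper half-plane model of the real hyperbolic plane (curvature \<open>-1\<close>).\<close>

definition hyp_plane :: "complex set" where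
  "hyp_plane = {z. 0 < Im z}"

definition hyp_dist :: "complex \<Rightarrow> complex \<Rightarrow> real" where
  "hyp_dist z w = arcosh (1 + (cmod (z - w))\<^sup>2 / (2 * Im z * Im w))"

end

theory Submission
  imports Defs
begin

text \<open>
  \<^emph>\<open>Lower bounds.\<close> \<open>X(d)\<close> contains graphs with \<open>O(r)\<close> vertices in which every balanced cut has at
  least \<open>r / 3\<close> edges.  Given a coarse wiring of such a graph with image \<open>I\<close>, every region of the
  target that contains a balanced portion of the image points of the vertices must have many boundary
  points in \<open>I\<close>.  In the Euclidean plane some balanced region has \<open>O(sqrt (card I))\<close> boundary points
  in \<open>I\<close>, in the hyperbolic plane \<open>O(log (card I))\<close>; so \<open>card I\<close> is at least of order \<open>r\<^sup>2\<close> and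
  \<open>exp (c * r)\<close>, respectively.

  \<^emph>\<open>Upper bounds.\<close> In a grid every edge of the wired graph gets a row of its own.  The rows have length
  \<open>n\<close> in the Euclidean plane; in the hyperbolic plane they grow exponentially with the depth.
\<close>

section \<open>Expanding permutations\<close>

text \<open>The cut-rich graphs come from counting: among 22-tuples of permutations of
  \<open>768 * r\<close> points, those that fail on some balanced set are too few to be all tuples.
  The regular graph that such a tuple defines has too large a degree for \<open>d = 3\<close>, so it
  is blown up, which costs a factor 3 in the size of cuts. The fraction 1/64 in the notion of
  balance is dictated by the separators. A heavy box of smallest scale cannot be cut off as it
  stands; it has to be enlarged until its boundary meets few image points. The enlarged region is
  covered by nine squares with less than 4/64 of the weight each in the Euclidean plane, and by
  three boxes with less than 3/64 each in the hyperbolic one. Both totals leave far more than 1/64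
  outside. The target graphs are known only up to quasi-isometry. Hence the geometry is reduced to
  two facts that survive: a step along an edge has bounded size, and a region of bounded size
  contains boundedly many vertices.\<close>

lemma exists_permutes_image_eq:
  assumes "finite U" "S \<subseteq> U" "T \<subseteq> U" "card S = card T"
  shows "\<exists>\<sigma>. \<sigma> permutes U \<and> \<sigma> ` S = T"
proof -
  have fin: "finite S" "finite T" using assms finite_subset by auto
  obtain h1 where h1: "bij_betw h1 S T"
    using finite_same_card_bij[OF fin assms(4)] by blast
  have "card (U - S) = card (U - T)"
    using assms fin by (simp add: card_Diff_subset)
  then obtain h2 where h2: "bij_betw h2 (U - S) (U - T)"
    using finite_same_card_bij[of "U - S" "U - T"] assms(1) by auto
  define \<sigma> where "\<sigma> x = (if x \<in> S then h1 x else if x \<in> U then h2 x else x)" for x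
  have b1: "bij_betw \<sigma> S T"
    using h1 by (subst bij_betw_cong[of _ _ h1]) (auto simp: \<sigma>_def)
  have b2: "bij_betw \<sigma> (U - S) (U - T)"
    using h2 by (subst bij_betw_cong[of _ _ h2]) (auto simp: \<sigma>_def)
  have "bij_betw \<sigma> (S \<union> (U - S)) (T \<union> (U - T))"
    by (rule bij_betw_combine[OF b1 b2]) auto
  moreover have "S \<union> (U - S) = U" "T \<union> (U - T) = U" using assms by auto
  ultimately have "bij_betw \<sigma> U U" by simp
  then have "\<sigma> permutes U"
    by (rule bij_imp_permutes) (use assms(2) in \<open>auto simp: \<sigma>_def\<close>)
  moreover have "\<sigma> ` S = T" using b1 by (simp add: bij_betw_def)
  ultimately show ?thesis by blast
qed

text \<open>The permutations of \<open>U\<close> are partitioned by the image of \<open>S\<close>.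
  Composition with a permutation that carries one candidate image to another embeds one class into
  the other, so all \<open>card U choose card S\<close> classes have equal size. The product form
  avoids division.\<close>

lemma card_permutes_image_eq:
  assumes "finite U" "S \<subseteq> U" "T \<subseteq> U" "card T = card S"
  shows "card {p. p permutes U \<and> p ` S = T} * (card U choose card S) = fact (card U)"
proof -
  define N where "N T = {p. p permutes U \<and> p ` S = T}" for T
  define \<T> where "\<T> = {T'. T' \<subseteq> U \<and> card T' = card S}"
  have finT: "finite \<T>" unfolding \<T>_def using assms(1) by simp
  have finN: "finite (N T')" for T'
    unfolding N_def using finite_permutations[OF assms(1)] by (rule rev_finite_subset) auto
  have le: "card (N T1) \<le> card (N T2)" if T12: "T1 \<in> \<T>" "T2 \<in> \<T>" for T1 T2
  proof -
    obtain \<sigma> where \<sigma>: "\<sigma> permutes U" "\<sigma> ` T1 = T2"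
      using exists_permutes_image_eq[OF assms(1), of T1 T2] T12 unfolding \<T>_def by force
    have "inj \<sigma>" using \<sigma>(1) by (rule permutes_inj)
    have "inj_on (\<lambda>p. \<sigma> \<circ> p) (N T1)"
      using \<open>inj \<sigma>\<close> by (auto simp: inj_on_def fun_eq_iff)
    moreover have "(\<lambda>p. \<sigma> \<circ> p) ` N T1 \<subseteq> N T2"
      using \<sigma> by (auto simp: N_def permutes_compose image_comp[symmetric])
    ultimately show ?thesis using finN card_inj_on_le by blast
  qed
  have T: "T \<in> \<T>" using assms by (simp add: \<T>_def)
  have eq: "card (N T') = card (N T)" if "T' \<in> \<T>" for T'
    using le[OF that T] le[OF T that] by simp
  have "{p. p permutes U} = (\<Union>T'\<in>\<T>. N T')"
  proof (intro set_eqI iffI)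
    fix p assume "p \<in> {p. p permutes U}"
    then have p: "p permutes U" by simp
    have "p ` S \<subseteq> U" using p assms(2) by (metis image_mono permutes_image)
    moreover have "card (p ` S) = card S" using p by (intro card_image permutes_inj_on)
    ultimately show "p \<in> (\<Union>T'\<in>\<T>. N T')" using p by (auto simp: N_def \<T>_def)
  qed (auto simp: N_def)
  then have "fact (card U) = card (\<Union>T'\<in>\<T>. N T')"
    using card_permutations[OF refl assms(1)] by simp
  also have "\<dots> = (\<Sum>T'\<in>\<T>. card (N T'))"
    by (rule card_UN_disjoint) (auto simp: finT finN, auto simp: N_def)
  also have "\<dots> = card \<T> * card (N T)" using eq by simp
  also have "card \<T> = card U choose card S"
    unfolding \<T>_def by (rule n_subsets[OF assms(1)])
  finally show ?thesis by (simp add: N_def mult.commute)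
qed

text \<open>Chernoff-type bound: a subset \<open>X\<close> gets weight \<open>c ^ (card U - card X)\<close>.\<close>

lemma card_small_subsets_le:
  fixes c :: nat
  assumes "finite U" "c > 0"
  shows "card {X. X \<subseteq> U \<and> card X \<le> t} * c ^ (card U - t) \<le> (c + 1) ^ card U"
proof -
  have "card {X. X \<subseteq> U \<and> card X \<le> t} * c ^ (card U - t)
      = (\<Sum>X\<in>{X. X \<subseteq> U \<and> card X \<le> t}. c ^ (card U - t))" by simp
  also have "\<dots> \<le> (\<Sum>X\<in>{X. X \<subseteq> U \<and> card X \<le> t}. c ^ (card U - card X))"
    using assms(2) by (intro sum_mono power_increasing) auto
  also have "\<dots> \<le> (\<Sum>X\<in>Pow U. c ^ (card U - card X))"
    using assms(1) by (intro sum_mono2) auto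
  also have "\<dots> = (\<Sum>X\<in>Pow U. (\<Prod>x\<in>X. 1) * (\<Prod>x\<in>U - X. c))"
    using assms(1) by (intro sum.cong) (auto simp: card_Diff_subset finite_subset)
  also have "\<dots> = (\<Prod>x\<in>U. 1 + c)"
    by (rule prod_add[OF assms(1), symmetric])
  finally show ?thesis by (simp add: add.commute)
qed

text \<open>In terms of probability: a random permutation moves at most \<open>r\<close> points of
  \<open>S\<close> out of \<open>S\<close> with probability at most 1 / 8 ^ (12 r). At most 8 ^ (12
  r) sets are that close to \<open>S\<close>, each is the image of \<open>S\<close> with probability
  at most 1 / 64 ^ (12 r), and 64 = 8 * 8.\<close>

lemma card_bad_permutations_le:
  fixes r :: nat
  assumes r: "r > 0" and S: "S \<subseteq> {..<768 * r}" "12 * r \<le> card S" "card S \<le> 756 * r"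
  shows "card {p. p permutes {..<768 * r} \<and> card (p ` S - S) \<le> r} * 8 ^ (12 * r)
    \<le> fact (768 * r)"
proof -
  define U where "U = {..<768 * r}"
  have U: "finite U" "card U = 768 * r" by (auto simp: U_def)
  have SU: "S \<subseteq> U" using S by (simp add: U_def)
  have finS: "finite S" using SU U(1) finite_subset by blast
  define \<T> where "\<T> = {T. T \<subseteq> U \<and> card T = card S \<and> card (T - S) \<le> r}"
  have cT: "card \<T> \<le> 8 ^ (12 * r)"
  proof -
    \<comment> \<open>A set \<open>T\<close> is recovered from its symmetric difference with
      \<open>S\<close>. As \<open>card T = card S\<close>, the two halves of this difference are
      equally large, so it has at most \<open>2 * r\<close> elements.\<close>
    define D where "D T = (T - S) \<union> (S - T)" for T
    have "inj_on D \<T>" by (auto simp: inj_on_def D_def)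
    moreover have "D ` \<T> \<subseteq> {X. X \<subseteq> U \<and> card X \<le> 2 * r}"
    proof safe
      fix T x assume T: "T \<in> \<T>"
      then have finT: "finite T" and cT: "card T = card S" using U(1) finite_subset
        by (auto simp: \<T>_def)
      show "x \<in> D T \<Longrightarrow> x \<in> U" using T SU by (auto simp: D_def \<T>_def)
      have "card (T - S) = card (S - T)"
        using card_Diff_subset_Int[of T S] card_Diff_subset_Int[of S T] finT finS cT
        by (simp add: Int_commute)
      then have "card (D T) \<le> 2 * card (T - S)"
        unfolding D_def by (metis card_Un_le mult_2)
      then show "card (D T) \<le> 2 * r" using T by (simp add: \<T>_def)
    qed
    moreover have "finite {X. X \<subseteq> U \<and> card X \<le> 2 * r}" using U(1) by simp
    ultimately have 1: "card \<T> \<le> card {X. X \<subseteq> U \<and> card X \<le> 2 * r}"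
      using card_inj_on_le by blast
    \<comment> \<open>Weight 64 in the Chernoff bound: (65 / 64) ^ 64 is close to e and so below 4,
      which contributes 4 ^ (12 r) because 768 = 64 * 12; and 64 ^ (2 r) = 2 ^ (12 r).\<close>
    have e1: "768 * r - 2 * r = 766 * r" by simp
    have e2: "(65::nat) ^ (768 * r) = (65 ^ 64) ^ (12 * r)"
      by (simp only: power_mult[symmetric] mult.assoc[symmetric]) simp
    have e3: "(64::nat) ^ (2 * r) = 2 ^ (12 * r)"
      using power_mult[of "2::nat" 6 "2 * r"] by simp
    have "card {X. X \<subseteq> U \<and> card X \<le> 2 * r} * 64 ^ (766 * r) \<le> 65 ^ (768 * r)"
      using card_small_subsets_le[OF U(1), of 64 "2 * r"] unfolding U(2) e1 by (simp only: numeral_plus_one) simp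
    also have "\<dots> \<le> (4 * 64 ^ 64) ^ (12 * r)" unfolding e2 by (rule power_mono) simp_all
    also have "\<dots> = 4 ^ (12 * r) * 64 ^ (2 * r + 766 * r)"
      by (simp only: power_mult_distrib power_mult[symmetric] mult.assoc[symmetric]) simp
    also have "\<dots> = 8 ^ (12 * r) * 64 ^ (766 * r)"
      unfolding power_add e3 by (simp only: mult.assoc[symmetric] power_mult_distrib[symmetric]) simp
    finally have "card {X. X \<subseteq> U \<and> card X \<le> 2 * r} \<le> 8 ^ (12 * r)"
      by simp
    with 1 show ?thesis by simp
  qed
  have choose: "64 ^ (12 * r) \<le> card U choose card S"
  proof -
    have "(of_nat (768 * r) / of_nat (12 * r)) ^ (12 * r) \<le> (of_nat (768 * r choose (12 * r)) :: real)"
      by (rule binomial_ge_n_over_k_pow_k) simp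
    then have "real (64 ^ (12 * r)) \<le> real (768 * r choose (12 * r))" using r by simp
    then have 1: "64 ^ (12 * r) \<le> 768 * r choose (12 * r)" by linarith
    have "768 * r choose (12 * r) \<le> 768 * r choose card S"
    proof (cases "2 * card S \<le> 768 * r")
      case True
      then show ?thesis by (intro binomial_mono S)
    next
      case False
      have "768 * r choose (12 * r) \<le> 768 * r choose (768 * r - card S)"
        by (rule binomial_mono) (use S False in linarith)+
      also have "\<dots> = 768 * r choose card S"
        using S by (subst binomial_symmetric[of "card S"]) auto
      finally show ?thesis .
    qed
    with 1 show ?thesis by (simp add: U)
  qed
  have N: "card {p. p permutes U \<and> p ` S = T} * 64 ^ (12 * r) \<le> fact (768 * r)" if "T \<in> \<T>" for T
  proof -
    have "card {p. p permutes U \<and> p ` S = T} * 64 ^ (12 * r)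
      \<le> card {p. p permutes U \<and> p ` S = T} * (card U choose card S)"
      using choose by simp
    also have "\<dots> = fact (768 * r)"
      using card_permutes_image_eq[OF U(1) SU, of T] that U(2) by (simp add: \<T>_def)
    finally show ?thesis .
  qed
  have "{p. p permutes U \<and> card (p ` S - S) \<le> r} \<subseteq> (\<Union>T\<in>\<T>. {p. p permutes U \<and> p ` S = T})"
  proof safe
    fix p assume p: "p permutes U" "card (p ` S - S) \<le> r"
    have "p ` S \<subseteq> U" using p(1) SU by (metis image_mono permutes_image)
    moreover have "card (p ` S) = card S" using p(1) by (intro card_image permutes_inj_on)
    ultimately show "p \<in> (\<Union>T\<in>\<T>. {p. p permutes U \<and> p ` S = T})"
      using p by (auto simp: \<T>_def)
  qed
  moreover have finT: "finite \<T>" unfolding \<T>_def using U(1) by simp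
  moreover have "finite {p. p permutes U \<and> p ` S = T}" for T
    using finite_permutations[OF U(1)] by (rule rev_finite_subset) auto
  ultimately have "card {p. p permutes U \<and> card (p ` S - S) \<le> r}
    \<le> card (\<Union>T\<in>\<T>. {p. p permutes U \<and> p ` S = T})"
    by (intro card_mono) auto
  also have "\<dots> \<le> (\<Sum>T\<in>\<T>. card {p. p permutes U \<and> p ` S = T})"
    by (rule card_UN_le[OF finT])
  finally have "card {p. p permutes U \<and> card (p ` S - S) \<le> r} * 64 ^ (12 * r)
    \<le> (\<Sum>T\<in>\<T>. card {p. p permutes U \<and> p ` S = T} * 64 ^ (12 * r))"
    by (simp add: sum_distrib_right[symmetric])
  also have "\<dots> \<le> card \<T> * fact (768 * r)"
    using sum_bounded_above[of \<T>, OF N] by simp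
  also have "\<dots> \<le> 8 ^ (12 * r) * fact (768 * r)" using cT by simp
  finally have "(card {p. p permutes U \<and> card (p ` S - S) \<le> r} * 8 ^ (12 * r)) * 8 ^ (12 * r)
     \<le> fact (768 * r) * 8 ^ (12 * r)"
    by (simp only: mult.assoc power_mult_distrib[symmetric]) (simp add: mult.commute)
  then show ?thesis by (simp add: U_def)
qed

text \<open>Union bound over at most \<open>2 ^ (768 * r)\<close> sets \<open>B\<close>. All 22
  permutations fail on a given \<open>B\<close> for a share of at most 1 / 8 ^ (12 * 22 r) = 1 / 2 ^
  (792 r) of the tuples; 22 is the least number whose product with 36 exceeds 768. The bounds
  \<open>12 * r\<close> and \<open>756 * r\<close> are 1/64 and 63/64 of all points.\<close>

lemma exists_expanding_permutations:
  fixes r :: nat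
  assumes r: "r > 0"
  shows "\<exists>\<pi> :: nat \<Rightarrow> nat \<Rightarrow> nat. (\<forall>s<22. \<pi> s permutes {..<768 * r}) \<and>
    (\<forall>B\<subseteq>{..<768 * r}. 12 * r \<le> card B \<longrightarrow> card B \<le> 756 * r \<longrightarrow>
      (\<exists>s<22. r < card (\<pi> s ` B - B)))"
proof -
  define U where "U = {..<768 * r}"
  define P where "P = {p. p permutes U}"
  define Bad where "Bad B = {p. p permutes U \<and> card (p ` B - B) \<le> r}" for B
  define \<B> where "\<B> = {B. B \<subseteq> U \<and> 12 * r \<le> card B \<and> card B \<le> 756 * r}"
  have finP: "finite P" unfolding P_def by (rule finite_permutations) (simp add: U_def)
  have cP: "card P = fact (768 * r)" unfolding P_def
    by (rule card_permutations) (auto simp: U_def)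
  have Bad: "Bad B \<subseteq> P" for B by (auto simp: Bad_def P_def)
  then have finBad: "finite (Bad B)" for B using finP finite_subset by blast
  have finB: "finite \<B>" by (simp add: \<B>_def U_def)
  have "card \<B> \<le> card (Pow U)" by (rule card_mono) (auto simp: \<B>_def U_def)
  also have "\<dots> = 2 ^ (768 * r)" by (simp add: card_Pow U_def)
  finally have cB: "card \<B> \<le> 2 ^ (768 * r)" .
  have "\<not> ({..<22::nat} \<rightarrow>\<^sub>E P \<subseteq> (\<Union>B\<in>\<B>. {..<22} \<rightarrow>\<^sub>E Bad B))"
  proof
    assume "{..<22::nat} \<rightarrow>\<^sub>E P \<subseteq> (\<Union>B\<in>\<B>. {..<22} \<rightarrow>\<^sub>E Bad B)"
    then have "card ({..<22::nat} \<rightarrow>\<^sub>E P) \<le> card (\<Union>B\<in>\<B>. {..<22::nat} \<rightarrow>\<^sub>E Bad B)"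
      by (intro card_mono finite_UN_I finite_PiE) (auto simp: finB finBad)
    also have "\<dots> \<le> (\<Sum>B\<in>\<B>. card ({..<22::nat} \<rightarrow>\<^sub>E Bad B))"
      by (rule card_UN_le[OF finB])
    finally have "fact (768 * r) ^ 22 \<le> (\<Sum>B\<in>\<B>. card (Bad B) ^ 22)"
      by (simp add: card_PiE cP)
    then have "fact (768 * r) ^ 22 * (8 ^ (12 * r)) ^ 22
      \<le> (\<Sum>B\<in>\<B>. card (Bad B) ^ 22) * (8 ^ (12 * r)) ^ 22"
      by (rule mult_right_mono) simp
    also have "\<dots> = (\<Sum>B\<in>\<B>. (card (Bad B) * 8 ^ (12 * r)) ^ 22)"
      by (simp add: sum_distrib_right power_mult_distrib)
    also have "\<dots> \<le> (\<Sum>B\<in>\<B>. fact (768 * r) ^ 22)"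
      using card_bad_permutations_le[OF r]
      by (intro sum_mono power_mono) (auto simp: \<B>_def Bad_def U_def)
    also have "\<dots> \<le> 2 ^ (768 * r) * fact (768 * r) ^ 22" using cB by simp
    finally have "(8 ^ (12 * r)) ^ 22 \<le> (2 ^ (768 * r) :: nat)"
      by (simp add: mult.commute)
    moreover have "(8 ^ (12 * r)) ^ 22 = (2 :: nat) ^ (792 * r)"
      using power_mult[of "2::nat" 3 "264 * r"] by (simp flip: power_mult)
    ultimately have "792 * r \<le> 768 * r" by simp
    then show False using r by simp
  qed
  then obtain \<pi> where \<pi>: "\<pi> \<in> {..<22::nat} \<rightarrow>\<^sub>E P" "\<pi> \<notin> (\<Union>B\<in>\<B>. {..<22::nat} \<rightarrow>\<^sub>E Bad B)"
    by (meson subsetI)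
  have 1: "\<pi> s permutes {..<768 * r}" if "s < 22" for s
    using \<pi>(1) that by (auto simp: P_def U_def)
  have "\<exists>s<22. r < card (\<pi> s ` B - B)"
    if B: "B \<subseteq> {..<768 * r}" "12 * r \<le> card B" "card B \<le> 756 * r" for B
  proof (rule ccontr)
    assume "\<not> ?thesis"
    then have "\<pi> s \<in> Bad B" if "s < 22" for s
      using 1[OF that] that unfolding Bad_def U_def by force
    then have "\<pi> \<in> {..<22} \<rightarrow>\<^sub>E Bad B"
      using \<pi>(1) by (intro PiE_I) (auto intro: PiE_arb)
    moreover have "B \<in> \<B>" using B by (simp add: \<B>_def U_def)
    ultimately show False using \<pi>(2) by (meson UN_I)
  qed
  with 1 show ?thesis by (intro exI[of _ \<pi>]) simp
qed

section \<open>Cut expanders in \<open>X(d)\<close>\<close>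

definition cut_edges :: "'a graph \<Rightarrow> 'a set \<Rightarrow> 'a set set" where
  "cut_edges G A = {e \<in> edges G. e \<inter> A \<noteq> {} \<and> e - A \<noteq> {}}"

text \<open>Balance is measured on a marked set \<open>W\<close>, which in the blow-up has one
  vertex on each path, so that a balanced cut induces a balanced subset of the base graph. The
  factor 3 is the loss in the blow-up.\<close>

definition cut_expander :: "'a graph \<Rightarrow> 'a set \<Rightarrow> nat \<Rightarrow> bool" where
  "cut_expander G W r \<longleftrightarrow> W \<subseteq> verts G \<and>
     (\<forall>A. card W \<le> 64 * card (W \<inter> A) \<longrightarrow> card W \<le> 64 * card (W - A) \<longrightarrow>
        r \<le> 3 * card (cut_edges G A))"

lemma finite_edges:
  assumes "is_graph G" "finite (verts G)"
  shows "finite (edges G)"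
proof (rule finite_subset)
  show "edges G \<subseteq> Pow (verts G)" using assms(1) by (auto simp: is_graph_def)
qed (use assms(2) in simp)

section \<open>Transport of graphs along injective relabellings\<close>

definition map_graph :: "('a \<Rightarrow> 'b) \<Rightarrow> 'a graph \<Rightarrow> 'b graph" where
  "map_graph h G = \<lparr>verts = h ` verts G, edges = (`) h ` edges G\<rparr>"

lemma is_graph_map_graph:
  assumes "is_graph G" "inj_on h (verts G)"
  shows "is_graph (map_graph h G)"
  using assms unfolding is_graph_def map_graph_def
  by (auto simp: card_image inj_on_subset)

lemma map_graph_map_graph: "map_graph h' (map_graph h G) = map_graph (h' \<circ> h) G"
  by (simp add: map_graph_def image_comp comp_def image_image)

lemma degree_le_map_graph:
  assumes "is_graph G" "inj_on h (verts G)" "degree_le G d"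
  shows "degree_le (map_graph h G) d"
  unfolding degree_le_def
proof
  fix w assume "w \<in> verts (map_graph h G)"
  then obtain v where v: "v \<in> verts G" "w = h v" by (auto simp: map_graph_def)
  have "{e \<in> edges (map_graph h G). w \<in> e} \<subseteq> (`) h ` {e \<in> edges G. v \<in> e}"
  proof
    fix e assume "e \<in> {e \<in> edges (map_graph h G). w \<in> e}"
    then obtain e' where e': "e = h ` e'" "e' \<in> edges G" "h v \<in> h ` e'"
      using v by (auto simp: map_graph_def)
    have "e' \<subseteq> verts G" using assms(1) e'(2) by (auto simp: is_graph_def)
    then have "v \<in> e'" using e'(3) v(1) assms(2) inj_on_image_mem_iff by metis
    then show "e \<in> (`) h ` {e \<in> edges G. v \<in> e}" using e' by auto
  qed
  moreover have "finite {e \<in> edges G. v \<in> e}" "card {e \<in> edges G. v \<in> e} \<le> d"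
    using assms(3) v by (auto simp: degree_le_def)
  ultimately show "finite {e \<in> edges (map_graph h G). w \<in> e} \<and>
      card {e \<in> edges (map_graph h G). w \<in> e} \<le> d"
    by (meson card_image_le card_mono finite_imageI finite_subset le_trans)
qed

lemma cut_expander_map_graph:
  assumes "is_graph G" "finite (verts G)" "inj_on h (verts G)" "cut_expander G W r"
  shows "cut_expander (map_graph h G) (h ` W) r"
  unfolding cut_expander_def
proof (intro conjI allI impI)
  have W: "W \<subseteq> verts G" using assms(4) by (simp add: cut_expander_def)
  then show "h ` W \<subseteq> verts (map_graph h G)" by (auto simp: map_graph_def)
  have injW: "inj_on h W" using assms(3) W inj_on_subset by blast
  fix A
  have 1: "h ` W \<inter> A = h ` (W \<inter> (h -` A))" "h ` W - A = h ` (W - (h -` A))" by auto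
  have 2: "card (h ` W) = card W" "card (h ` W \<inter> A) = card (W \<inter> (h -` A))"
    "card (h ` W - A) = card (W - (h -` A))"
    unfolding 1 using injW by (auto intro!: card_image intro: inj_on_subset)
  assume "card (h ` W) \<le> 64 * card (h ` W \<inter> A)" "card (h ` W) \<le> 64 * card (h ` W - A)"
  then have "r \<le> 3 * card (cut_edges G (h -` A))"
    using assms(4) unfolding cut_expander_def 2 by blast
  also have "card (cut_edges G (h -` A)) \<le> card (cut_edges (map_graph h G) A)"
  proof (rule card_inj_on_le)
    show "inj_on ((`) h) (cut_edges G (h -` A))"
    proof (rule inj_on_subset)
      show "inj_on ((`) h) (Pow (verts G))" using assms(3) by (rule inj_on_image_Pow)
      show "cut_edges G (h -` A) \<subseteq> Pow (verts G)"
        using assms(1) by (auto simp: cut_edges_def is_graph_def)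
    qed
    show "(`) h ` cut_edges G (h -` A) \<subseteq> cut_edges (map_graph h G) A"
      by (fastforce simp: cut_edges_def map_graph_def)
    show "finite (cut_edges (map_graph h G) A)"
      using finite_edges[OF assms(1,2)] by (simp add: cut_edges_def map_graph_def)
  qed
  finally show "r \<le> 3 * card (cut_edges (map_graph h G) A)" by simp
qed

text \<open>The embedding is a composite of three injections: into the natural numbers, to the
  representative of the isomorphism class, and into the tagged copy within the disjoint union. The
  second is extracted from \<open>graph_iso\<close>, which is all that is known about the chosen
  representative.\<close>

lemma embed_in_X_graph:
  fixes G :: "'a graph"
  assumes "is_graph G" "finite (verts G)" "degree_le G d"
  obtains h where "inj_on h (verts G)" "subgraph (map_graph h G) (X_graph d)"
proof -
  obtain h1 :: "'a \<Rightarrow> nat" where h1: "inj_on h1 (verts G)"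
    using finite_imp_inj_to_nat_seg[OF assms(2)] by auto
  define G1 where "G1 = map_graph h1 G"
  have G1: "is_graph G1" "finite (verts G1)" "degree_le G1 d"
    unfolding G1_def using assms h1
    by (auto simp: is_graph_map_graph degree_le_map_graph) (simp add: map_graph_def)
  have "graph_iso G1 G1" unfolding graph_iso_def by (rule exI[of _ id]) simp
  then have "graph_iso G1 (iso_rep G1)" unfolding iso_rep_def by (rule someI)
  then obtain h2 where h2: "bij_betw h2 (verts G1) (verts (iso_rep G1))"
    "edges (iso_rep G1) = (`) h2 ` edges G1" unfolding graph_iso_def by blast
  have rep: "iso_rep G1 \<in> finite_graph_reps d"
    unfolding finite_graph_reps_def using G1 by blast
  define h where "h = Pair (iso_rep G1) \<circ> h2 \<circ> h1"
  have eq: "map_graph h G = map_graph (Pair (iso_rep G1)) (iso_rep G1)"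
    using h2 by (simp add: h_def map_graph_map_graph[symmetric] G1_def[symmetric])
       (simp add: map_graph_def bij_betw_def)
  have "inj_on h2 (h1 ` verts G)"
    using h2(1) by (simp add: bij_betw_def G1_def map_graph_def)
  then have inj: "inj_on h (verts G)"
    unfolding h_def using h1 by (intro comp_inj_on) (auto intro: inj_onI)
  have "subgraph (map_graph h G) (X_graph d)"
    unfolding subgraph_def
  proof (intro conjI)
    show "is_graph (map_graph h G)" using assms(1) inj by (rule is_graph_map_graph)
    show "verts (map_graph h G) \<subseteq> verts (X_graph d)"
      unfolding eq using rep by (simp add: map_graph_def X_graph_def disjoint_union_def) blast
    show "edges (map_graph h G) \<subseteq> edges (X_graph d)"
      unfolding eq using rep by (simp add: map_graph_def X_graph_def disjoint_union_def) blast
  qed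
  with inj show thesis by (rule that)
qed

lemma X_graph_subgraph_degree_le:
  assumes "subgraph G (X_graph d)" "finite (verts G)"
  shows "degree_le G d"
proof -
  have iso: "degree_le (iso_rep G0) d \<and> is_graph (iso_rep G0)"
    if G0: "is_graph G0" "finite (verts G0)" "degree_le G0 d" for G0
  proof -
    have "graph_iso G0 G0" unfolding graph_iso_def by (rule exI[of _ id]) simp
    then have "graph_iso G0 (iso_rep G0)" unfolding iso_rep_def by (rule someI)
    then obtain h where h: "bij_betw h (verts G0) (verts (iso_rep G0))"
      "edges (iso_rep G0) = (`) h ` edges G0" unfolding graph_iso_def by blast
    then have "iso_rep G0 = map_graph h G0" by (simp add: map_graph_def bij_betw_def)
    moreover have "inj_on h (verts G0)" using h by (simp add: bij_betw_def)
    ultimately show ?thesis using G0 by (simp add: degree_le_map_graph is_graph_map_graph)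
  qed
  show ?thesis
    unfolding degree_le_def
  proof
    fix x assume x: "x \<in> verts G"
    then have "x \<in> verts (X_graph d)" using assms(1) by (auto simp: subgraph_def)
    then obtain H v where H: "x = (H, v)" "H \<in> finite_graph_reps d" "v \<in> verts H"
      by (auto simp: X_graph_def disjoint_union_def)
    have degH: "degree_le H d" using H(2) iso by (auto simp: finite_graph_reps_def)
    have fin: "finite {e \<in> edges H. v \<in> e}" "card {e \<in> edges H. v \<in> e} \<le> d"
      using degH H(3) by (auto simp: degree_le_def)
    have "{e \<in> edges G. x \<in> e} \<subseteq> (`) (Pair H) ` {e \<in> edges H. v \<in> e}"
    proof
      fix e assume "e \<in> {e \<in> edges G. x \<in> e}"
      then have e: "e \<in> edges (X_graph d)" "x \<in> e" using assms(1) by (auto simp: subgraph_def)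
      then obtain H' e' where "e = Pair H' ` e'" "H' \<in> finite_graph_reps d" "e' \<in> edges H'"
        by (auto simp: X_graph_def disjoint_union_def)
      with e H(1) show "e \<in> (`) (Pair H) ` {e \<in> edges H. v \<in> e}" by auto
    qed
    then show "finite {e \<in> edges G. x \<in> e} \<and> card {e \<in> edges G. x \<in> e} \<le> d"
      using fin by (meson card_image_le card_mono finite_imageI finite_subset le_trans)
  qed
qed

text \<open>
  Every vertex of the 44-regular graph given by 22 permutations is blown up to a path with 44
  vertices, one for each incident edge, which brings the degree down to 3.
\<close>

definition blowup_graph :: "(nat \<Rightarrow> nat \<Rightarrow> nat) \<Rightarrow> nat \<Rightarrow> (nat \<times> nat) graph" where
  "blowup_graph \<pi> n = \<lparr>verts = {..<n} \<times> {..<44},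
     edges = {{(i, p), (i, Suc p)} |i p. i < n \<and> Suc p < 44} \<union>
             {{(i, s), (\<pi> s i, 22 + s)} |i s. i < n \<and> s < 22}\<rparr>"

lemma blowup_graph:
  assumes \<pi>: "\<And>s. s < 22 \<Longrightarrow> \<pi> s permutes {..<n}"
  shows "is_graph (blowup_graph \<pi> n)" "degree_le (blowup_graph \<pi> n) 3"
    "finite (verts (blowup_graph \<pi> n))" "card (verts (blowup_graph \<pi> n)) = 44 * n"
proof -
  have \<pi>': "\<pi> s i < n" if "s < 22" "i < n" for s i
    using permutes_in_image[OF \<pi>[OF that(1)], of i] that(2) by simp
  show "is_graph (blowup_graph \<pi> n)"
    using \<pi>' by (auto simp: is_graph_def blowup_graph_def card_insert_if)
  show "finite (verts (blowup_graph \<pi> n))" "card (verts (blowup_graph \<pi> n)) = 44 * n"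
    by (auto simp: blowup_graph_def)
  show "degree_le (blowup_graph \<pi> n) 3"
    unfolding degree_le_def
  proof
    fix v assume "v \<in> verts (blowup_graph \<pi> n)"
    obtain i p where v: "v = (i, p)" by (cases v)
    \<comment> \<open>The three candidates for an edge at \<open>(i, p)\<close>: two along the path
      and one outer edge, outgoing at positions below 22 and incoming at the others. For
      \<open>p = 0\<close> the second entry degenerates to a singleton, which is harmless in an
      upper bound.\<close>
    define E where "E = [{(i, p), (i, Suc p)}, {(i, p - 1), (i, p)},
        if p < 22 then {(i, p), (\<pi> p i, 22 + p)} else {(inv (\<pi> (p - 22)) i, p - 22), (i, p)}]"
    have "{e \<in> edges (blowup_graph \<pi> n). v \<in> e} \<subseteq> set E"
    proof
      fix e assume "e \<in> {e \<in> edges (blowup_graph \<pi> n). v \<in> e}"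
      then have e: "e \<in> edges (blowup_graph \<pi> n)" "v \<in> e" by auto
      then consider j q where "e = {(j, q), (j, Suc q)}"
        | j s where "j < n" "s < 22" "e = {(j, s), (\<pi> s j, 22 + s)}"
        by (auto simp: blowup_graph_def)
      then show "e \<in> set E"
      proof cases
        case 1
        then consider "i = j" "p = q" | "i = j" "p = Suc q" using e(2) by (auto simp: v)
        then have "e = {(i, p), (i, Suc p)} \<or> e = {(i, p - 1), (i, p)}"
          using 1 by cases simp_all
        then show ?thesis unfolding E_def by (elim disjE) simp_all
      next
        case 2
        have inv: "inv (\<pi> s) (\<pi> s j) = j" using permutes_inverses(2)[OF \<pi>[OF 2(2)]] .
        consider "i = j" "p = s" | "i = \<pi> s j" "p = 22 + s" using e(2) 2(3) by (auto simp: v)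
        then show ?thesis
        proof cases
          case 1
          then have "e = {(i, p), (\<pi> p i, 22 + p)}" "p < 22" using 2 by simp_all
          then show ?thesis by (simp add: E_def)
        next
          case 2
          then have "e = {(inv (\<pi> (p - 22)) i, p - 22), (i, p)}" "\<not> p < 22"
            using \<open>e = {(j, s), (\<pi> s j, 22 + s)}\<close> inv by simp_all
          then show ?thesis by (simp add: E_def)
        qed
      qed
    qed
    moreover have "card (set E) \<le> 3" using card_length[of E] by (simp add: E_def)
    ultimately show "finite {e \<in> edges (blowup_graph \<pi> n). v \<in> e} \<and>
        card {e \<in> edges (blowup_graph \<pi> n). v \<in> e} \<le> 3"
      by (meson List.finite_set card_mono finite_subset le_trans)
  qed
qed

text \<open>Call a base vertex impure if its path is cut. Membership in \<open>A\<close> is constant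
  along a pure path, so every \<open>i\<close> in \<open>B\<close> that \<open>\<pi> s\<close> moves
  out of \<open>B\<close> has a cut outer edge unless \<open>i\<close> or its image is impure. Each
  of the three cases covers at most as many \<open>i\<close> as there are cut edges.\<close>

lemma cut_expander_blowup_graph:
  assumes \<pi>: "\<And>s. s < 22 \<Longrightarrow> \<pi> s permutes {..<768 * r}"
    and exp: "\<And>B. B \<subseteq> {..<768 * r} \<Longrightarrow> 12 * r \<le> card B \<Longrightarrow> card B \<le> 756 * r \<Longrightarrow>
      \<exists>s<22. r < card (\<pi> s ` B - B)"
  shows "cut_expander (blowup_graph \<pi> (768 * r)) ({..<768 * r} \<times> {0}) r"
  unfolding cut_expander_def
proof (intro conjI allI impI)
  define n where "n = 768 * r"
  define G where "G = blowup_graph \<pi> n"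
  show "{..<768 * r} \<times> {0} \<subseteq> verts (blowup_graph \<pi> (768 * r))"
    by (auto simp: blowup_graph_def)
  fix A :: "(nat \<times> nat) set"
  define B where "B = {i. i < n \<and> (i, 0) \<in> A}"
  assume "card ({..<768 * r} \<times> {0::nat}) \<le> 64 * card ({..<768 * r} \<times> {0} \<inter> A)"
    "card ({..<768 * r} \<times> {0::nat}) \<le> 64 * card ({..<768 * r} \<times> {0} - A)"
  moreover have "{..<768 * r} \<times> {0} \<inter> A = (\<lambda>i. (i, 0)) ` B"
    "{..<768 * r} \<times> {0} - A = (\<lambda>i. (i, 0)) ` ({..<n} - B)"
    by (auto simp: B_def n_def)
  ultimately have cB: "n \<le> 64 * card B" "n \<le> 64 * card ({..<n} - B)"
    by (simp_all add: card_image inj_on_def n_def card_cartesian_product)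
  have Bn: "B \<subseteq> {..<n}" by (auto simp: B_def)
  have "card ({..<n} - B) = n - card B" using Bn by (simp add: card_Diff_subset finite_subset)
  moreover have "card B \<le> n" using card_mono[OF _ Bn] by simp
  \<comment> \<open>Balance on the marked vertices is exactly the range in which the permutations
    expand: 768 / 64 = 12 and 768 - 12 = 756.\<close>
  ultimately have "12 * r \<le> card B" "card B \<le> 756 * r" using cB by (auto simp: n_def)
  then obtain s where s: "s < 22" "r < card (\<pi> s ` B - B)"
    using exp[of B] Bn unfolding n_def by blast
  define X where "X = cut_edges G A"
  have finX: "finite X" unfolding X_def cut_edges_def
    using finite_edges[of G] blowup_graph[of \<pi> n] \<pi> by (simp add: G_def n_def)
  have \<pi>s: "\<pi> s permutes {..<n}" using \<pi>[OF s(1)] by (simp add: n_def)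
  define outer where "outer i = {(i, s), (\<pi> s i, 22 + s)}" for i
  define impure where "impure = {i. i < n \<and> (\<exists>p. {(i, p), (i, Suc p)} \<in> X)}"
  have pure: "(i, p) \<in> A \<longleftrightarrow> (i, 0) \<in> A" if "i < n" "i \<notin> impure" "p < 44" for i p
    using that(3)
  proof (induction p)
    case (Suc p)
    have "{(i, p), (i, Suc p)} \<notin> X" using that by (auto simp: impure_def)
    moreover have "{(i, p), (i, Suc p)} \<in> edges G"
      using that Suc by (auto simp: G_def blowup_graph_def)
    ultimately have "(i, p) \<in> A \<longleftrightarrow> (i, Suc p) \<in> A" by (auto simp: X_def cut_edges_def)
    then show ?case using Suc by simp
  qed simp
  have impure_le: "card impure \<le> card X"
  proof -
    \<comment> \<open>One cut path edge for each impure vertex; paths of different base vertices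
      share no edge, so the choice is injective.\<close>
    define F where "F i = (SOME e. \<exists>p. e = {(i, p), (i, Suc p)} \<and> e \<in> X)" for i
    have F: "\<exists>p. F i = {(i, p), (i, Suc p)} \<and> F i \<in> X" if "i \<in> impure" for i
      unfolding F_def by (rule someI_ex) (use that in \<open>auto simp: impure_def\<close>)
    have "inj_on F impure"
    proof
      fix i j assume "i \<in> impure" "j \<in> impure" "F i = F j"
      then show "i = j" using F[of i] F[of j] by (auto simp: doubleton_eq_iff)
    qed
    moreover have "F ` impure \<subseteq> X" using F by blast
    ultimately show ?thesis using finX card_inj_on_le by blast
  qed
  define J where "J = {i \<in> B. \<pi> s i \<notin> B}"
  have \<pi>n: "\<pi> s i < n" if "i < n" for i
    using permutes_in_image[OF \<pi>s, of i] that by simp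
  have "\<pi> s ` B - B = \<pi> s ` J" by (auto simp: J_def)
  then have "r < card J" using s(2) card_image_le[of J "\<pi> s"] Bn
    by (metis (no_types, lifting) J_def finite_lessThan finite_subset less_le_trans mem_Collect_eq subsetI)
  moreover have J: "J \<subseteq> {i \<in> J. outer i \<in> X} \<union> impure \<union> {i \<in> J. \<pi> s i \<in> impure}"
  proof
    fix i assume i: "i \<in> J"
    have "i < n" using i Bn by (auto simp: J_def)
    have "outer i \<in> edges G"
      using \<open>i < n\<close> s(1) by (auto simp: G_def blowup_graph_def outer_def)
    moreover have "(i, s) \<in> A" if "i \<notin> impure"
      using pure[of i s] that i s(1) \<open>i < n\<close> by (auto simp: J_def B_def)
    moreover have "(\<pi> s i, 22 + s) \<notin> A" if "\<pi> s i \<notin> impure"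
      using pure[of "\<pi> s i" "22 + s"] that i s(1) \<pi>n[OF \<open>i < n\<close>] by (auto simp: J_def B_def)
    ultimately show "i \<in> {i \<in> J. outer i \<in> X} \<union> impure \<union> {i \<in> J. \<pi> s i \<in> impure}"
      using i by (auto simp: X_def cut_edges_def outer_def)
  qed
  have finJ: "finite J" using Bn finite_subset by (fastforce simp: J_def)
  have fin_imp: "finite impure" by (simp add: impure_def)
  have "card J \<le> card {i \<in> J. outer i \<in> X} + card impure + card {i \<in> J. \<pi> s i \<in> impure}"
    by (rule order_trans[OF card_mono[OF _ J]])
      (use finJ fin_imp in \<open>auto intro!: order_trans[OF card_Un_le] add_mono\<close>)
  moreover have "card {i \<in> J. outer i \<in> X} \<le> card X"
    by (rule card_inj_on_le[of outer])
      (use finX s(1) in \<open>auto simp: inj_on_def outer_def doubleton_eq_iff\<close>)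
  moreover have "card {i \<in> J. \<pi> s i \<in> impure} \<le> card impure"
    by (rule card_inj_on_le[of "\<pi> s"])
      (use fin_imp permutes_inj_on[OF \<pi>s] in \<open>auto intro: inj_on_subset\<close>)
  ultimately have "r \<le> 3 * card X" using impure_le by linarith
  then show "r \<le> 3 * card (cut_edges (blowup_graph \<pi> (768 * r)) A)"
    by (simp add: X_def G_def n_def)
qed

section \<open>Wirings and walk systems\<close>

lemma vertex_pt_eq_iff [simp]: "vertex_pt u = vertex_pt v \<longleftrightarrow> u = v"
proof
  assume "vertex_pt u = vertex_pt v"
  then have "vertex_pt u u = vertex_pt v u" by simp
  then show "u = v" by (simp add: vertex_pt_def indicator_def split: if_splits)
qed simp

lemma cell_doubleton:
  assumes "a \<noteq> b"
  shows "cell {a, b} = (\<lambda>t x. (1 - t) * vertex_pt a x + t * vertex_pt b x) ` {0..1}"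
proof safe
  fix p assume p: "p \<in> cell {a, b}"
  have "p = (\<lambda>x. (1 - p b) * vertex_pt a x + p b * vertex_pt b x)"
  proof
    fix x show "p x = (1 - p b) * vertex_pt a x + p b * vertex_pt b x"
      using p assms by (auto simp: cell_def vertex_pt_def indicator_def)
  qed
  moreover have "0 \<le> p a" "0 \<le> p b" "p a + p b = 1" using p assms by (auto simp: cell_def)
  ultimately show "p \<in> (\<lambda>t x. (1 - t) * vertex_pt a x + t * vertex_pt b x) ` {0..1}"
    by (intro image_eqI[of _ _ "p b"]) auto
next
  fix t :: real assume "t \<in> {0..1}"
  then show "(\<lambda>x. (1 - t) * vertex_pt a x + t * vertex_pt b x) \<in> cell {a, b}"
    using assms by (auto simp: cell_def vertex_pt_def)
qed

lemma vertex_pt_mem_cell: "finite e \<Longrightarrow> vertex_pt v \<in> cell e \<longleftrightarrow> v \<in> e"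
  by (auto simp: cell_def vertex_pt_def indicator_def)

lemma vertex_pt_mem_walk_graph:
  assumes "vertex_pt v \<in> realisation (walk_graph w)"
  shows "v \<in> set w"
  using assms
  by (auto simp: realisation_def walk_graph_def vertex_pt_mem_cell)

text \<open>The midpoint of the cell has two nonzero coordinates. So it is not a vertex, and an edge
  whose cell contains it must have both \<open>a\<close> and \<open>b\<close> as endpoints.\<close>

lemma cell_subset_walk_graph:
  assumes "cell {a, b} \<subseteq> realisation (walk_graph w)" "a \<noteq> b"
  shows "{a, b} \<in> edges (walk_graph w)"
proof -
  define p where "p x = (1 / 2) * vertex_pt a x + (1 / 2) * vertex_pt b x" for x
  have "p \<in> cell {a, b}"
    unfolding cell_doubleton[OF assms(2)] p_def by (rule image_eqI[of _ _ "1 / 2"]) auto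
  then have "p \<in> realisation (walk_graph w)" using assms(1) by blast
  then consider v where "p = vertex_pt v" | e where "e \<in> edges (walk_graph w)" "p \<in> cell e"
    by (auto simp: realisation_def)
  then show ?thesis
  proof cases
    case 1
    then have "p a = vertex_pt v a" by simp
    then show ?thesis using assms(2) by (cases "a = v") (auto simp: p_def vertex_pt_def)
  next
    case 2
    have "p a \<noteq> 0" "p b \<noteq> 0" using assms(2) by (auto simp: p_def vertex_pt_def)
    then have "a \<in> e" "b \<in> e" using 2(2) by (auto simp: cell_def)
    moreover obtain x y where "e = {x, y}" using 2(1) by (auto simp: walk_graph_def)
    ultimately have "e = {a, b}" using assms(2) by auto
    then show ?thesis using 2(1) by simp
  qed
qed

lemma is_walk_nth_edge:
  assumes "is_walk H w" "Suc i < length w"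
  shows "{w ! i, w ! Suc i} \<in> edges H"
  using assms by (auto simp: is_walk_def successively_conv_nth)

lemma walk_crossing:
  assumes "w \<noteq> []" "hd w \<in> R" "last w \<notin> R"
  shows "\<exists>i. Suc i < length w \<and> w ! i \<in> R \<and> w ! Suc i \<notin> R"
  using assms
proof (induction w)
  case (Cons a w)
  show ?case
  proof (cases "w \<noteq> [] \<and> hd w \<in> R")
    case True
    then obtain i where "Suc i < length w" "w ! i \<in> R" "w ! Suc i \<notin> R"
      using Cons by auto
    then show ?thesis by (intro exI[of _ "Suc i"]) auto
  next
    case False
    then show ?thesis using Cons.prems by (intro exI[of _ 0]) (auto simp: hd_conv_nth split: if_splits)
  qed
qed simp

text \<open>The bridge from topology to counting, used by both lower bounds. The walk of a cut edge
  leaves \<open>R\<close> along some edge inside the image, which has an endpoint in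
  \<open>S\<close>. There are at most \<open>D * card (I \<inter> S)\<close> such edges in
  \<open>H\<close>, and each carries at most \<open>k\<close> edges of \<open>G\<close>.\<close>

lemma coarse_wiring_cut:
  assumes G: "is_graph G" "finite (verts G)" and H: "is_graph H" "degree_le H D"
    and f: "coarse_wiring k G H f"
  obtains g I where "finite I" "I \<subseteq> verts H" "card I = volume G H f" "g ` verts G \<subseteq> I"
    and "\<And>x. card {v \<in> verts G. g v = x} \<le> k"
    and "\<And>R S. (\<And>x y. {x, y} \<in> edges H \<Longrightarrow> x \<in> I \<Longrightarrow> y \<in> I \<Longrightarrow> x \<in> R \<Longrightarrow> y \<notin> R \<Longrightarrow> x \<in> S \<or> y \<in> S)
      \<Longrightarrow> card (cut_edges G {v. g v \<in> R}) \<le> k * (D * card (I \<inter> S))"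
proof -
  have fw: "wiring G H f"
    and fv: "\<And>v'. v' \<in> verts H \<Longrightarrow> card {v \<in> verts G. f (vertex_pt v) = vertex_pt v'} \<le> k"
    and fe: "\<And>e'. e' \<in> edges H \<Longrightarrow> card {e \<in> edges G. cell e' \<subseteq> f ` cell e} \<le> k"
    using f by (auto simp: coarse_wiring_def)
  have "\<forall>v\<in>verts G. \<exists>v'. v' \<in> verts H \<and> f (vertex_pt v) = vertex_pt v'"
    using fw by (auto simp: wiring_def)
  then obtain g where g: "\<And>v. v \<in> verts G \<Longrightarrow> g v \<in> verts H"
    "\<And>v. v \<in> verts G \<Longrightarrow> f (vertex_pt v) = vertex_pt (g v)" by metis
  have finE: "finite (edges G)" using G by (rule finite_edges)
  define I where "I = verts (wiring_image G H f)"
  have I: "x \<in> I \<longleftrightarrow> x \<in> verts H \<and> vertex_pt x \<in> f ` realisation G" for x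
    by (auto simp: I_def wiring_image_def)
  have walk: "\<exists>w. is_walk H w \<and> hd w = g u \<and> last w = g v \<and> f ` cell {u, v} = realisation (walk_graph w)"
    if e: "{u, v} \<in> edges G" for u v
  proof -
    have "u \<in> verts G" "v \<in> verts G" using e G(1) by (auto simp: is_graph_def)
    moreover obtain w where "is_walk H w" "f (vertex_pt u) = vertex_pt (hd w)"
      "f (vertex_pt v) = vertex_pt (last w)" "f ` cell {u, v} = realisation (walk_graph w)"
      using fw e unfolding wiring_def by blast
    ultimately show ?thesis using g(2) by auto
  qed
  have "\<forall>e\<in>edges G. \<exists>w. f ` cell e = realisation (walk_graph w)"
  proof
    fix e assume e: "e \<in> edges G"
    then obtain u v where "e = {u, v}" using G(1) by (auto simp: is_graph_def card_2_iff)
    then show "\<exists>w. f ` cell e = realisation (walk_graph w)" using walk e by blast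
  qed
  then obtain W where W: "\<And>e. e \<in> edges G \<Longrightarrow> f ` cell e = realisation (walk_graph (W e))" by metis
  have "I \<subseteq> g ` verts G \<union> (\<Union>e\<in>edges G. set (W e))"
  proof
    fix x assume "x \<in> I"
    then have "vertex_pt x \<in> f ` realisation G" by (simp add: I)
    then consider v where "v \<in> verts G" "vertex_pt x = f (vertex_pt v)"
      | e where "e \<in> edges G" "vertex_pt x \<in> f ` cell e"
      by (auto simp: realisation_def)
    then show "x \<in> g ` verts G \<union> (\<Union>e\<in>edges G. set (W e))"
      by cases (use g W vertex_pt_mem_walk_graph in fastforce)+
  qed
  then have finI: "finite I" using finE G(2) by (meson List.finite_set finite_UN_I finite_Un finite_imageI finite_subset)
  have gI: "g ` verts G \<subseteq> I"
  proof safe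
    fix v assume v: "v \<in> verts G"
    have "vertex_pt (g v) \<in> f ` realisation G"
      using v g(2)[OF v] by (intro image_eqI[of _ _ "vertex_pt v"]) (auto simp: realisation_def)
    then show "g v \<in> I" using g(1)[OF v] by (simp add: I)
  qed
  show thesis
  proof (rule that[of I g])
    show "I \<subseteq> verts H" by (auto simp: I)
    show "card I = volume G H f" by (simp add: I_def volume_def)
    show "card {v \<in> verts G. g v = x} \<le> k" for x
    proof (cases "x \<in> verts H")
      case True
      have "{v \<in> verts G. g v = x} = {v \<in> verts G. f (vertex_pt v) = vertex_pt x}" using g(2) by auto
      then show ?thesis using fv[OF True] by simp
    next
      case False
      then have "{v \<in> verts G. g v = x} = {}" using g(1) by auto
      then show ?thesis by (metis card.empty le0)
    qed
    fix R S :: "'b set"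
    assume S: "\<And>x y. {x, y} \<in> edges H \<Longrightarrow> x \<in> I \<Longrightarrow> y \<in> I \<Longrightarrow> x \<in> R \<Longrightarrow> y \<notin> R \<Longrightarrow> x \<in> S \<or> y \<in> S"
    define X where "X = (\<Union>z\<in>I \<inter> S. {e' \<in> edges H. z \<in> e'})"
    have deg: "finite {e' \<in> edges H. z \<in> e'}" "card {e' \<in> edges H. z \<in> e'} \<le> D" if "z \<in> I \<inter> S" for z
      using H(2) that by (auto simp: degree_le_def I)
    have finX: "finite X" unfolding X_def using finI deg by blast
    have "card X \<le> (\<Sum>z\<in>I \<inter> S. card {e' \<in> edges H. z \<in> e'})"
      unfolding X_def using finI by (intro card_UN_le) simp
    also have "\<dots> \<le> card (I \<inter> S) * D"
      using sum_bounded_above[of "I \<inter> S" "\<lambda>z. card {e' \<in> edges H. z \<in> e'}" D] deg by simp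
    finally have cX: "card X \<le> D * card (I \<inter> S)" by (simp add: mult.commute)
    have "cut_edges G {v. g v \<in> R} \<subseteq> (\<Union>e'\<in>X. {e \<in> edges G. cell e' \<subseteq> f ` cell e})"
    proof
      fix e assume e: "e \<in> cut_edges G {v. g v \<in> R}"
      then obtain u v where uv: "u \<in> e" "v \<in> e" "g u \<in> R" "g v \<notin> R" by (auto simp: cut_edges_def)
      have eG: "e \<in> edges G" using e by (simp add: cut_edges_def)
      have "u \<noteq> v" using uv by auto
      then have euv: "e = {u, v}" using uv eG G(1) by (auto simp: is_graph_def card_2_iff)
      obtain w where w: "is_walk H w" "hd w = g u" "last w = g v"
        "f ` cell {u, v} = realisation (walk_graph w)" using walk eG euv by blast
      obtain i where i: "Suc i < length w" "w ! i \<in> R" "w ! Suc i \<notin> R"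
        using walk_crossing[of w R] w uv by (auto simp: is_walk_def)
      have edge: "{w ! i, w ! Suc i} \<in> edges H" using w(1) i(1) by (rule is_walk_nth_edge)
      have setw: "set w \<subseteq> I"
      proof
        fix x assume x: "x \<in> set w"
        then have "vertex_pt x \<in> f ` cell {u, v}" unfolding w(4) by (simp add: realisation_def walk_graph_def)
        then show "x \<in> I" using x w(1) eG euv unfolding I by (auto simp: is_walk_def realisation_def)
      qed
      have "w ! i \<in> I" "w ! Suc i \<in> I" using setw i(1) by (auto intro!: subsetD[OF setw])
      then have "{w ! i, w ! Suc i} \<in> X" using S[OF edge] i edge by (auto simp: X_def)
      moreover have "cell {w ! i, w ! Suc i} \<subseteq> f ` cell e"
        unfolding euv w(4) using i(1) by (auto simp: realisation_def walk_graph_def)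
      ultimately show "e \<in> (\<Union>e'\<in>X. {e \<in> edges G. cell e' \<subseteq> f ` cell e})" using eG by blast
    qed
    then have "card (cut_edges G {v. g v \<in> R}) \<le> card (\<Union>e'\<in>X. {e \<in> edges G. cell e' \<subseteq> f ` cell e})"
      by (intro card_mono finite_UN_I finX) (use finE in auto)
    also have "\<dots> \<le> (\<Sum>e'\<in>X. card {e \<in> edges G. cell e' \<subseteq> f ` cell e})"
      by (rule card_UN_le[OF finX])
    also have "\<dots> \<le> card X * k"
      using sum_bounded_above[of X "\<lambda>e'. card {e \<in> edges G. cell e' \<subseteq> f ` cell e}" k] fe
      by (auto simp: X_def)
    also have "\<dots> \<le> k * (D * card (I \<inter> S))" using cX by (simp add: mult.commute)
    finally show "card (cut_edges G {v. g v \<in> R}) \<le> k * (D * card (I \<inter> S))" .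
  qed (use finI gI in auto)
qed

section \<open>Continuous maps that follow walks\<close>

text \<open>A sum of tent functions: the path is at \<open>w ! i\<close> at time \<open>i\<close>
  and moves linearly in between. As a single sum it is continuous without case distinctions, also
  for walks that repeat vertices.\<close>

definition walk_path :: "'a list \<Rightarrow> real \<Rightarrow> 'a \<Rightarrow> real" where
  "walk_path w s x = (\<Sum>i<length w. max 0 (1 - \<bar>s - real i\<bar>) * vertex_pt (w ! i) x)"

lemma continuous_on_walk_path: "continuous_on A (\<lambda>p. walk_path w (c * p b))"
  unfolding walk_path_def
  by (intro continuous_on_coordinatewise_then_product continuous_intros
      continuous_on_subset[OF continuous_on_product_coordinates]) auto

lemma walk_path_nat:
  assumes "i < length w"
  shows "walk_path w (real i) = vertex_pt (w ! i)"
proof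
  fix x
  have "walk_path w (real i) x = (\<Sum>j<length w. if j = i then vertex_pt (w ! i) x else 0)"
    unfolding walk_path_def by (intro sum.cong) (auto simp: max_def)
  then show "walk_path w (real i) x = vertex_pt (w ! i) x" using assms by simp
qed

lemma walk_path_between:
  assumes "Suc i < length w" "0 \<le> t" "t \<le> 1"
  shows "walk_path w (real i + t) = (\<lambda>x. (1 - t) * vertex_pt (w ! i) x + t * vertex_pt (w ! Suc i) x)"
proof
  fix x
  have "walk_path w (real i + t) x = (\<Sum>j\<in>{i, Suc i}. max 0 (1 - \<bar>real i + t - real j\<bar>) * vertex_pt (w ! j) x)"
    unfolding walk_path_def
  proof (rule sum.mono_neutral_right)
    show "\<forall>j\<in>{..<length w} - {i, Suc i}. max 0 (1 - \<bar>real i + t - real j\<bar>) * vertex_pt (w ! j) x = 0"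
    proof
      fix j assume j: "j \<in> {..<length w} - {i, Suc i}"
      then have "real j \<le> real i - 1 \<or> real j \<ge> real i + 2" by auto
      then show "max 0 (1 - \<bar>real i + t - real j\<bar>) * vertex_pt (w ! j) x = 0"
        using assms by (auto simp: max_def)
    qed
  qed (use assms in auto)
  then show "walk_path w (real i + t) x = (1 - t) * vertex_pt (w ! i) x + t * vertex_pt (w ! Suc i) x"
    using assms by (auto simp: max_def)
qed

lemma walk_path_image:
  assumes "is_graph H" "is_walk H w"
  shows "walk_path w ` {0..real (length w - 1)} = realisation (walk_graph w)"
proof -
  have w: "w \<noteq> []" using assms by (auto simp: is_walk_def)
  have ne: "w ! i \<noteq> w ! Suc i" if "Suc i < length w" for i
    using is_walk_nth_edge[OF assms(2) that] assms(1) by (auto simp: is_graph_def)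
  show ?thesis
  proof safe
    fix s assume s: "s \<in> {0..real (length w - 1)}"
    show "walk_path w s \<in> realisation (walk_graph w)"
    proof (cases "s = real (length w - 1)")
      case True
      then show ?thesis using walk_path_nat[of "length w - 1" w] w
        by (auto simp: realisation_def walk_graph_def)
    next
      case False
      define i where "i = nat \<lfloor>s\<rfloor>"
      have i: "real i \<le> s" "s < real i + 1" using s by (auto simp: i_def)
      then have "Suc i < length w" using s False by (simp add: of_nat_diff)
      then have "walk_path w s \<in> cell {w ! i, w ! Suc i}"
        using walk_path_between[of i w "s - real i"] i
        unfolding cell_doubleton[OF ne[OF \<open>Suc i < length w\<close>]]
        by (intro image_eqI[of _ _ "s - real i"]) auto
      then show ?thesis using \<open>Suc i < length w\<close> by (auto simp: realisation_def walk_graph_def)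
    qed
  next
    fix p assume "p \<in> realisation (walk_graph w)"
    then consider v where "v \<in> set w" "p = vertex_pt v"
      | i where "Suc i < length w" "p \<in> cell {w ! i, w ! Suc i}"
      by (auto simp: realisation_def walk_graph_def)
    then show "p \<in> walk_path w ` {0..real (length w - 1)}"
    proof cases
      case 1
      then obtain i where "i < length w" "v = w ! i" by (auto simp: in_set_conv_nth)
      then show ?thesis using 1 walk_path_nat[of i w] by (intro image_eqI[of _ _ "real i"]) auto
    next
      case 2
      then obtain t where "t \<in> {0..1}"
        "p = (\<lambda>x. (1 - t) * vertex_pt (w ! i) x + t * vertex_pt (w ! Suc i) x)"
        unfolding cell_doubleton[OF ne[OF 2(1)]] by blast
      then show ?thesis using 2 walk_path_between[of i w t]
        by (intro image_eqI[of _ _ "real i + t"]) auto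
    qed
  qed
qed

lemma edges_walk_graph_rev: "edges (walk_graph (rev w)) \<subseteq> edges (walk_graph w)"
proof
  fix e assume "e \<in> edges (walk_graph (rev w))"
  then obtain i where i: "Suc i < length w" "e = {rev w ! i, rev w ! Suc i}"
    by (auto simp: walk_graph_def)
  define j where "j = length w - Suc (Suc i)"
  have "Suc j < length w" "e = {w ! j, w ! Suc j}"
    using i by (auto simp: j_def rev_nth Suc_diff_Suc)
  then show "e \<in> edges (walk_graph w)" by (auto simp: walk_graph_def)
qed

lemma realisation_walk_graph_rev: "realisation (walk_graph (rev w)) = realisation (walk_graph w)"
proof -
  have "edges (walk_graph (rev w)) = edges (walk_graph w)"
    using edges_walk_graph_rev[of w] edges_walk_graph_rev[of "rev w"] by auto
  moreover have "verts (walk_graph (rev w)) = verts (walk_graph w)" by (simp add: walk_graph_def)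
  ultimately show ?thesis by (simp add: realisation_def)
qed

lemma is_walk_rev: "is_walk H w \<Longrightarrow> is_walk H (rev w)"
  by (auto simp: is_walk_def insert_commute)

lemma realisation_walk_graph_subset:
  assumes "is_walk H w"
  shows "realisation (walk_graph w) \<subseteq> realisation H"
  using assms is_walk_nth_edge[OF assms] by (fastforce simp: is_walk_def realisation_def walk_graph_def)

lemma closed_cell: "finite e \<Longrightarrow> closed (cell e)"
  unfolding cell_def
  by (intro closed_Collect_conj closed_Collect_all closed_Collect_imp closed_Collect_le
      closed_Collect_eq continuous_intros) auto

lemma closed_vertex_pt: "closed {vertex_pt v}"
proof -
  have "{vertex_pt v} = {p. \<forall>x. p x = vertex_pt v x}" by auto
  also have "closed \<dots>"
    by (intro closed_Collect_all closed_Collect_eq continuous_intros) auto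
  finally show ?thesis .
qed

text \<open>On the cell of an edge the map runs along the assigned walk at constant speed, with the
  barycentric coordinate of the target end as time. These maps agree at common vertices, and since
  there are finitely many closed cells they paste to a continuous map.\<close>

lemma wiring_of_walks:
  assumes G: "is_graph G" "finite (verts G)" and H: "is_graph H"
    and g: "g ` verts G \<subseteq> verts H"
    and P: "\<And>e. e \<in> edges G \<Longrightarrow> \<exists>u v. e = {u, v} \<and> walk_between H (g u) (g v) (P e)"
  obtains f where "wiring G H f" "\<And>v. v \<in> verts G \<Longrightarrow> f (vertex_pt v) = vertex_pt (g v)"
    "\<And>e. e \<in> edges G \<Longrightarrow> f ` cell e = realisation (walk_graph (P e))"
proof -
  obtain src tgt where st: "\<And>e. e \<in> edges G \<Longrightarrow> e = {src e, tgt e} \<and> walk_between H (g (src e)) (g (tgt e)) (P e)"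
    using P by metis
  have ne: "src e \<noteq> tgt e" if "e \<in> edges G" for e
  proof
    assume "src e = tgt e"
    then have "e = {tgt e}" using st[OF that] by auto
    then have "card e = 1" by (metis is_singletonI is_singleton_altdef)
    then show False using G(1) that by (simp add: is_graph_def)
  qed
  define fe where "fe e p = walk_path (P e) (real (length (P e) - 1) * p (tgt e))" for e p
  \<comment> \<open>Away from the vertices, the edge on which \<open>p\<close> lies is recovered as
    the support of \<open>p\<close>.\<close>
  define f where "f p = (if \<exists>v\<in>verts G. p = vertex_pt v then vertex_pt (g (THE v. p = vertex_pt v))
    else fe {x. p x \<noteq> 0} p)" for p
  have fv: "f (vertex_pt v) = vertex_pt (g v)" if "v \<in> verts G" for v
    using that by (auto simp: f_def)
  have P': "is_walk H (P e)" "hd (P e) = g (src e)" "last (P e) = g (tgt e)" if "e \<in> edges G" for e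
    using st[OF that] by (auto simp: walk_between_def)
  have fe: "f p = fe e p" if e: "e \<in> edges G" and p: "p \<in> cell e" for e p
  proof (cases "\<exists>v\<in>verts G. p = vertex_pt v")
    case True
    then obtain v where v: "v \<in> verts G" "p = vertex_pt v" by blast
    have "finite e" using st[OF e] by (metis finite.emptyI finite_insert)
    then have "v \<in> e" using p v by (simp add: vertex_pt_mem_cell)
    have nonempty: "P e \<noteq> []" using P'(1)[OF e] by (simp add: is_walk_def)
    have "v = src e \<or> v = tgt e" using \<open>v \<in> e\<close> st[OF e] by auto
    then show ?thesis
    proof
      assume "v = src e"
      moreover have "vertex_pt (src e) (tgt e) = 0" using ne[OF e] by (simp add: vertex_pt_def)
      ultimately show ?thesis
        using v ne[OF e] P'(2)[OF e] walk_path_nat[of 0 "P e"] nonempty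
        by (simp add: fv fe_def hd_conv_nth)
    next
      assume "v = tgt e"
      moreover have "vertex_pt (tgt e) (tgt e) = 1" by (simp add: vertex_pt_def)
      ultimately show ?thesis
        using v ne[OF e] P'(3)[OF e] walk_path_nat[of "length (P e) - 1" "P e"] nonempty
        by (simp add: fv fe_def last_conv_nth)
    qed
  next
    case False
    define a b where "a = src e" and "b = tgt e"
    have ab: "e = {a, b}" "a \<noteq> b" using st[OF e] ne[OF e] by (auto simp: a_def b_def)
    have verts: "a \<in> verts G" "b \<in> verts G" using e G(1) ab by (auto simp: is_graph_def)
    obtain t where t: "p = (\<lambda>x. (1 - t) * vertex_pt a x + t * vertex_pt b x)"
      using p unfolding ab(1) cell_doubleton[OF ab(2)] by blast
    have "t \<noteq> 0" "t \<noteq> 1" using False verts t by auto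
    then have "{x. p x \<noteq> 0} = e"
      using ab by (auto simp: t vertex_pt_def indicator_def)
    then show ?thesis using False by (simp add: f_def)
  qed
  have fcell: "f ` cell e = realisation (walk_graph (P e))" if e: "e \<in> edges G" for e
  proof -
    define L where "L = real (length (P e) - 1)"
    have "(\<lambda>p. p (tgt e)) ` cell e = {0..1}"
    proof -
      have "e = {src e, tgt e}" using st[OF e] by blast
      then have "(\<lambda>p. p (tgt e)) ` cell e = (\<lambda>t. t) ` {0..1}"
        using cell_doubleton[OF ne[OF e]] ne[OF e] by (simp add: image_image vertex_pt_def)
      then show ?thesis by simp
    qed
    then have "(\<lambda>p. L * p (tgt e)) ` cell e = (*) L ` {0..1}" by (metis image_image)
    also have "\<dots> = {0..L}"
      by (simp add: L_def image_mult_atLeastAtMost_if)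
    finally have 1: "(\<lambda>p. L * p (tgt e)) ` cell e = {0..L}" .
    have "f ` cell e = fe e ` cell e" using fe[OF e] by auto
    also have "\<dots> = walk_path (P e) ` ((\<lambda>p. L * p (tgt e)) ` cell e)"
      by (simp add: image_image fe_def L_def)
    also have "\<dots> = realisation (walk_graph (P e))"
      unfolding 1 unfolding L_def by (rule walk_path_image[OF H P'(1)[OF e]])
    finally show ?thesis .
  qed
  have finE: "finite (edges G)" using G by (rule finite_edges)
  have cont: "continuous_on (realisation G) f"
    unfolding realisation_def
  proof (intro continuous_on_closed_Un)
    have V: "vertex_pt ` verts G = (\<Union>v\<in>verts G. {vertex_pt v})" by auto
    show "closed (vertex_pt ` verts G)" unfolding V
      using G(2) closed_vertex_pt by (intro closed_UN) auto
    show "continuous_on (vertex_pt ` verts G) f" unfolding V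
      using G(2) closed_vertex_pt by (intro continuous_on_closed_Union) auto
    have fin: "finite e" if "e \<in> edges G" for e
      using st[OF that] by (metis finite.emptyI finite_insert)
    show "closed (\<Union>e\<in>edges G. cell e)" using finE closed_cell fin by (intro closed_UN) auto
    show "continuous_on (\<Union>e\<in>edges G. cell e) f"
    proof (intro continuous_on_closed_Union finE closed_cell fin)
      fix e assume e: "e \<in> edges G"
      have "continuous_on (cell e) (fe e)" unfolding fe_def by (rule continuous_on_walk_path)
      then show "continuous_on (cell e) f" using fe[OF e] by (simp cong: continuous_on_cong)
    qed
  qed
  have into: "f ` realisation G \<subseteq> realisation H"
  proof -
    have "f (vertex_pt v) \<in> realisation H" if "v \<in> verts G" for v
      using g that by (auto simp: fv realisation_def)
    moreover have "f ` cell e \<subseteq> realisation H" if "e \<in> edges G" for e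
      unfolding fcell[OF that] using P'(1)[OF that] by (rule realisation_walk_graph_subset)
    ultimately show ?thesis by (auto simp: realisation_def[of G])
  qed
  have walks: "\<exists>w. is_walk H w \<and>
             f (vertex_pt u) = vertex_pt (hd w) \<and> f (vertex_pt v) = vertex_pt (last w) \<and>
             f ` cell {u, v} = realisation (walk_graph w)" if e: "{u, v} \<in> edges G" for u v
  proof -
    define w where "w = P {u, v}"
    have verts: "u \<in> verts G" "v \<in> verts G" using e G(1) by (auto simp: is_graph_def)
    have ne: "w \<noteq> []" using P'(1)[OF e] by (auto simp: w_def is_walk_def)
    \<comment> \<open>A wiring must provide a walk for either order of the endpoints, whereas
      \<open>P\<close> fixes an orientation; the other order takes the reversed walk.\<close>
    consider "u = src {u, v}" "v = tgt {u, v}" | "v = src {u, v}" "u = tgt {u, v}"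
      using st[OF e] by (metis doubleton_eq_iff)
    then show ?thesis
    proof cases
      case 1
      then show ?thesis using P'[OF e] verts fcell[OF e] fv by (intro exI[of _ w]) (auto simp: w_def)
    next
      case 2
      then have "hd (rev w) = g u" "last (rev w) = g v"
        using P'[OF e] ne by (auto simp: w_def hd_rev last_rev)
      then show ?thesis using P'[OF e] verts fcell[OF e] fv
        by (intro exI[of _ "rev w"]) (auto simp: w_def is_walk_rev realisation_walk_graph_rev)
    qed
  qed
  have "\<forall>v\<in>verts G. \<exists>v'\<in>verts H. f (vertex_pt v) = vertex_pt v'"
    using fv g by blast
  then have "wiring G H f"
    unfolding wiring_def by (intro conjI allI impI cont into walks)
  then show thesis using fv fcell by (rule that)
qed

section \<open>Coarse geometry\<close>

lemma walk_between_take: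
  assumes "is_walk G w" "i < length w"
  shows "walk_between G (hd w) (w ! i) (take (Suc i) w)"
proof -
  have 1: "take (Suc i) w \<noteq> []" using assms by auto
  have "successively (\<lambda>u v. {u, v} \<in> edges G) (take (Suc i) w)"
    using assms by (auto simp: is_walk_def successively_conv_nth)
  then have "is_walk G (take (Suc i) w)"
    using assms set_take_subset[of "Suc i" w] 1 by (auto simp: is_walk_def)
  moreover have "last (take (Suc i) w) = w ! i"
    using assms by (simp add: take_Suc_conv_app_nth)
  ultimately show ?thesis using assms by (simp add: walk_between_def hd_take)
qed

lemma graph_dist_le:
  assumes "walk_between G u v w"
  shows "graph_dist G u v \<le> real (length w - 1)"
  unfolding graph_dist_def
  using assms by (intro of_nat_mono Least_le exI[of _ w]) (auto simp: walk_between_def is_walk_def)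

lemma obtain_geodesic:
  assumes "connected_graph G" "u \<in> verts G" "v \<in> verts G"
  obtains w where "walk_between G u v w" "real (length w) = graph_dist G u v + 1"
proof -
  obtain w where w: "walk_between G u v w" using assms by (auto simp: connected_graph_def)
  then have "\<exists>w. walk_between G u v w \<and> length w = Suc (length w - 1)"
    by (intro exI[of _ w]) (auto simp: walk_between_def is_walk_def)
  then have "\<exists>n w. walk_between G u v w \<and> length w = Suc n" using w
    by (metis Suc_pred length_greater_0_conv is_walk_def walk_between_def)
  from LeastI_ex[OF this] show thesis using that unfolding graph_dist_def by auto
qed

lemma card_walk_ends_le:
  assumes "is_graph G" "degree_le G D"
  shows "finite {v. \<exists>w. walk_between G u v w \<and> length w = Suc n} \<and>
    card {v. \<exists>w. walk_between G u v w \<and> length w = Suc n} \<le> D ^ n"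
proof (induction n)
  case 0
  have sub: "{v. \<exists>w. walk_between G u v w \<and> length w = Suc 0} \<subseteq> {u}"
    by (auto simp: walk_between_def length_Suc_conv)
  then show ?case using card_mono[OF _ sub] finite_subset[OF sub] by simp
next
  case (Suc n)
  define N where "N n = {v. \<exists>w. walk_between G u v w \<and> length w = Suc n}" for n
  have nbr: "finite {x. {v, x} \<in> edges G} \<and> card {x. {v, x} \<in> edges G} \<le> D" if "v \<in> verts G" for v
  proof -
    have inj: "inj_on (\<lambda>x. {v, x}) {x. {v, x} \<in> edges G}"
      by (auto simp: inj_on_def doubleton_eq_iff)
    have sub: "(\<lambda>x. {v, x}) ` {x. {v, x} \<in> edges G} \<subseteq> {e \<in> edges G. v \<in> e}" by auto
    have fin: "finite {e \<in> edges G. v \<in> e}" "card {e \<in> edges G. v \<in> e} \<le> D"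
      using assms(2) that by (auto simp: degree_le_def)
    show ?thesis
      using inj_on_finite[OF inj sub fin(1)] card_inj_on_le[OF inj sub fin(1)] fin(2) by simp
  qed
  have N: "N n \<subseteq> verts G" by (auto simp: N_def walk_between_def is_walk_def)
  have sub: "N (Suc n) \<subseteq> (\<Union>v\<in>N n. {x. {v, x} \<in> edges G})"
  proof
    fix x assume "x \<in> N (Suc n)"
    then obtain w where w: "walk_between G u x w" "length w = Suc (Suc n)" by (auto simp: N_def)
    then have "is_walk G w" "hd w = u" "last w = x" by (auto simp: walk_between_def)
    then have "walk_between G u (w ! n) (take (Suc n) w)"
      using walk_between_take[of G w n] w(2) by simp
    then have "w ! n \<in> N n" using w(2) by (auto simp: N_def intro!: exI[of _ "take (Suc n) w"])
    moreover have "{w ! n, w ! Suc n} \<in> edges G" using \<open>is_walk G w\<close> w(2)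
      by (auto simp: is_walk_def successively_conv_nth)
    moreover have "w ! Suc n = x" using \<open>last w = x\<close> w(2) by (metis diff_Suc_1 last_conv_nth length_0_conv nat.distinct(1))
    ultimately show "x \<in> (\<Union>v\<in>N n. {x. {v, x} \<in> edges G})" by auto
  qed
  have finN: "finite (N n)" and cN: "card (N n) \<le> D ^ n" using Suc by (auto simp: N_def)
  have fin: "finite (\<Union>v\<in>N n. {x. {v, x} \<in> edges G})" using finN nbr N by blast
  have "card (N (Suc n)) \<le> card (\<Union>v\<in>N n. {x. {v, x} \<in> edges G})"
    by (rule card_mono[OF fin sub])
  also have "\<dots> \<le> (\<Sum>v\<in>N n. card {x. {v, x} \<in> edges G})" by (rule card_UN_le[OF finN])
  also have "\<dots> \<le> card (N n) * D"
    using sum_bounded_above[of "N n" "\<lambda>v. card {x. {v, x} \<in> edges G}" D] nbr N by auto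
  also have "\<dots> \<le> D ^ Suc n" using cN by (simp add: mult.commute)
  finally show ?case using finite_subset[OF sub fin] by (simp add: N_def)
qed

lemma card_graph_ball_le:
  assumes "is_graph G" "degree_le G D" "connected_graph G" "u \<in> verts G"
    "A \<subseteq> {v \<in> verts G. graph_dist G u v \<le> real R}"
  shows "finite A \<and> card A \<le> (\<Sum>n\<le>R. D ^ n)"
proof -
  define N where "N n = {v. \<exists>w. walk_between G u v w \<and> length w = Suc n}" for n
  have N: "finite (N n)" "card (N n) \<le> D ^ n" for n
    using card_walk_ends_le[OF assms(1,2), of u n] by (auto simp: N_def)
  have sub: "A \<subseteq> (\<Union>n\<le>R. N n)"
  proof
    fix v assume "v \<in> A"
    then have v: "v \<in> verts G" "graph_dist G u v \<le> real R" using assms(5) by auto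
    obtain w where w: "walk_between G u v w" "real (length w) = graph_dist G u v + 1"
      using obtain_geodesic[OF assms(3,4) v(1)] by blast
    have "length w \<noteq> 0" using w(1) by (auto simp: walk_between_def is_walk_def)
    then have "v \<in> N (length w - 1)" using w(1) by (auto simp: N_def)
    moreover have "length w - 1 \<le> R" using w(2) v(2) by linarith
    ultimately show "v \<in> (\<Union>n\<le>R. N n)" by blast
  qed
  have "card A \<le> card (\<Union>n\<le>R. N n)" using sub N(1) by (intro card_mono) auto
  also have "\<dots> \<le> (\<Sum>n\<le>R. card (N n))" by (rule card_UN_le) simp
  also have "\<dots> \<le> (\<Sum>n\<le>R. D ^ n)" using N(2) by (intro sum_mono)
  finally show ?thesis using finite_subset[OF sub] N(1) by auto
qed

text \<open>The weak consequences of a quasi-isometry from which everything later is derived; the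
  constants of the quasi-isometry disappear into existential bounds. Bounded degree enters through
  the third one: vertices with images of bounded diameter lie in a ball of the graph.\<close>

lemma quasi_isometry_coarse:
  assumes "is_graph G" "bounded_degree G" "graph_quasi_isometric_to G M \<delta>"
  obtains f where "f \<in> verts G \<rightarrow> M"
    and "\<And>l::nat. \<exists>r\<ge>0. \<forall>w y. is_walk G w \<longrightarrow> length w \<le> l \<longrightarrow> y \<in> set w \<longrightarrow> \<delta> (f (hd w)) (f y) \<le> r"
    and "\<And>r. \<exists>B::nat. \<forall>A\<subseteq>verts G. (\<forall>x\<in>A. \<forall>y\<in>A. \<delta> (f x) (f y) \<le> r) \<longrightarrow> finite A \<and> card A \<le> B"
    and "\<exists>C\<ge>0. \<forall>z\<in>M. \<exists>y\<in>verts G. \<delta> (f y) z \<le> C"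
    and "\<And>r. \<exists>l::nat. \<forall>x\<in>verts G. \<forall>y\<in>verts G. \<delta> (f x) (f y) \<le> r \<longrightarrow>
      (\<exists>w. walk_between G x y w \<and> length w \<le> l)"
proof -
  obtain D where D: "degree_le G D" using assms(2) by (auto simp: bounded_degree_def)
  have con: "connected_graph G" using assms(3) by (simp add: graph_quasi_isometric_to_def)
  obtain f L C where f: "f \<in> verts G \<rightarrow> M" and L: "L \<ge> 1" and C: "C \<ge> 0"
    and lower: "\<And>x y. x \<in> verts G \<Longrightarrow> y \<in> verts G \<Longrightarrow> graph_dist G x y / L - C \<le> \<delta> (f x) (f y)"
    and upper: "\<And>x y. x \<in> verts G \<Longrightarrow> y \<in> verts G \<Longrightarrow> \<delta> (f x) (f y) \<le> L * graph_dist G x y + C"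
    and dense: "\<And>z. z \<in> M \<Longrightarrow> \<exists>x\<in>verts G. \<delta> (f x) z \<le> C"
    using assms(3) unfolding graph_quasi_isometric_to_def quasi_isometric_def by metis
  have dist: "graph_dist G x y \<le> real (nat \<lceil>L * (r + C)\<rceil>)"
    if "x \<in> verts G" "y \<in> verts G" "\<delta> (f x) (f y) \<le> r" for x y r
  proof -
    have "graph_dist G x y / L \<le> r + C" using lower[OF that(1,2)] that(3) by simp
    then have "graph_dist G x y \<le> L * (r + C)" using L by (simp add: field_simps)
    then show ?thesis by linarith
  qed
  show thesis
  proof (rule that[OF f])
    fix l :: nat
    have "\<delta> (f (hd w)) (f y) \<le> L * l + C" if w: "is_walk G w" "length w \<le> l" "y \<in> set w" for w y
    proof -
      have verts: "hd w \<in> verts G" "y \<in> verts G" using w by (auto simp: is_walk_def)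
      obtain i where i: "i < length w" "y = w ! i" using w(3) by (auto simp: in_set_conv_nth)
      have "graph_dist G (hd w) y \<le> real (length (take (Suc i) w) - 1)"
        using graph_dist_le[OF walk_between_take[OF w(1) i(1)]] i(2) by simp
      also have "\<dots> \<le> real l" using w(2) by simp
      finally have "L * graph_dist G (hd w) y \<le> L * l" using L by simp
      then show ?thesis using upper[OF verts] by linarith
    qed
    moreover have "L * real l + C \<ge> 0" using L C by simp
    ultimately show "\<exists>r\<ge>0. \<forall>w y. is_walk G w \<longrightarrow> length w \<le> l \<longrightarrow> y \<in> set w \<longrightarrow> \<delta> (f (hd w)) (f y) \<le> r"
      by blast
  next
    fix r :: real
    define R where "R = nat \<lceil>L * (r + C)\<rceil>"
    show "\<exists>B::nat. \<forall>A\<subseteq>verts G. (\<forall>x\<in>A. \<forall>y\<in>A. \<delta> (f x) (f y) \<le> r) \<longrightarrow> finite A \<and> card A \<le> B"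
    proof (intro exI allI impI)
      fix A assume A: "A \<subseteq> verts G" "\<forall>x\<in>A. \<forall>y\<in>A. \<delta> (f x) (f y) \<le> r"
      show "finite A \<and> card A \<le> (\<Sum>n\<le>R. D ^ n)"
      proof (cases "A = {}")
        case False
        then obtain u where u: "u \<in> A" by blast
        show ?thesis
          by (rule card_graph_ball_le[OF assms(1) D con, of u]) (use u A in \<open>auto simp: R_def intro!: dist\<close>)
      qed simp
    qed
    show "\<exists>l::nat. \<forall>x\<in>verts G. \<forall>y\<in>verts G. \<delta> (f x) (f y) \<le> r \<longrightarrow>
      (\<exists>w. walk_between G x y w \<and> length w \<le> l)"
    proof (rule exI[of _ "Suc R"], intro ballI impI)
      fix x y assume xy: "x \<in> verts G" "y \<in> verts G" "\<delta> (f x) (f y) \<le> r"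
      obtain w where w: "walk_between G x y w" "real (length w) = graph_dist G x y + 1"
        using obtain_geodesic[OF con xy(1,2)] by blast
      then have "length w \<le> Suc R" using dist[OF xy] unfolding R_def by linarith
      with w(1) show "\<exists>w. walk_between G x y w \<and> length w \<le> Suc R" by blast
    qed
  next
    show "\<exists>C\<ge>0. \<forall>z\<in>M. \<exists>y\<in>verts G. \<delta> (f y) z \<le> C" using dense C by blast
  qed
qed

section \<open>Closeness in the upper half-plane\<close>

text \<open>Trades \<open>arcosh\<close> for a polynomial inequality: the estimates below speak of
  \<open>(cmod (z - w))\<^sup>2 \<le> K * (Im z * Im w)\<close> with a constant \<open>K\<close> in
  place of a radius.\<close>

lemma hyp_dist_le_iff:
  assumes "r \<ge> 0" "z \<in> hyp_plane" "w \<in> hyp_plane"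
  shows "hyp_dist z w \<le> r \<longleftrightarrow> (cmod (z - w))\<^sup>2 \<le> 2 * (cosh r - 1) * (Im z * Im w)"
proof -
  have pos: "Im z * Im w > 0" using assms by (simp add: hyp_plane_def)
  define u where "u = 1 + (cmod (z - w))\<^sup>2 / (2 * Im z * Im w)"
  have u: "u \<ge> 1" using pos by (simp add: u_def mult.assoc)
  have "arcosh u \<ge> 0" using u by simp
  then have "arcosh u \<le> r \<longleftrightarrow> cosh (arcosh u) \<le> cosh r"
    using assms(1) by (simp add: cosh_real_nonneg_le_iff)
  also have "cosh (arcosh u) = u" using u by simp
  also have "u \<le> cosh r \<longleftrightarrow> (cmod (z - w))\<^sup>2 \<le> 2 * (cosh r - 1) * (Im z * Im w)"
  proof -
    have "u \<le> cosh r \<longleftrightarrow> (cmod (z - w))\<^sup>2 / (2 * (Im z * Im w)) \<le> cosh r - 1"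
      by (simp add: u_def mult.assoc le_diff_eq add.commute)
    also have "\<dots> \<longleftrightarrow> (cmod (z - w))\<^sup>2 \<le> (cosh r - 1) * (2 * (Im z * Im w))"
      using pos by (intro pos_divide_le_eq) simp
    finally show ?thesis by (simp only: mult_ac)
  qed
  finally show ?thesis by (simp add: hyp_dist_def u_def)
qed

lemma hyp_dist_leI:
  assumes "z \<in> hyp_plane" "w \<in> hyp_plane" "K \<ge> 0" "(cmod (z - w))\<^sup>2 \<le> K * (Im z * Im w)"
  shows "hyp_dist z w \<le> arcosh (1 + K / 2)"
  using assms by (subst hyp_dist_le_iff) auto

text \<open>Otherwise \<open>Im w * Im w\<close> would exceed \<open>(K + 2) * Im z * Im w\<close>,
  and then the squared difference of the heights alone would be larger than
  \<open>K * (Im z * Im w)\<close>.\<close>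

lemma hyp_close_Im:
  assumes "z \<in> hyp_plane" "w \<in> hyp_plane" "K \<ge> 0" "(cmod (z - w))\<^sup>2 \<le> K * (Im z * Im w)"
  shows "Im w \<le> (K + 2) * Im z"
proof (rule ccontr)
  assume "\<not> ?thesis"
  then have gt: "(K + 2) * Im z < Im w" by simp
  have pos: "Im z > 0" "Im w > 0" using assms by (auto simp: hyp_plane_def)
  have "(Im z - Im w)\<^sup>2 \<le> (cmod (z - w))\<^sup>2"
    by (simp add: cmod_power2)
  then have "(Im z - Im w)\<^sup>2 \<le> K * (Im z * Im w)" using assms(4) by simp
  moreover have "(K + 2) * Im z * Im w < Im w * Im w" using gt pos by simp
  moreover have "(Im z - Im w)\<^sup>2 = Im w * Im w - 2 * (Im z * Im w) + Im z * Im z"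
    by (simp add: power2_eq_square algebra_simps)
  moreover have "Im z * Im z > 0" using pos by simp
  ultimately show False by (simp add: algebra_simps)
qed

lemma hyp_close_norm:
  assumes "z \<in> hyp_plane" "w \<in> hyp_plane" "K \<ge> 0" "(cmod (z - w))\<^sup>2 \<le> K * (Im z * Im w)"
  shows "cmod (z - w) \<le> (K + 2) * Im z"
proof (rule power2_le_imp_le)
  have pos: "Im z > 0" "Im w > 0" using assms by (auto simp: hyp_plane_def)
  have "(cmod (z - w))\<^sup>2 \<le> K * (Im z * Im w)" by fact
  also have "\<dots> \<le> K * (Im z * ((K + 2) * Im z))"
    using hyp_close_Im[OF assms] assms(3) pos by (intro mult_left_mono) auto
  also have "\<dots> = K * (K + 2) * (Im z)\<^sup>2" by (simp add: power2_eq_square)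
  also have "\<dots> \<le> (K + 2) * (K + 2) * (Im z)\<^sup>2" using assms(3) by (intro mult_right_mono) auto
  finally show "(cmod (z - w))\<^sup>2 \<le> ((K + 2) * Im z)\<^sup>2" by (simp add: power2_eq_square algebra_simps)
  show "0 \<le> (K + 2) * Im z" using assms(3) pos by simp
qed

text \<open>Both Euclidean distances are bounded by multiples of the height of the middle point
  \<open>w\<close>, which in turn is comparable with the heights of \<open>z\<close> and
  \<open>u\<close>.\<close>

lemma hyp_close_trans:
  assumes "z \<in> hyp_plane" "w \<in> hyp_plane" "u \<in> hyp_plane" "K \<ge> 0" "K' \<ge> 0"
    "(cmod (z - w))\<^sup>2 \<le> K * (Im z * Im w)" "(cmod (w - u))\<^sup>2 \<le> K' * (Im w * Im u)"
  shows "(cmod (z - u))\<^sup>2 \<le> ((K + K' + 4)\<^sup>2 * ((K + 2) * (K' + 2))) * (Im z * Im u)"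
proof -
  have pos: "Im z > 0" "Im w > 0" "Im u > 0" using assms by (auto simp: hyp_plane_def)
  have 1: "(cmod (w - z))\<^sup>2 \<le> K * (Im w * Im z)" using assms(6) by (simp add: norm_minus_commute mult.commute)
  have 2: "(cmod (u - w))\<^sup>2 \<le> K' * (Im u * Im w)" using assms(7) by (simp add: norm_minus_commute mult.commute)
  have "cmod (z - u) \<le> cmod (w - z) + cmod (w - u)"
    using norm_triangle_ineq[of "z - w" "w - u"] by (simp add: norm_minus_commute)
  also have "\<dots> \<le> (K + 2) * Im w + (K' + 2) * Im w"
    using hyp_close_norm[OF assms(2,1,4) 1] hyp_close_norm[OF assms(2,3,5,7)] by simp
  finally have "cmod (z - u) \<le> (K + K' + 4) * Im w" by (simp add: algebra_simps)
  then have "(cmod (z - u))\<^sup>2 \<le> ((K + K' + 4) * Im w)\<^sup>2" by (rule power_mono) simp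
  also have "\<dots> = (K + K' + 4)\<^sup>2 * (Im w * Im w)" by (simp add: power2_eq_square)
  finally have *: "(cmod (z - u))\<^sup>2 \<le> (K + K' + 4)\<^sup>2 * (Im w * Im w)" .
  have "Im w * Im w \<le> ((K + 2) * Im z) * ((K' + 2) * Im u)"
    using hyp_close_Im[OF assms(1,2,4,6)] hyp_close_Im[OF assms(3,2,5) 2] pos assms(4)
    by (intro mult_mono) auto
  from mult_left_mono[OF this, of "(K + K' + 4)\<^sup>2"]
  have "(K + K' + 4)\<^sup>2 * (Im w * Im w) \<le> ((K + K' + 4)\<^sup>2 * ((K + 2) * (K' + 2))) * (Im z * Im u)"
    by (simp add: mult_ac)
  with * show ?thesis by simp
qed

text \<open>A coarse form of the triangle inequality, with some bound that depends only on
  \<open>a\<close> and \<open>b\<close>. This is what \<open>exists_grid_net\<close> asks of a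
  metric.\<close>

lemma hyp_dist_weak_triangle:
  "\<exists>c. \<forall>x\<in>hyp_plane. \<forall>y\<in>hyp_plane. \<forall>z\<in>hyp_plane. hyp_dist x y \<le> a \<longrightarrow> hyp_dist y z \<le> b \<longrightarrow> hyp_dist x z \<le> c"
proof -
  define K K' where "K = 2 * (cosh (max a 0) - 1)" and "K' = 2 * (cosh (max b 0) - 1)"
  have K: "K \<ge> 0" "K' \<ge> 0" by (auto simp: K_def K'_def cosh_real_ge_1)
  show ?thesis
  proof (intro exI ballI impI)
    fix x y z assume *: "x \<in> hyp_plane" "y \<in> hyp_plane" "z \<in> hyp_plane" "hyp_dist x y \<le> a" "hyp_dist y z \<le> b"
    have "hyp_dist x y \<le> max a 0" "hyp_dist y z \<le> max b 0" using * by auto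
    then have "(cmod (x - y))\<^sup>2 \<le> K * (Im x * Im y)" "(cmod (y - z))\<^sup>2 \<le> K' * (Im y * Im z)"
      using * by (auto simp: hyp_dist_le_iff K_def K'_def)
    from hyp_dist_leI[OF *(1,3) _ hyp_close_trans[OF *(1-3) K this]] K
    show "hyp_dist x z \<le> arcosh (1 + ((K + K' + 4)\<^sup>2 * ((K + 2) * (K' + 2))) / 2)" by simp
  qed
qed

lemma hyp_dist_commute: "hyp_dist z w = hyp_dist w z"
  by (simp add: hyp_dist_def norm_minus_commute mult_ac)

section \<open>Separators\<close>

lemma card_fibres_le:
  assumes "finite T" "\<And>p. p \<in> T \<Longrightarrow> card {z \<in> I. c z = p} \<le> M" "finite I"
  shows "card {z \<in> I. c z \<in> T} \<le> M * card T"
proof -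
  have "{z \<in> I. c z \<in> T} = (\<Union>p\<in>T. {z \<in> I. c z = p})" by auto
  then have "card {z \<in> I. c z \<in> T} \<le> (\<Sum>p\<in>T. card {z \<in> I. c z = p})"
    using card_UN_le[OF assms(1)] by simp
  also have "\<dots> \<le> card T * M" using sum_bounded_above[of T _ M, OF assms(2)] by simp
  finally show ?thesis by (simp add: mult.commute)
qed

definition int_box :: "int \<Rightarrow> int \<Rightarrow> int \<Rightarrow> int \<Rightarrow> (int \<times> int) set" where
  "int_box x0 x1 y0 y1 = {x0..<x1} \<times> {y0..<y1}"

text \<open>
  Take the smallest scale \<open>s\<close> at which a dyadic square carries 1/64 of the weight.  Its
  concentric enlargements by less than \<open>s\<close> all have balanced weight, and their boundary layers
  are disjoint; so \<open>r\<close> is at most \<open>E * card I / s\<close>, and it is also \<open>O(E * s)\<close>.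
\<close>

lemma plane_separation:
  fixes a :: "'v \<Rightarrow> int \<times> int" and c :: "'z \<Rightarrow> int \<times> int"
  assumes W: "finite W" and I: "finite I"
    and F: "\<And>p. card {v \<in> W. a v = p} \<le> F" "64 * F < card W"
    and M: "\<And>p. card {z \<in> I. c z = p} \<le> M"
    and cut: "\<And>x0 x1 y0 y1. card W \<le> 64 * card {v \<in> W. a v \<in> int_box x0 x1 y0 y1} \<Longrightarrow>
      card W \<le> 64 * card {v \<in> W. a v \<notin> int_box x0 x1 y0 y1} \<Longrightarrow>
      r \<le> E * card {z \<in> I. c z \<in> int_box (x0 - 1) (x1 + 1) (y0 - 1) (y1 + 1) - int_box x0 x1 y0 y1}"
  shows "r\<^sup>2 \<le> 8 * M * E\<^sup>2 * card I"
proof -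
  define sq where "sq m i j = int_box (i * 2 ^ m) ((i + 1) * 2 ^ m) (j * 2 ^ m) ((j + 1) * 2 ^ m)" for m i j
  define w where "w S = card {v \<in> W. a v \<in> S}" for S
  have w_Un: "w (\<Union>x\<in>X. T x) \<le> (\<Sum>x\<in>X. w (T x))" if "finite X" for X :: "(int \<times> int) set" and T
  proof -
    have "{v \<in> W. a v \<in> (\<Union>x\<in>X. T x)} = (\<Union>x\<in>X. {v \<in> W. a v \<in> T x})" by auto
    then show ?thesis unfolding w_def using card_UN_le[OF that] by simp
  qed
  have w_mono: "w S \<le> w T" if "S \<subseteq> T" for S T
    unfolding w_def using W that by (intro card_mono) auto
  define good where "good m \<longleftrightarrow> (\<exists>i j. card W \<le> 64 * w (sq m i j))" for m
  \<comment> \<open>Dyadic squares do not cross the coordinate axes, so four of them around the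
    origin are needed to cover all points \<open>a v\<close>. One of the four then carries a quarter
    of the weight.\<close>
  have "\<exists>m. good m"
  proof -
    define N where "N = (\<Sum>v\<in>W. nat \<bar>fst (a v)\<bar> + nat \<bar>snd (a v)\<bar>)"
    have N: "\<bar>fst (a v)\<bar> < 2 ^ N \<and> \<bar>snd (a v)\<bar> < 2 ^ N" if "v \<in> W" for v
    proof -
      have "nat \<bar>fst (a v)\<bar> + nat \<bar>snd (a v)\<bar> \<le> N" unfolding N_def using W that
        by (intro member_le_sum) auto
      moreover have "N < 2 ^ N" by (rule less_exp)
      ultimately have "nat \<bar>fst (a v)\<bar> < 2 ^ N" "nat \<bar>snd (a v)\<bar> < 2 ^ N" by linarith+
      then show ?thesis by (simp add: nat_less_iff)
    qed
    define X where "X = {-1, 0::int} \<times> {-1, 0::int}"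
    have "W = {v \<in> W. a v \<in> (\<Union>x\<in>X. sq N (fst x) (snd x))}"
    proof (intro equalityI subsetI CollectI conjI)
      fix v assume v: "v \<in> W"
      define i j where "i = (if fst (a v) < 0 then -1 else 0 :: int)"
        and "j = (if snd (a v) < 0 then -1 else 0 :: int)"
      have "a v \<in> sq N i j"
        using N[OF v] by (cases "a v") (auto simp: sq_def int_box_def i_def j_def)
      then show "a v \<in> (\<Union>x\<in>X. sq N (fst x) (snd x))"
        by (intro UN_I[of "(i, j)"]) (auto simp: X_def i_def j_def)
    qed auto
    then have "card W = w (\<Union>x\<in>X. sq N (fst x) (snd x))" unfolding w_def by simp
    also have "\<dots> \<le> (\<Sum>x\<in>X. w (sq N (fst x) (snd x)))" by (rule w_Un) (simp add: X_def)
    finally have le: "card W \<le> (\<Sum>x\<in>X. w (sq N (fst x) (snd x)))" .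
    show ?thesis
    proof (rule ccontr)
      assume "\<not> ?thesis"
      then have "64 * w (sq N (fst x) (snd x)) \<le> card W" for x
        by (auto simp: good_def not_le intro: less_imp_le)
      then have "(\<Sum>x\<in>X. 64 * w (sq N (fst x) (snd x))) \<le> card X * card W"
        using sum_bounded_above[of X "\<lambda>x. 64 * w (sq N (fst x) (snd x))" "card W"] by simp
      then have "64 * (\<Sum>x\<in>X. w (sq N (fst x) (snd x))) \<le> 4 * card W"
        by (simp add: sum_distrib_left X_def)
      then show False using le F(2) by linarith
    qed
  qed
  then have good: "good (LEAST m. good m)" by (rule LeastI_ex)
  define m where "m = (LEAST m. good m)"
  define S where "S = (2::nat) ^ m"
  obtain i j where ij: "card W \<le> 64 * w (sq m i j)" using good by (auto simp: m_def good_def)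
  \<comment> \<open>By minimality of \<open>m\<close>: a square of scale 0 is a single point and
    carries at most \<open>F\<close>; any other consists of four squares with less than 1/64 of the
    weight each.\<close>
  have small: "16 * w (sq m i' j') < card W" for i' j'
  proof (cases m)
    case 0
    have "sq m i' j' = {(i', j')}" by (auto simp: sq_def int_box_def 0)
    then show ?thesis using F(1)[of "(i', j')"] F(2) by (simp add: w_def)
  next
    case (Suc m')
    have "\<not> good m'" using not_less_Least[of m' good] Suc unfolding m_def by simp
    then have ng: "64 * w (sq m' i j) < card W" for i j by (auto simp: good_def not_le)
    define X where "X = {2 * i', 2 * i' + 1} \<times> {2 * j', 2 * j' + 1}"
    have "sq m i' j' \<subseteq> (\<Union>x\<in>X. sq m' (fst x) (snd x))"
      by (auto simp: sq_def int_box_def X_def Suc algebra_simps)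
    then have "w (sq m i' j') \<le> (\<Sum>x\<in>X. w (sq m' (fst x) (snd x)))"
      by (rule order_trans[OF w_mono w_Un]) (simp add: X_def)
    then have "64 * w (sq m i' j') \<le> (\<Sum>x\<in>X. 64 * w (sq m' (fst x) (snd x)))"
      by (simp add: sum_distrib_left[symmetric])
    also have "\<dots> < (\<Sum>x\<in>X. card W)"
      using ng by (intro sum_strict_mono) (auto simp: X_def)
    also have "\<dots> = 4 * card W" by (simp add: X_def)
    finally show ?thesis by simp
  qed
  define B where "B t = int_box (i * 2 ^ m - int t) ((i + 1) * 2 ^ m + int t)
      (j * 2 ^ m - int t) ((j + 1) * 2 ^ m + int t)" for t
  \<comment> \<open>As \<open>t\<close> is less than the side length, nine squares of the same scale
    cover \<open>B t\<close>. It carries at most 9/16 of the weight, and at least 1/64 because it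
    contains the heavy square.\<close>
  have layer: "r \<le> E * card {z \<in> I. c z \<in> B (Suc t) - B t}" if t: "t < S" for t
  proof -
    have ts: "int t < 2 ^ m" using t by (simp add: S_def)
    have "sq m i j \<subseteq> B t" by (auto simp: sq_def B_def int_box_def)
    then have 1: "card W \<le> 64 * w (B t)" using ij w_mono[of "sq m i j" "B t"] by simp
    define X where "X = {i - 1, i, i + 1} \<times> {j - 1, j, j + 1}"
    have "B t \<subseteq> (\<Union>x\<in>X. sq m (fst x) (snd x))"
    proof
      fix p assume p: "p \<in> B t"
      define L where "L = (2::int) ^ m"
      have near: "\<exists>i'\<in>{i - 1, i, i + 1}. i' * L \<le> z \<and> z < (i' + 1) * L"
        if "i * L - int t \<le> z" "z < (i + 1) * L + int t" for i z
      proof -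
        consider "z < i * L" | "i * L \<le> z" "z < (i + 1) * L" | "(i + 1) * L \<le> z" by linarith
        then show ?thesis
          using that ts unfolding L_def[symmetric] by cases (auto simp: algebra_simps)
      qed
      have pb: "i * L - int t \<le> fst p" "fst p < (i + 1) * L + int t"
        "j * L - int t \<le> snd p" "snd p < (j + 1) * L + int t"
        using p by (auto simp: B_def int_box_def L_def)
      obtain i' where i': "i' \<in> {i - 1, i, i + 1}" "i' * L \<le> fst p" "fst p < (i' + 1) * L"
        using near[OF pb(1,2)] by blast
      obtain j' where j': "j' \<in> {j - 1, j, j + 1}" "j' * L \<le> snd p" "snd p < (j' + 1) * L"
        using near[OF pb(3,4)] by blast
      have "p \<in> sq m i' j'" using i' j' by (cases p) (auto simp: sq_def int_box_def L_def)
      moreover have "(i', j') \<in> X" unfolding X_def using i'(1) j'(1) by (rule SigmaI)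
      ultimately show "p \<in> (\<Union>x\<in>X. sq m (fst x) (snd x))" by (intro UN_I[of "(i', j')"]) auto
    qed
    then have "w (B t) \<le> (\<Sum>x\<in>X. w (sq m (fst x) (snd x)))"
      by (rule order_trans[OF w_mono w_Un]) (simp add: X_def)
    then have "16 * w (B t) \<le> (\<Sum>x\<in>X. 16 * w (sq m (fst x) (snd x)))"
      by (simp add: sum_distrib_left[symmetric])
    also have "\<dots> \<le> (\<Sum>x\<in>X. card W)" using small by (intro sum_mono less_imp_le) auto
    also have "\<dots> = 9 * card W" by (simp add: X_def)
    finally have 2: "16 * w (B t) \<le> 9 * card W" .
    have "{v \<in> W. a v \<notin> B t} = W - {v \<in> W. a v \<in> B t}" by auto
    then have "card {v \<in> W. a v \<notin> B t} = card W - w (B t)"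
      using W by (simp add: w_def card_Diff_subset)
    then have 3: "card W \<le> 64 * card {v \<in> W. a v \<notin> B t}" using 2 by linarith
    have Bs: "B (Suc t) = int_box (i * 2 ^ m - int t - 1) ((i + 1) * 2 ^ m + int t + 1)
      (j * 2 ^ m - int t - 1) ((j + 1) * 2 ^ m + int t + 1)" by (simp add: B_def algebra_simps)
    show ?thesis unfolding Bs unfolding B_def
      by (rule cut) (use 1 3 in \<open>simp_all only: B_def w_def\<close>)
  qed
  have disj: "{z \<in> I. c z \<in> B (Suc t) - B t} \<inter> {z \<in> I. c z \<in> B (Suc t') - B t'} = {}" if "t < t'" for t t'
  proof -
    have "B (Suc t) \<subseteq> B t'" using that by (auto simp: B_def int_box_def)
    then show ?thesis by auto
  qed
  have "S * r = (\<Sum>t<S. r)" by simp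
  also have "\<dots> \<le> (\<Sum>t<S. E * card {z \<in> I. c z \<in> B (Suc t) - B t})"
    using layer by (intro sum_mono) auto
  also have "\<dots> = E * (\<Sum>t<S. card {z \<in> I. c z \<in> B (Suc t) - B t})" by (simp add: sum_distrib_left)
  also have "(\<Sum>t<S. card {z \<in> I. c z \<in> B (Suc t) - B t}) = card (\<Union>t<S. {z \<in> I. c z \<in> B (Suc t) - B t})"
  proof (rule card_UN_disjoint[symmetric])
    show "\<forall>t\<in>{..<S}. \<forall>t'\<in>{..<S}. t \<noteq> t' \<longrightarrow>
       {z \<in> I. c z \<in> B (Suc t) - B t} \<inter> {z \<in> I. c z \<in> B (Suc t') - B t'} = {}"
    proof (intro ballI impI)
      fix t t' :: nat assume "t \<noteq> t'"
      then consider "t < t'" | "t' < t" by linarith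
      then show "{z \<in> I. c z \<in> B (Suc t) - B t} \<inter> {z \<in> I. c z \<in> B (Suc t') - B t'} = {}"
        using disj[of t t'] disj[of t' t] by cases blast+
    qed
  qed (use I in auto)
  also have "\<dots> \<le> card I" using I by (intro card_mono) auto
  finally have Sr: "S * r \<le> E * card I" by simp
  \<comment> \<open>The innermost layer has \<open>4 * S + 4 \<le> 8 * S\<close> cells, so
    \<open>r\<close> is at most a multiple of \<open>S\<close>; the sum over all layers has bounded
    \<open>S * r\<close>. When the two are multiplied, the unknown scale cancels.\<close>
  have "r \<le> E * card {z \<in> I. c z \<in> B (Suc 0) - B 0}" by (rule layer) (simp add: S_def)
  also have "card {z \<in> I. c z \<in> B (Suc 0) - B 0} \<le> M * card (B (Suc 0) - B 0)"
    by (rule card_fibres_le) (use M I in \<open>auto simp: B_def int_box_def\<close>)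
  also have "card (B (Suc 0) - B 0) \<le> 8 * S"
  proof -
    have sub: "B 0 \<subseteq> B (Suc 0)" by (auto simp: B_def int_box_def)
    have fin: "finite (B t)" for t by (simp add: B_def int_box_def)
    have "card (B t) = (S + 2 * t)\<^sup>2" for t
    proof -
      have "nat ((i + 1) * 2 ^ m + int t - (i * 2 ^ m - int t)) = S + 2 * t" for i
        by (simp add: algebra_simps S_def nat_add_distrib nat_power_eq)
      then show ?thesis by (simp add: B_def int_box_def power2_eq_square)
    qed
    then have "card (B (Suc 0) - B 0) = (S + 2)\<^sup>2 - S\<^sup>2"
      using card_Diff_subset[OF fin sub] by simp
    also have "\<dots> = 4 * S + 4" by (simp add: power2_eq_square algebra_simps)
    also have "\<dots> \<le> 8 * S" by (simp add: S_def)
    finally show ?thesis .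
  qed
  finally have r: "r \<le> E * (M * (8 * S))" by simp
  have "r\<^sup>2 \<le> E * (M * (8 * S)) * r" using r by (simp add: power2_eq_square)
  also have "\<dots> = 8 * M * E * (S * r)" by (simp add: mult_ac)
  also have "\<dots> \<le> 8 * M * E * (E * card I)" using Sr by (intro mult_left_mono) auto
  finally show ?thesis by (simp add: power2_eq_square mult_ac)
qed

text \<open>
  A point at height at most \<open>s / 8\<close> cannot be close to both outer quarters of an interval of
  length \<open>s\<close>: passing to the better quarter halves the number of points.
\<close>

lemma exists_thin_vertical_line:
  fixes x y :: "'z \<Rightarrow> real"
  assumes I: "finite I"
    and M: "\<And>x0 s. s > 0 \<Longrightarrow> card {z \<in> I. s / 8 < y z \<and> y z \<le> s \<and> \<bar>x z - x0\<bar> \<le> 2 * s} \<le> M"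
  shows "P \<subseteq> I \<Longrightarrow> s > 0 \<Longrightarrow> (\<And>z. z \<in> P \<Longrightarrow> y z \<le> s) \<Longrightarrow> card P < 2 ^ k \<Longrightarrow>
    \<exists>\<theta>\<in>{x0..x0 + s}. card {z \<in> P. \<bar>x z - \<theta>\<bar> \<le> y z} \<le> M * k"
proof (induction k arbitrary: P s x0)
  case 0
  then have "P = {}" using I finite_subset by fastforce
  then show ?case using 0 by (intro bexI[of _ x0]) auto
next
  case (Suc k)
  have finP: "finite P" using Suc.prems(1) I finite_subset by blast
  \<comment> \<open>The low points that are close to some line in the quarter starting at
    \<open>u\<close>. For a line chosen there, only these and the points of height above
    \<open>s / 8\<close> can count.\<close>
  define A where "A u = {z \<in> P. y z \<le> s / 8 \<and> (\<exists>\<theta>\<in>{u..u + s / 4}. \<bar>x z - \<theta>\<bar> \<le> y z)}" for u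
  have fA: "finite (A u)" "A u \<subseteq> P" for u using finP by (auto simp: A_def)
  \<comment> \<open>The outer quarters are \<open>s / 2\<close> apart, whereas the lines close to a
    point of height at most \<open>s / 8\<close> lie in a window of length
    \<open>s / 4\<close>.\<close>
  define u1 u2 where "u1 = x0" and "u2 = x0 + 3 * s / 4"
  have "A u1 \<inter> A u2 = {}"
  proof (rule ccontr)
    assume "A u1 \<inter> A u2 \<noteq> {}"
    then obtain z t1 t2 where "y z \<le> s / 8" "t1 \<le> u1 + s / 4" "\<bar>x z - t1\<bar> \<le> y z"
      "u2 \<le> t2" "\<bar>x z - t2\<bar> \<le> y z" by (auto simp: A_def)
    then show False using Suc.prems(2) unfolding u1_def u2_def by linarith
  qed
  then have "card (A u1) + card (A u2) = card (A u1 \<union> A u2)"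
    using fA by (simp add: card_Un_disjoint)
  also have "\<dots> \<le> card P" using finP fA by (intro card_mono) auto
  also have "\<dots> < 2 * 2 ^ k" using Suc.prems(4) by simp
  finally have "card (A u1) < 2 ^ k \<or> card (A u2) < 2 ^ k" by linarith
  then obtain u where u: "u = u1 \<or> u = u2" "card (A u) < 2 ^ k" by blast
  have "\<exists>\<theta>\<in>{u..u + s / 4}. card {z \<in> A u. \<bar>x z - \<theta>\<bar> \<le> y z} \<le> M * k"
  proof (rule Suc.IH)
    show "A u \<subseteq> I" using fA Suc.prems(1) by blast
    show "s / 4 > 0" using Suc.prems(2) by simp
    show "y z \<le> s / 4" if "z \<in> A u" for z using that Suc.prems(2) by (auto simp: A_def)
  qed (fact u(2))
  then obtain \<theta> where \<theta>: "\<theta> \<in> {u..u + s / 4}" "card {z \<in> A u. \<bar>x z - \<theta>\<bar> \<le> y z} \<le> M * k" by blast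
  have \<theta>': "\<theta> \<in> {x0..x0 + s}" using \<theta>(1) u(1) Suc.prems(2) by (auto simp: u1_def u2_def)
  \<comment> \<open>The points that are too high for the recursive call. They contribute at most
    \<open>M\<close> at each of the \<open>k\<close> halvings, whence \<open>M * k\<close>.\<close>
  define Big where "Big = {z \<in> I. s / 8 < y z \<and> y z \<le> s \<and> \<bar>x z - x0\<bar> \<le> 2 * s}"
  have "{z \<in> P. \<bar>x z - \<theta>\<bar> \<le> y z} \<subseteq> {z \<in> A u. \<bar>x z - \<theta>\<bar> \<le> y z} \<union> Big"
  proof
    fix z assume z: "z \<in> {z \<in> P. \<bar>x z - \<theta>\<bar> \<le> y z}"
    then have "y z \<le> s" using Suc.prems(3) by auto
    then have "\<bar>x z - x0\<bar> \<le> 2 * s" using z \<theta>' by auto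
    then show "z \<in> {z \<in> A u. \<bar>x z - \<theta>\<bar> \<le> y z} \<union> Big"
      using z \<theta>(1) \<open>y z \<le> s\<close> Suc.prems(1) by (cases "y z \<le> s / 8") (auto simp: A_def Big_def)
  qed
  then have "card {z \<in> P. \<bar>x z - \<theta>\<bar> \<le> y z} \<le> card ({z \<in> A u. \<bar>x z - \<theta>\<bar> \<le> y z} \<union> Big)"
    using fA I by (intro card_mono) (auto simp: Big_def)
  also have "\<dots> \<le> M * k + M"
    using card_Un_le \<theta>(2) M[OF Suc.prems(2), of x0] unfolding Big_def
    by (meson add_mono order_trans)
  finally show ?case using \<theta>' by (intro bexI[of _ \<theta>]) auto
qed

text \<open>
  As in the plane, take the smallest dyadic box of height and width \<open>s\<close> with 1/64 of the weight,
  and move its two sides outwards to vertical lines that are close to few points.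
\<close>

lemma half_plane_separation:
  fixes x y :: "'z \<Rightarrow> real" and g :: "'v \<Rightarrow> 'z"
  assumes W: "finite W" and I: "finite I" and \<eta>: "\<eta> \<ge> 8"
    and pos: "\<And>v. v \<in> W \<Longrightarrow> y (g v) > 0"
    and F: "\<And>x0 s. s > 0 \<Longrightarrow>
      card {v \<in> W. s / \<eta> < y (g v) \<and> y (g v) \<le> s \<and> \<bar>x (g v) - x0\<bar> \<le> 2 * s} \<le> F" "64 * F < card W"
    and M: "\<And>x0 s. s > 0 \<Longrightarrow> card {z \<in> I. s / \<eta> < y z \<and> y z \<le> s \<and> \<bar>x z - x0\<bar> \<le> 2 * s} \<le> M"
    and cut: "\<And>s \<theta> \<theta>'. s > 0 \<Longrightarrow>
      card W \<le> 64 * card {v \<in> W. y (g v) \<le> s \<and> \<theta> \<le> x (g v) \<and> x (g v) < \<theta>'} \<Longrightarrow>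
      card W \<le> 64 * card {v \<in> W. \<not> (y (g v) \<le> s \<and> \<theta> \<le> x (g v) \<and> x (g v) < \<theta>')} \<Longrightarrow>
      r \<le> E * card {z \<in> I. y z \<le> s \<and> (\<bar>x z - \<theta>\<bar> \<le> y z \<or> \<bar>x z - \<theta>'\<bar> \<le> y z \<or>
        s / \<eta> < y z \<and> \<theta> \<le> x z \<and> x z < \<theta>')}"
    and k: "card I < 2 ^ k"
  shows "r \<le> E * (M * (2 * k + 1))"
proof -
  have Wne: "W \<noteq> {}" using F(2) by auto
  \<comment> \<open>Half the least height, so that boxes of scale 0 contain no point of
    \<open>W\<close> and the smallest good scale has a predecessor.\<close>
  define s0 where "s0 = Min ((\<lambda>v. y (g v)) ` W) / 2"
  have "Min ((\<lambda>v. y (g v)) ` W) \<in> (\<lambda>v. y (g v)) ` W" using W Wne by (intro Min_in) auto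
  then have s0: "s0 > 0" using pos by (auto simp: s0_def)
  have s0y: "s0 < y (g v)" if "v \<in> W" for v
  proof -
    have "Min ((\<lambda>v. y (g v)) ` W) \<le> y (g v)" using W that by (intro Min_le) auto
    then show ?thesis using s0 by (simp add: s0_def)
  qed
  define Q where "Q m i = {v \<in> W. y (g v) \<le> s0 * 2 ^ m \<and>
    s0 * 2 ^ m * of_int i \<le> x (g v) \<and> x (g v) < s0 * 2 ^ m * (of_int i + 1)}" for m :: nat and i :: int
  define good where "good m \<longleftrightarrow> (\<exists>i. card W \<le> 64 * card (Q m i))" for m
  have finQ: "finite (Q m i)" for m i using W by (simp add: Q_def)
  have "\<exists>m. good m"
  proof -
    define b where "b = (\<Sum>v\<in>W. \<bar>x (g v)\<bar> + y (g v))"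
    obtain m :: nat where m: "b / s0 < 2 ^ m" using real_arch_pow[of 2 "b / s0"] by auto
    have b: "\<bar>x (g v)\<bar> < s0 * 2 ^ m \<and> y (g v) < s0 * 2 ^ m" if "v \<in> W" for v
    proof -
      have "\<bar>x (g v)\<bar> + y (g v) \<le> b" unfolding b_def
        using W that pos by (intro member_le_sum[of v W "\<lambda>v. \<bar>x (g v)\<bar> + y (g v)"]) (auto simp: less_imp_le)
      also have "b < s0 * 2 ^ m" using m s0 by (simp add: field_simps)
      finally show ?thesis using pos[OF that] by linarith
    qed
    have "W \<subseteq> Q m (- 1) \<union> Q m 0"
    proof
      fix v assume "v \<in> W"
      then show "v \<in> Q m (- 1) \<union> Q m 0" using b[of v] by (auto simp: Q_def)
    qed
    then have "card W \<le> card (Q m (- 1)) + card (Q m 0)"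
      by (meson card_Un_le card_mono finQ finite_UnI order_trans)
    then have "card W \<le> 64 * card (Q m (- 1)) \<or> card W \<le> 64 * card (Q m 0)" by linarith
    then show ?thesis unfolding good_def by blast
  qed
  then have good: "good (LEAST m. good m)" by (rule LeastI_ex)
  define m where "m = (LEAST m. good m)"
  obtain i where i: "card W \<le> 64 * card (Q m i)" using good by (auto simp: m_def good_def)
  have "Q 0 i = {}" for i using s0y by (force simp: Q_def)
  then have "m \<noteq> 0" using i Wne W by (auto simp: card_gt_0_iff)
  then obtain m' where m': "m = Suc m'" using not0_implies_Suc by blast
  define s where "s = s0 * 2 ^ m"
  have s: "s > 0" "s0 * 2 ^ m' = s / 2" using s0 by (auto simp: s_def m')
  have "\<not> good m'" using not_less_Least[of m' good] m' unfolding m_def by simp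
  then have ng: "64 * card (Q m' i) < card W" for i by (auto simp: good_def not_le)
  \<comment> \<open>The lower half of a box consists of two boxes of half the size, with less than
    1/64 of the weight each by minimality; the upper half carries at most \<open>F\<close>, again
    less than 1/64.\<close>
  have small: "64 * card (Q m i) < 3 * card W" for i
  proof -
    define T where "T = {v \<in> W. s / \<eta> < y (g v) \<and> y (g v) \<le> s \<and> \<bar>x (g v) - s * of_int i\<bar> \<le> 2 * s}"
    have "Q m i \<subseteq> Q m' (2 * i) \<union> Q m' (2 * i + 1) \<union> T"
    proof
      fix v assume v: "v \<in> Q m i"
      then have v': "v \<in> W" "y (g v) \<le> s" "s * of_int i \<le> x (g v)" "x (g v) < s * of_int i + s"
        by (auto simp: Q_def s_def[symmetric] algebra_simps)
      show "v \<in> Q m' (2 * i) \<union> Q m' (2 * i + 1) \<union> T"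
      proof (cases "y (g v) \<le> s / 2")
        case True
        then show ?thesis using v' by (auto simp: Q_def s(2) algebra_simps)
      next
        case False
        have "s / \<eta> \<le> s / 2" using \<eta> s(1) by (intro divide_left_mono) auto
        then have "s / \<eta> < y (g v)" using False by linarith
        then show ?thesis using v' s(1) by (auto simp: T_def)
      qed
    qed
    moreover have "finite (Q m' (2 * i) \<union> Q m' (2 * i + 1) \<union> T)"
      using W finQ by (auto simp: T_def)
    ultimately have "card (Q m i) \<le> card (Q m' (2 * i) \<union> Q m' (2 * i + 1) \<union> T)" by (intro card_mono)
    also have "\<dots> \<le> card (Q m' (2 * i)) + card (Q m' (2 * i + 1)) + card T"
      by (meson add_mono card_Un_le order_refl order_trans)
    finally have "card (Q m i) \<le> card (Q m' (2 * i)) + card (Q m' (2 * i + 1)) + card T" .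
    moreover have "card T \<le> F" unfolding T_def by (rule F(1)[OF s(1)])
    ultimately show ?thesis using ng[of "2 * i"] ng[of "2 * i + 1"] F(2) by linarith
  qed
  define P where "P = {z \<in> I. y z \<le> s}"
  have M8: "card {z \<in> I. s / 8 < y z \<and> y z \<le> s \<and> \<bar>x z - x0\<bar> \<le> 2 * s} \<le> M" if "s > 0" for s x0
  proof -
    have le: "s / \<eta> \<le> s / 8" using \<eta> that by (intro divide_left_mono) auto
    have "card {z \<in> I. s / 8 < y z \<and> y z \<le> s \<and> \<bar>x z - x0\<bar> \<le> 2 * s}
      \<le> card {z \<in> I. s / \<eta> < y z \<and> y z \<le> s \<and> \<bar>x z - x0\<bar> \<le> 2 * s}"
      using I by (intro card_mono) (auto intro: le_less_trans[OF le])
    with M[OF that] show ?thesis by (rule order_trans[rotated])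
  qed
  have cP: "card P < 2 ^ k" using card_mono[OF I, of P] k by (simp add: P_def)
  have thin: "\<exists>\<theta>\<in>{x0..x0 + s}. card {z \<in> P. \<bar>x z - \<theta>\<bar> \<le> y z} \<le> M * k" for x0
    by (rule exists_thin_vertical_line[OF I M8 _ s(1) _ cP]) (auto simp: P_def)
  \<comment> \<open>Each side moves outwards by at most \<open>s\<close>. So the region contains the
    heavy box and is covered by that box and its two neighbours, which carry at most 9/64 of the
    weight.\<close>
  obtain \<theta> where \<theta>: "\<theta> \<in> {s * of_int i - s..s * of_int i}" "card {z \<in> P. \<bar>x z - \<theta>\<bar> \<le> y z} \<le> M * k"
    using thin[of "s * of_int i - s"] by auto
  obtain \<theta>' where \<theta>': "\<theta>' \<in> {s * of_int i + s..s * of_int i + s + s}" "card {z \<in> P. \<bar>x z - \<theta>'\<bar> \<le> y z} \<le> M * k"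
    using thin[of "s * of_int i + s"] by auto
  define R where "R = {v \<in> W. y (g v) \<le> s \<and> \<theta> \<le> x (g v) \<and> x (g v) < \<theta>'}"
  have "Q m i \<subseteq> R" using \<theta>(1) \<theta>'(1) by (auto simp: R_def Q_def s_def[symmetric] algebra_simps)
  then have "card (Q m i) \<le> card R" using W by (intro card_mono) (auto simp: R_def)
  then have 1: "card W \<le> 64 * card R" using i by linarith
  have "R \<subseteq> Q m (i - 1) \<union> Q m i \<union> Q m (i + 1)"
    using \<theta>(1) \<theta>'(1) by (auto simp: R_def Q_def s_def[symmetric] algebra_simps)
  then have "card R \<le> card (Q m (i - 1) \<union> Q m i \<union> Q m (i + 1))"
    using finQ by (intro card_mono) auto
  also have "\<dots> \<le> card (Q m (i - 1)) + card (Q m i) + card (Q m (i + 1))"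
    by (meson add_mono card_Un_le order_refl order_trans)
  finally have 2: "64 * card R \<le> 9 * card W"
    using small[of "i - 1"] small[of i] small[of "i + 1"] by linarith
  have "{v \<in> W. \<not> (y (g v) \<le> s \<and> \<theta> \<le> x (g v) \<and> x (g v) < \<theta>')} = W - R" by (auto simp: R_def)
  moreover have "card (W - R) = card W - card R"
    using W by (intro card_Diff_subset) (auto simp: R_def)
  ultimately have 3: "card W \<le> 64 * card {v \<in> W. \<not> (y (g v) \<le> s \<and> \<theta> \<le> x (g v) \<and> x (g v) < \<theta>')}"
    using 2 by simp
  \<comment> \<open>The top layer, with its window centred at the middle of the heavy box: the
    region reaches only \<open>3 * s / 2\<close> to either side, within the allowed
    \<open>2 * s\<close>.\<close>
  define T where "T = {z \<in> I. s / \<eta> < y z \<and> y z \<le> s \<and> \<bar>x z - (s * of_int i + s / 2)\<bar> \<le> 2 * s}"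
  have "r \<le> E * card {z \<in> I. y z \<le> s \<and> (\<bar>x z - \<theta>\<bar> \<le> y z \<or> \<bar>x z - \<theta>'\<bar> \<le> y z \<or>
        s / \<eta> < y z \<and> \<theta> \<le> x z \<and> x z < \<theta>')}"
    using cut[OF s(1)] 1 3 unfolding R_def by blast
  also have "card {z \<in> I. y z \<le> s \<and> (\<bar>x z - \<theta>\<bar> \<le> y z \<or> \<bar>x z - \<theta>'\<bar> \<le> y z \<or>
        s / \<eta> < y z \<and> \<theta> \<le> x z \<and> x z < \<theta>')}
    \<le> card ({z \<in> P. \<bar>x z - \<theta>\<bar> \<le> y z} \<union> {z \<in> P. \<bar>x z - \<theta>'\<bar> \<le> y z} \<union> T)"
    using I \<theta>(1) \<theta>'(1) s(1) by (intro card_mono) (auto simp: P_def T_def)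
  also have "\<dots> \<le> card {z \<in> P. \<bar>x z - \<theta>\<bar> \<le> y z} + card {z \<in> P. \<bar>x z - \<theta>'\<bar> \<le> y z} + card T"
    by (meson add_mono card_Un_le order_refl order_trans)
  also have "\<dots> \<le> M * k + M * k + M"
    using \<theta>(2) \<theta>'(2) M[OF s(1), of "s * of_int i + s / 2"] unfolding T_def by linarith
  also have "\<dots> = M * (2 * k + 1)" by (simp add: algebra_simps)
  finally show ?thesis by simp
qed

section \<open>Wirings along grids\<close>

text \<open>Walks are handled up to existence, which turns concatenation and reversal into
  transitivity and symmetry.\<close>

definition joined_in :: "'a graph \<Rightarrow> 'a set \<Rightarrow> 'a \<Rightarrow> 'a \<Rightarrow> bool" where
  "joined_in G A u v \<longleftrightarrow> (\<exists>w. walk_between G u v w \<and> set w \<subseteq> A)"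

lemma joined_in_refl: "u \<in> verts G \<Longrightarrow> u \<in> A \<Longrightarrow> joined_in G A u u"
  unfolding joined_in_def walk_between_def is_walk_def by (rule exI[of _ "[u]"]) simp

lemma joined_in_sym: "joined_in G A u v \<Longrightarrow> joined_in G A v u"
  unfolding joined_in_def
proof (elim exE conjE)
  fix w assume "walk_between G u v w" "set w \<subseteq> A"
  then show "\<exists>w. walk_between G v u w \<and> set w \<subseteq> A"
    by (intro exI[of _ "rev w"]) (auto simp: walk_between_def is_walk_rev hd_rev last_rev)
qed

lemma joined_in_mono: "joined_in G A u v \<Longrightarrow> A \<subseteq> B \<Longrightarrow> joined_in G B u v"
  unfolding joined_in_def by blast

lemma joined_in_trans:
  assumes "joined_in G A u v" "joined_in G A v x"
  shows "joined_in G A u x"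
proof -
  obtain w w' where w: "walk_between G u v w" "set w \<subseteq> A" and w': "walk_between G v x w'" "set w' \<subseteq> A"
    using assms by (auto simp: joined_in_def)
  have ne: "w \<noteq> []" "w' \<noteq> []" using w w' by (auto simp: walk_between_def is_walk_def)
  then obtain y ys where w'_eq: "w' = y # ys" by (cases w') auto
  have y: "y = last w" using w w' w'_eq by (auto simp: walk_between_def)
  have "is_walk G (w @ ys)"
    using w(1) w'(1) ne y unfolding walk_between_def is_walk_def w'_eq
    by (auto simp: successively_append_iff successively_Cons)
  moreover have "hd (w @ ys) = u" using w ne by (simp add: walk_between_def)
  moreover have "last (w @ ys) = x" using w(1) w' ne y by (auto simp: walk_between_def w'_eq)
  ultimately show ?thesis
    using w(2) w'(2) unfolding joined_in_def walk_between_def w'_eq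
    by (intro exI[of _ "w @ ys"]) auto
qed

lemma card_edges_le:
  assumes "is_graph G" "finite (verts G)" "degree_le G d"
  shows "card (edges G) \<le> card (verts G) * d"
proof -
  have "edges G \<subseteq> (\<Union>v\<in>verts G. {e \<in> edges G. v \<in> e})"
  proof
    fix e assume e: "e \<in> edges G"
    then obtain v where "v \<in> e" using assms(1) by (fastforce simp: is_graph_def card_2_iff)
    then show "e \<in> (\<Union>v\<in>verts G. {e \<in> edges G. v \<in> e})"
      using e assms(1) by (auto simp: is_graph_def)
  qed
  then have "card (edges G) \<le> card (\<Union>v\<in>verts G. {e \<in> edges G. v \<in> e})"
    using finite_edges[OF assms(1,2)] assms(2) by (intro card_mono) auto
  also have "\<dots> \<le> (\<Sum>v\<in>verts G. card {e \<in> edges G. v \<in> e})" by (rule card_UN_le[OF assms(2)])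
  also have "\<dots> \<le> card (verts G) * d"
    using sum_bounded_above[of "verts G" "\<lambda>v. card {e \<in> edges G. v \<in> e}" d] assms(3)
    by (simp add: degree_le_def)
  finally show ?thesis .
qed

text \<open>
  For \<open>\<beta> = 1\<close> the index set is a quadrant of the square grid, for \<open>\<beta> = 2\<close> a strip of the hyperbolic
  plane in which row \<open>j\<close> lies on the horocycle at height \<open>1 / 2 ^ j\<close>.
\<close>

definition grid_net :: "'y graph \<Rightarrow> nat \<Rightarrow> (nat \<times> nat \<Rightarrow> 'y) \<Rightarrow> (nat \<times> nat \<Rightarrow> 'y set) \<Rightarrow> nat \<Rightarrow> nat \<Rightarrow> bool" where
  "grid_net Y \<beta> \<psi> N l B \<longleftrightarrow>
     (\<forall>q. \<psi> q \<in> verts Y \<and> \<psi> q \<in> N q \<and> finite (N q) \<and> card (N q) \<le> l) \<and>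
     (\<forall>i j. joined_in Y (N (i, j)) (\<psi> (i, j)) (\<psi> (Suc i, j)) \<and>
            joined_in Y (N (i, j)) (\<psi> (i, j)) (\<psi> (\<beta> * i, Suc j))) \<and>
     (\<forall>y. finite {q. y \<in> N q} \<and> card {q. y \<in> N q} \<le> B)"

text \<open>
  The vertices are sent to row \<open>0\<close>; the edge number \<open>t\<close> follows the column of one endpoint to row
  \<open>t\<close>, then that row, and returns along the column of the other endpoint.  Hence a grid edge is
  used at most \<open>d\<close> times as part of a column and once as part of a row.
\<close>

lemma wir_le_of_grid_net:
  assumes Y: "is_graph Y" and net: "grid_net Y \<beta> \<psi> N l B" and \<beta>: "\<beta> \<ge> 1"
    and G: "is_graph G" "finite (verts G)" "degree_le G d" "card (verts G) \<le> n"
    and k: "B * (d + 1) \<le> k"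
  shows "wir k G Y \<le> enat (l * ((n * \<beta> ^ (n * d) + 1) * (n * d + 1)))"
proof -
  have N: "\<psi> q \<in> verts Y" "\<psi> q \<in> N q" "finite (N q)" "card (N q) \<le> l" for q
    using net unfolding grid_net_def by blast+
  have right: "joined_in Y (N (i, j)) (\<psi> (i, j)) (\<psi> (Suc i, j))" for i j
    using net unfolding grid_net_def by blast
  have up: "joined_in Y (N (i, j)) (\<psi> (i, j)) (\<psi> (\<beta> * i, Suc j))" for i j
    using net unfolding grid_net_def by blast
  have B: "finite {q. y \<in> N q}" "card {q. y \<in> N q} \<le> B" for y
    using net unfolding grid_net_def by blast+
  have finE: "finite (edges G)" by (rule finite_edges[OF G(1,2)])
  obtain \<iota> where \<iota>: "inj_on \<iota> (verts G)" "\<iota> ` verts G = {..<card (verts G)}"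
    using ex_bij_betw_finite_nat[OF G(2)] by (auto simp: bij_betw_def atLeast0LessThan)
  obtain \<kappa> where \<kappa>: "inj_on \<kappa> (edges G)" "\<kappa> ` edges G = {..<card (edges G)}"
    using ex_bij_betw_finite_nat[OF finE] by (auto simp: bij_betw_def atLeast0LessThan)
  define m where "m = n * d"
  have \<iota>n: "\<iota> v < n" if "v \<in> verts G" for v
  proof -
    have "\<iota> v \<in> {..<card (verts G)}" using \<iota>(2) that by blast
    then show ?thesis using G(4) by simp
  qed
  have \<kappa>m: "\<kappa> e < m" if "e \<in> edges G" for e
  proof -
    have "\<kappa> e < card (edges G)" using \<kappa>(2) that by blast
    also have "\<dots> \<le> card (verts G) * d" by (rule card_edges_le[OF G(1-3)])
    also have "\<dots> \<le> m" using G(4) by (simp add: m_def)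
    finally show ?thesis .
  qed
  \<comment> \<open>The grid positions available to \<open>e\<close>: the columns of its endpoints
    down to row \<open>\<kappa> e\<close>, and a stretch of that row wide enough for every column,
    since column \<open>\<iota> v\<close> meets row \<open>t\<close> at
    \<open>\<iota> v * \<beta> ^ t\<close>.\<close>
  define U where "U e = {(\<iota> v * \<beta> ^ t, t) |v t. v \<in> e \<and> t \<le> \<kappa> e} \<union>
    {(i, \<kappa> e) |i. i < n * \<beta> ^ \<kappa> e}" for e
  define A where "A e = (\<Union>q\<in>U e. N q)" for e
  define g where "g v = \<psi> (\<iota> v, 0)" for v
  have A_mono: "N q \<subseteq> A e" if "q \<in> U e" for q e using that by (auto simp: A_def)
  have column: "joined_in Y (A e) (g v) (\<psi> (\<iota> v * \<beta> ^ t, t))" if "v \<in> e" "t \<le> \<kappa> e" for v e t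
    using that(2)
  proof (induction t)
    case 0
    have "(\<iota> v, 0) \<in> U e" unfolding U_def using that(1) by (force intro: exI[of _ v])
    then have "g v \<in> A e" using N(2)[of "(\<iota> v, 0)"] A_mono by (auto simp: g_def)
    then show ?case using N(1) by (auto simp: g_def intro: joined_in_refl)
  next
    case (Suc t)
    have "(\<iota> v * \<beta> ^ t, t) \<in> U e" using that Suc.prems by (auto simp: U_def)
    then have "joined_in Y (A e) (\<psi> (\<iota> v * \<beta> ^ t, t)) (\<psi> (\<beta> * (\<iota> v * \<beta> ^ t), Suc t))"
      using up A_mono joined_in_mono by metis
    moreover have "joined_in Y (A e) (g v) (\<psi> (\<iota> v * \<beta> ^ t, t))" using Suc by simp
    ultimately show ?case using joined_in_trans by (fastforce simp: mult_ac)
  qed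
  \<comment> \<open>Within its row the edge passes through position \<open>(0, \<kappa> e)\<close>,
    to which both columns are joined; no case distinction on the order of the columns
    arises.\<close>
  have row: "joined_in Y (A e) (\<psi> (0, \<kappa> e)) (\<psi> (i, \<kappa> e))" if "i \<le> n * \<beta> ^ \<kappa> e" "n > 0" for i e
    using that(1)
  proof (induction i)
    case 0
    have "(0, \<kappa> e) \<in> U e" using that(2) \<beta> by (auto simp: U_def)
    then have "\<psi> (0, \<kappa> e) \<in> A e" using N(2) A_mono by blast
    then show ?case using N(1) by (auto intro: joined_in_refl)
  next
    case (Suc i)
    have "(i, \<kappa> e) \<in> U e" using Suc.prems by (auto simp: U_def)
    then have "joined_in Y (A e) (\<psi> (i, \<kappa> e)) (\<psi> (Suc i, \<kappa> e))"
      using right A_mono joined_in_mono by metis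
    then show ?case using Suc joined_in_trans by fastforce
  qed
  have "\<exists>w u v. e = {u, v} \<and> walk_between Y (g u) (g v) w \<and> set w \<subseteq> A e" if e: "e \<in> edges G" for e
  proof -
    obtain u v where uv: "e = {u, v}" using e G(1) by (auto simp: is_graph_def card_2_iff)
    then have V: "u \<in> verts G" "v \<in> verts G" using e G(1) by (auto simp: is_graph_def)
    have "n > 0" using \<iota>n[OF V(1)] by simp
    have *: "joined_in Y (A e) (\<psi> (0, \<kappa> e)) (\<psi> (\<iota> x * \<beta> ^ \<kappa> e, \<kappa> e))" if "x \<in> verts G" for x
      using row[OF _ \<open>n > 0\<close>] \<iota>n[OF that] by (simp add: less_imp_le)
    have "joined_in Y (A e) (g u) (\<psi> (0, \<kappa> e))"
      using joined_in_trans[OF column joined_in_sym[OF *[OF V(1)]]] uv by simp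
    moreover have "joined_in Y (A e) (\<psi> (0, \<kappa> e)) (g v)"
      using joined_in_trans[OF *[OF V(2)] joined_in_sym[OF column]] uv by simp
    ultimately have "joined_in Y (A e) (g u) (g v)" by (rule joined_in_trans)
    then show ?thesis using uv unfolding joined_in_def by blast
  qed
  then obtain P where P: "\<And>e. e \<in> edges G \<Longrightarrow> \<exists>u v. e = {u, v} \<and> walk_between Y (g u) (g v) (P e)"
    "\<And>e. e \<in> edges G \<Longrightarrow> set (P e) \<subseteq> A e" by metis
  obtain f where f: "wiring G Y f" "\<And>v. v \<in> verts G \<Longrightarrow> f (vertex_pt v) = vertex_pt (g v)"
    "\<And>e. e \<in> edges G \<Longrightarrow> f ` cell e = realisation (walk_graph (P e))"
    by (rule wiring_of_walks[OF G(1,2) Y _ P(1)]) (auto simp: g_def N(1))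
  have "coarse_wiring k G Y f"
    unfolding coarse_wiring_def
  proof (intro conjI ballI f(1))
    fix y assume "y \<in> verts Y"
    have "card {v \<in> verts G. f (vertex_pt v) = vertex_pt y} \<le> card {q. y \<in> N q}"
    proof (rule card_inj_on_le)
      show "inj_on (\<lambda>v. (\<iota> v, 0::nat)) {v \<in> verts G. f (vertex_pt v) = vertex_pt y}"
        using \<iota>(1) by (auto simp: inj_on_def)
      show "(\<lambda>v. (\<iota> v, 0)) ` {v \<in> verts G. f (vertex_pt v) = vertex_pt y} \<subseteq> {q. y \<in> N q}"
        using f(2) N(2) by (auto simp: g_def)
    qed (rule B(1))
    also have "\<dots> \<le> k" using B(2)[of y] k by simp
    finally show "card {v \<in> verts G. f (vertex_pt v) = vertex_pt y} \<le> k" .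
  next
    fix e' assume e': "e' \<in> edges Y"
    obtain a b where ab: "e' = {a, b}" "a \<noteq> b" using e' Y by (auto simp: is_graph_def card_2_iff)
    have users: "card {e \<in> edges G. q \<in> U e} \<le> d + 1" for q
    proof -
      obtain i t where q: "q = (i, t)" by (cases q)
      define E1 where "E1 = {e \<in> edges G. \<kappa> e = t}"
      \<comment> \<open>Different columns never meet, because multiplication by
        \<open>\<beta> ^ t\<close> is injective. So the position determines the endpoint
        \<open>v\<close>, and at most \<open>d\<close> edges use it as part of a column.\<close>
      define E2 where "E2 = {e \<in> edges G. \<exists>v\<in>e. \<iota> v * \<beta> ^ t = i}"
      have "card E1 \<le> card {t}" unfolding E1_def
        by (rule card_inj_on_le[of \<kappa>]) (use \<kappa>(1) in \<open>auto intro: inj_on_subset\<close>)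
      then have E1: "card E1 \<le> 1" by simp
      have E2: "card E2 \<le> d"
      proof (cases "E2 = {}")
        case False
        then obtain e v where ev: "e \<in> edges G" "v \<in> e" "\<iota> v * \<beta> ^ t = i" by (auto simp: E2_def)
        then have v: "v \<in> verts G" using G(1) by (auto simp: is_graph_def)
        have "E2 \<subseteq> {e \<in> edges G. v \<in> e}"
        proof
          fix e2 assume "e2 \<in> E2"
          then obtain v2 where e2: "e2 \<in> edges G" "v2 \<in> e2" "\<iota> v2 * \<beta> ^ t = i" by (auto simp: E2_def)
          then have "v2 \<in> verts G" using G(1) by (auto simp: is_graph_def)
          moreover have "\<iota> v2 = \<iota> v" using e2(3) ev(3) \<beta> by (metis mult_cancel2 not_one_le_zero power_not_zero)
          ultimately have "v2 = v" using v \<iota>(1) by (auto dest: inj_onD)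
          then show "e2 \<in> {e \<in> edges G. v \<in> e}" using e2 by simp
        qed
        moreover have "finite {e \<in> edges G. v \<in> e}" "card {e \<in> edges G. v \<in> e} \<le> d"
          using G(3) v unfolding degree_le_def by blast+
        ultimately show ?thesis using card_mono order_trans by blast
      qed simp
      have "{e \<in> edges G. q \<in> U e} \<subseteq> E1 \<union> E2" by (auto simp: U_def q E1_def E2_def)
      then have "card {e \<in> edges G. q \<in> U e} \<le> card (E1 \<union> E2)"
        using finE by (intro card_mono) (auto simp: E1_def E2_def)
      also have "\<dots> \<le> card E1 + card E2" by (rule card_Un_le)
      finally show ?thesis using E1 E2 by simp
    qed
    \<comment> \<open>A walk through \<open>e'\<close> visits \<open>a\<close>, hence its edge uses
      one of the at most \<open>B\<close> positions \<open>q\<close> with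
      \<open>a \<in> N q\<close>, and each position has at most \<open>d + 1\<close> users.\<close>
    have sub: "{e \<in> edges G. cell e' \<subseteq> f ` cell e} \<subseteq> (\<Union>q\<in>{q. a \<in> N q}. {e \<in> edges G. q \<in> U e})"
    proof
      fix e assume "e \<in> {e \<in> edges G. cell e' \<subseteq> f ` cell e}"
      then have e: "e \<in> edges G" "cell {a, b} \<subseteq> realisation (walk_graph (P e))"
        using f(3) ab(1) by auto
      from e(2) have "{a, b} \<in> edges (walk_graph (P e))" using ab(2) by (rule cell_subset_walk_graph)
      then have "a \<in> set (P e)" by (auto simp: walk_graph_def doubleton_eq_iff)
      then have "a \<in> A e" using P(2)[OF e(1)] by blast
      then show "e \<in> (\<Union>q\<in>{q. a \<in> N q}. {e \<in> edges G. q \<in> U e})" using e(1) by (auto simp: A_def)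
    qed
    have "card {e \<in> edges G. cell e' \<subseteq> f ` cell e} \<le> card (\<Union>q\<in>{q. a \<in> N q}. {e \<in> edges G. q \<in> U e})"
      using sub finE B(1) by (intro card_mono finite_UN_I) auto
    also have "\<dots> \<le> (\<Sum>q\<in>{q. a \<in> N q}. card {e \<in> edges G. q \<in> U e})" by (rule card_UN_le[OF B(1)])
    also have "\<dots> \<le> card {q. a \<in> N q} * (d + 1)"
      using sum_bounded_above[of "{q. a \<in> N q}" "\<lambda>q. card {e \<in> edges G. q \<in> U e}" "d + 1"] users by simp
    also have "\<dots> \<le> B * (d + 1)" using B(2) by (intro mult_right_mono) auto
    also have "\<dots> \<le> k" by (rule k)
    finally show "card {e \<in> edges G. cell e' \<subseteq> f ` cell e} \<le> k" .
  qed
  then have "wir k G Y \<le> enat (volume G Y f)"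
    unfolding wir_def by (intro INF_lower) simp
  also have "volume G Y f \<le> l * ((n * \<beta> ^ (n * d) + 1) * (n * d + 1))"
  proof -
    define Q where "Q = {..n * \<beta> ^ m} \<times> {..m}"
    have le: "n * \<beta> ^ t \<le> n * \<beta> ^ m" if "t \<le> m" for t
      using \<beta> that by (intro mult_left_mono power_increasing) auto
    have "n \<le> n * \<beta> ^ m" using \<beta> by simp
    have UQ: "U e \<subseteq> Q" if e: "e \<in> edges G" for e
    proof
      fix q assume "q \<in> U e"
      then consider v t where "q = (\<iota> v * \<beta> ^ t, t)" "v \<in> e" "t \<le> \<kappa> e"
        | i where "q = (i, \<kappa> e)" "i < n * \<beta> ^ \<kappa> e" by (auto simp: U_def)
      then show "q \<in> Q"
      proof cases
        case 1
        then have "\<iota> v \<le> n" using \<iota>n e G(1) by (fastforce simp: is_graph_def intro: less_imp_le)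
        then have "\<iota> v * \<beta> ^ t \<le> n * \<beta> ^ t" by (rule mult_le_mono1)
        moreover have "t \<le> m" using 1(3) \<kappa>m[OF e] by simp
        ultimately have "\<iota> v * \<beta> ^ t \<le> n * \<beta> ^ m" using le order_trans by blast
        then show ?thesis using 1(1) \<open>t \<le> m\<close> by (simp add: Q_def)
      next
        case 2
        have "\<kappa> e \<le> m" using \<kappa>m[OF e] by simp
        then have "i \<le> n * \<beta> ^ m" using 2(2) le[of "\<kappa> e"] by linarith
        then show ?thesis using 2(1) \<open>\<kappa> e \<le> m\<close> by (simp add: Q_def)
      qed
    qed
    have "verts (wiring_image G Y f) \<subseteq> (\<Union>q\<in>Q. N q)"
    proof
      fix y assume "y \<in> verts (wiring_image G Y f)"
      then have "vertex_pt y \<in> f ` realisation G" by (simp add: wiring_image_def)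
      then consider v where "v \<in> verts G" "vertex_pt y = f (vertex_pt v)"
        | e where "e \<in> edges G" "vertex_pt y \<in> f ` cell e"
        by (auto simp: realisation_def)
      then show "y \<in> (\<Union>q\<in>Q. N q)"
      proof cases
        case 1
        then have "y \<in> N (\<iota> v, 0)" using f(2) N(2) by (simp add: g_def)
        moreover have "\<iota> v \<le> n * \<beta> ^ m" using \<iota>n[OF 1(1)] \<open>n \<le> n * \<beta> ^ m\<close> by linarith
        then have "(\<iota> v, 0) \<in> Q" by (simp add: Q_def)
        ultimately show ?thesis by blast
      next
        case 2
        then have "y \<in> set (P e)" using f(3) vertex_pt_mem_walk_graph by metis
        then have "y \<in> A e" using P(2) 2(1) by blast
        then show ?thesis using UQ[OF 2(1)] by (auto simp: A_def)
      qed
    qed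
    then have "volume G Y f \<le> card (\<Union>q\<in>Q. N q)"
      unfolding volume_def using N(3) by (intro card_mono finite_UN_I) (auto simp: Q_def)
    also have "\<dots> \<le> (\<Sum>q\<in>Q. card (N q))" by (rule card_UN_le) (simp add: Q_def)
    also have "\<dots> \<le> card Q * l" using sum_bounded_above[of Q "\<lambda>q. card (N q)" l] N(4) by simp
    also have "card Q = (n * \<beta> ^ m + 1) * (m + 1)" by (simp add: Q_def card_cartesian_product)
    finally show ?thesis by (simp add: m_def mult.commute)
  qed
  finally show ?thesis by simp
qed

section \<open>Construction of grid nets in the two target geometries\<close>

text \<open>\<open>\<psi> q\<close> is a vertex with image near \<open>pos q\<close>, and
  \<open>N q\<close> consists of two short walks that start there, one for each kind of step. A
  vertex \<open>y\<close> lies in \<open>N q\<close> only if \<open>pos q\<close> is within a fixed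
  distance of \<open>f y\<close>, so \<open>count\<close> bounds the overlap of the sets
  \<open>N q\<close>.\<close>

lemma exists_grid_net:
  assumes Y: "is_graph Y" "bounded_degree Y" "graph_quasi_isometric_to Y M \<delta>"
    and sym: "\<And>x y. \<delta> x y = \<delta> y x"
    and tri: "\<And>a b. \<exists>c. \<forall>x\<in>M. \<forall>y\<in>M. \<forall>z\<in>M. \<delta> x y \<le> a \<longrightarrow> \<delta> y z \<le> b \<longrightarrow> \<delta> x z \<le> c"
    and pos: "\<And>q. pos q \<in> M"
    and step: "\<And>i j. \<delta> (pos (i, j)) (pos (Suc i, j)) \<le> c \<and> \<delta> (pos (i, j)) (pos (\<beta> * i, Suc j)) \<le> c"
    and count: "\<And>r. \<exists>B::nat. \<forall>x\<in>M. finite {q. \<delta> (pos q) x \<le> r} \<and> card {q. \<delta> (pos q) x \<le> r} \<le> B"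
  obtains \<psi> N l B where "grid_net Y \<beta> \<psi> N l B"
proof -
  obtain f where f: "f \<in> verts Y \<rightarrow> M"
    and walk: "\<And>l::nat. \<exists>r\<ge>0. \<forall>w y. is_walk Y w \<longrightarrow> length w \<le> l \<longrightarrow> y \<in> set w \<longrightarrow> \<delta> (f (hd w)) (f y) \<le> r"
    and dense: "\<exists>C\<ge>0. \<forall>z\<in>M. \<exists>y\<in>verts Y. \<delta> (f y) z \<le> C"
    and conn: "\<And>r. \<exists>l::nat. \<forall>x\<in>verts Y. \<forall>y\<in>verts Y. \<delta> (f x) (f y) \<le> r \<longrightarrow>
      (\<exists>w. walk_between Y x y w \<and> length w \<le> l)"
    by (rule quasi_isometry_coarse[OF Y]) blast
  obtain C where C: "\<And>z. z \<in> M \<Longrightarrow> \<exists>y\<in>verts Y. \<delta> (f y) z \<le> C" using dense by blast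
  obtain \<psi> where \<psi>: "\<And>q. \<psi> q \<in> verts Y" "\<And>q. \<delta> (f (\<psi> q)) (pos q) \<le> C"
    using C[OF pos] by metis
  have fM: "f y \<in> M" if "y \<in> verts Y" for y using f that by blast
  obtain c1 where c1: "\<And>x y z. x \<in> M \<Longrightarrow> y \<in> M \<Longrightarrow> z \<in> M \<Longrightarrow> \<delta> x y \<le> C \<Longrightarrow> \<delta> y z \<le> c \<Longrightarrow> \<delta> x z \<le> c1"
    using tri[of C c] by blast
  obtain c2 where c2: "\<And>x y z. x \<in> M \<Longrightarrow> y \<in> M \<Longrightarrow> z \<in> M \<Longrightarrow> \<delta> x y \<le> c1 \<Longrightarrow> \<delta> y z \<le> C \<Longrightarrow> \<delta> x z \<le> c2"
    using tri[of c1 C] by blast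
  have near: "\<delta> (f (\<psi> q)) (f (\<psi> q')) \<le> c2" if "\<delta> (pos q) (pos q') \<le> c" for q q'
  proof (rule c2[of _ "pos q'"])
    show "\<delta> (f (\<psi> q)) (pos q') \<le> c1"
      by (rule c1[of _ "pos q"]) (use fM \<psi> pos that in auto)
    show "\<delta> (pos q') (f (\<psi> q')) \<le> C" using \<psi>(2) sym by metis
  qed (use fM \<psi> pos in auto)
  obtain l where l: "\<And>x y. x \<in> verts Y \<Longrightarrow> y \<in> verts Y \<Longrightarrow> \<delta> (f x) (f y) \<le> c2 \<Longrightarrow>
      \<exists>w. walk_between Y x y w \<and> length w \<le> l" using conn[of c2] by blast
  have "\<exists>w. walk_between Y (\<psi> (i, j)) (\<psi> (Suc i, j)) w \<and> length w \<le> l"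
    "\<exists>w. walk_between Y (\<psi> (i, j)) (\<psi> (\<beta> * i, Suc j)) w \<and> length w \<le> l" for i j
    using near step by (auto intro!: l \<psi>(1))
  then obtain R U where R: "\<And>i j. walk_between Y (\<psi> (i, j)) (\<psi> (Suc i, j)) (R i j) \<and> length (R i j) \<le> l"
    and U: "\<And>i j. walk_between Y (\<psi> (i, j)) (\<psi> (\<beta> * i, Suc j)) (U i j) \<and> length (U i j) \<le> l"
    by metis
  define N where "N q = set (R (fst q) (snd q)) \<union> set (U (fst q) (snd q))" for q
  obtain r where r: "\<And>w y. is_walk Y w \<Longrightarrow> length w \<le> l \<Longrightarrow> y \<in> set w \<Longrightarrow> \<delta> (f (hd w)) (f y) \<le> r"
    using walk[of l] by blast
  obtain c3 where c3: "\<And>x y z. x \<in> M \<Longrightarrow> y \<in> M \<Longrightarrow> z \<in> M \<Longrightarrow> \<delta> x y \<le> C \<Longrightarrow> \<delta> y z \<le> r \<Longrightarrow> \<delta> x z \<le> c3"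
    using tri[of C r] by blast
  obtain B where B: "\<And>x. x \<in> M \<Longrightarrow> finite {q. \<delta> (pos q) x \<le> c3} \<and> card {q. \<delta> (pos q) x \<le> c3} \<le> B"
    using count[of c3] by blast
  have N: "y \<in> verts Y \<and> \<delta> (pos q) (f y) \<le> c3" if yN: "y \<in> N q" for y q
  proof -
    obtain i j where q: "q = (i, j)" by (cases q)
    then obtain w where w: "is_walk Y w" "hd w = \<psi> q" "length w \<le> l" "y \<in> set w"
      using yN R[of i j] U[of i j] unfolding N_def walk_between_def by force
    then have y: "y \<in> verts Y" by (auto simp: is_walk_def)
    have "\<delta> (pos q) (f (\<psi> q)) \<le> C" using \<psi>(2) sym by metis
    then have "\<delta> (pos q) (f y) \<le> c3"
      using c3[OF pos fM[OF \<psi>(1)] fM[OF y]] r[OF w(1,3,4)] w(2) by simp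
    with y show ?thesis by simp
  qed
  have "grid_net Y \<beta> \<psi> N (2 * l) B"
    unfolding grid_net_def
  proof (intro conjI allI)
    fix q :: "nat \<times> nat"
    obtain i j where q: "q = (i, j)" by (cases q)
    show "\<psi> q \<in> verts Y" by (rule \<psi>(1))
    have "R i j \<noteq> []" "hd (R i j) = \<psi> q" using R[of i j] by (auto simp: q walk_between_def is_walk_def)
    then show "\<psi> q \<in> N q" using hd_in_set[of "R i j"] by (simp add: N_def q)
    show "finite (N q)" by (simp add: N_def)
    have "card (N q) \<le> card (set (R i j)) + card (set (U i j))" by (simp add: N_def q card_Un_le)
    also have "\<dots> \<le> length (R i j) + length (U i j)" by (intro add_mono card_length)
    also have "\<dots> \<le> 2 * l" using R[of i j] U[of i j] by simp
    finally show "card (N q) \<le> 2 * l" .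
  next
    fix i j
    show "joined_in Y (N (i, j)) (\<psi> (i, j)) (\<psi> (Suc i, j))"
      "joined_in Y (N (i, j)) (\<psi> (i, j)) (\<psi> (\<beta> * i, Suc j))"
      unfolding joined_in_def N_def using R[of i j] U[of i j] by auto
  next
    fix y
    have "finite {q. y \<in> N q} \<and> card {q. y \<in> N q} \<le> B"
    proof (cases "y \<in> verts Y")
      case True
      have sub: "{q. y \<in> N q} \<subseteq> {q. \<delta> (pos q) (f y) \<le> c3}" using N by blast
      show ?thesis using B[OF fM[OF True]] sub by (meson card_mono finite_subset order_trans)
    next
      case False
      then have "{q. y \<in> N q} = {}" using N by blast
      then show ?thesis by (metis card.empty finite.emptyI le0)
    qed
    then show "finite {q. y \<in> N q}" "card {q. y \<in> N q} \<le> B" by auto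
  qed
  then show thesis by (rule that)
qed

lemma card_nat_diam_le:
  fixes A :: "nat set"
  assumes "\<And>i j. i \<in> A \<Longrightarrow> j \<in> A \<Longrightarrow> i \<le> j + m"
  shows "finite A \<and> card A \<le> m + 1"
proof (cases "A = {}")
  case False
  define a where "a = (LEAST i. i \<in> A)"
  have a: "a \<in> A" using False unfolding a_def by (auto intro: LeastI)
  have "A \<subseteq> {a..a + m}" using assms a by (auto simp: a_def intro: Least_le)
  then show ?thesis using card_mono[of "{a..a + m}" A] finite_subset by auto
qed simp

lemma card_nat_near_le:
  fixes X c :: real
  assumes "c \<ge> 0"
  shows "finite {i::nat. \<bar>real i - X\<bar> \<le> c} \<and> card {i::nat. \<bar>real i - X\<bar> \<le> c} \<le> nat \<lceil>2 * c\<rceil> + 1"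
  by (rule card_nat_diam_le) (use assms in \<open>simp; linarith\<close>)

lemma card_Sigma_le:
  fixes A :: "'a set" and B :: "'a \<Rightarrow> 'b set"
  assumes "finite A" "card A \<le> a" "\<And>x. x \<in> A \<Longrightarrow> finite (B x) \<and> card (B x) \<le> b"
  shows "finite (Sigma A B) \<and> card (Sigma A B) \<le> a * b"
proof
  show fin: "finite (Sigma A B)" using assms by (intro finite_SigmaI) auto
  have "card (Sigma A B) = (\<Sum>x\<in>A. card (B x))" using assms by (intro card_SigmaI) auto
  also have "\<dots> \<le> card A * b" using sum_bounded_above[of A "\<lambda>x. card (B x)" b] assms by simp
  also have "\<dots> \<le> a * b" using assms(2) by simp
  finally show "card (Sigma A B) \<le> a * b" .
qed

lemma plane_grid_net:
  assumes "is_graph Y" "bounded_degree Y" "graph_quasi_isometric_to Y (UNIV :: (real^2) set) dist"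
  obtains \<psi> N l B where "grid_net Y 1 \<psi> N l B"
proof -
  define pos :: "nat \<times> nat \<Rightarrow> real^2" where "pos q = vector [real (fst q), real (snd q)]" for q
  have pos: "pos q $ 1 = real (fst q)" "pos q $ 2 = real (snd q)" for q by (auto simp: pos_def)
  have le1: "dist u v \<le> 1" if "\<bar>u $ 1 - v $ 1\<bar> + \<bar>u $ 2 - v $ 2\<bar> \<le> 1" for u v :: "real^2"
    using norm_le_l1_cart[of "u - v"] that by (simp add: dist_norm sum_2)
  show thesis
  proof (rule exists_grid_net[OF assms, where pos = pos and c = 1 and \<beta> = 1])
    show "\<exists>c. \<forall>x\<in>UNIV. \<forall>y\<in>UNIV. \<forall>z\<in>UNIV. dist x y \<le> a \<longrightarrow> dist y z \<le> b \<longrightarrow> dist (x::real^2) z \<le> c" for a b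
      by (rule exI[of _ "a + b"]) (metis add_mono dist_triangle order_trans)
    show "dist (pos (i, j)) (pos (Suc i, j)) \<le> 1 \<and> dist (pos (i, j)) (pos (1 * i, Suc j)) \<le> 1" for i j
      by (intro conjI le1) (auto simp: pos)
    show "\<exists>B::nat. \<forall>x\<in>UNIV. finite {q. dist (pos q) x \<le> r} \<and> card {q. dist (pos q) x \<le> r} \<le> B" for r
    proof (intro exI ballI)
      fix x :: "real^2"
      define c where "c = max r 0"
      define b where "b = nat \<lceil>2 * c\<rceil> + 1"
      define S where "S = {i::nat. \<bar>real i - x $ 1\<bar> \<le> c} \<times> {i::nat. \<bar>real i - x $ 2\<bar> \<le> c}"
      have "{q. dist (pos q) x \<le> r} \<subseteq> S"
      proof
        fix q assume "q \<in> {q. dist (pos q) x \<le> r}"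
        then have "norm (pos q - x) \<le> c" by (simp add: dist_norm c_def)
        then have "\<bar>(pos q - x) $ i\<bar> \<le> c" for i using component_le_norm_cart order_trans by blast
        from this[of 1] this[of 2] show "q \<in> S" by (simp add: S_def pos mem_Times_iff)
      qed
      moreover have "finite S \<and> card S \<le> b * b"
        unfolding S_def b_def using card_nat_near_le[of c] by (intro card_Sigma_le) (auto simp: c_def)
      ultimately show "finite {q. dist (pos q) x \<le> r} \<and> card {q. dist (pos q) x \<le> r} \<le>
          (nat \<lceil>2 * max r 0\<rceil> + 1) * (nat \<lceil>2 * max r 0\<rceil> + 1)"
        unfolding b_def c_def by (meson card_mono finite_subset order_trans)
    qed
  qed (auto simp: dist_commute intro: that)
qed

text \<open>Row \<open>j\<close> has spacing and height \<open>1 / 2 ^ j\<close>, so neighbours in a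
  row are at a constant hyperbolic distance; the step to \<open>(2 * i, Suc j)\<close> keeps the
  real part and halves the height. Both steps satisfy the closeness inequality with constant 1,
  whence the bound \<open>arcosh (1 + 1 / 2)\<close>.\<close>

lemma hyp_plane_grid_net:
  assumes "is_graph Z" "bounded_degree Z" "graph_quasi_isometric_to Z hyp_plane hyp_dist"
  obtains \<psi> N l B where "grid_net Z 2 \<psi> N l B"
proof -
  define pos :: "nat \<times> nat \<Rightarrow> complex" where
    "pos q = Complex (real (fst q) / 2 ^ snd q) (1 / 2 ^ snd q)" for q
  have posH: "pos q \<in> hyp_plane" for q by (simp add: pos_def hyp_plane_def)
  show thesis
  proof (rule exists_grid_net[OF assms, where pos = pos and c = "arcosh (1 + 1 / 2)" and \<beta> = 2])
    show "hyp_dist x y = hyp_dist y x" for x y by (rule hyp_dist_commute)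
    show "\<exists>c. \<forall>x\<in>hyp_plane. \<forall>y\<in>hyp_plane. \<forall>z\<in>hyp_plane. hyp_dist x y \<le> a \<longrightarrow>
        hyp_dist y z \<le> b \<longrightarrow> hyp_dist x z \<le> c" for a b by (rule hyp_dist_weak_triangle)
    show "pos q \<in> hyp_plane" for q by (rule posH)
    show "hyp_dist (pos (i, j)) (pos (Suc i, j)) \<le> arcosh (1 + 1 / 2) \<and>
        hyp_dist (pos (i, j)) (pos (2 * i, Suc j)) \<le> arcosh (1 + 1 / 2)" for i j
    proof (intro conjI hyp_dist_leI posH)
      have "real i / 2 ^ j - real (Suc i) / 2 ^ j = - 1 / 2 ^ j" by (simp add: diff_divide_distrib[symmetric])
      then show "(cmod (pos (i, j) - pos (Suc i, j)))\<^sup>2 \<le> 1 * (Im (pos (i, j)) * Im (pos (Suc i, j)))"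
        unfolding cmod_power2 by (simp add: pos_def power2_eq_square del: of_nat_Suc)
      have "real i / 2 ^ j - real (2 * i) / 2 ^ Suc j = 0" "1 / 2 ^ j - 1 / 2 ^ Suc j = (1 / 2 ^ Suc j :: real)"
        by (simp_all add: field_simps)
      then show "(cmod (pos (i, j) - pos (2 * i, Suc j)))\<^sup>2 \<le> 1 * (Im (pos (i, j)) * Im (pos (2 * i, Suc j)))"
        unfolding cmod_power2
        by (simp add: pos_def power2_eq_square del: power_Suc of_nat_mult) (simp add: field_simps)
    qed simp_all
    show "\<exists>B::nat. \<forall>x\<in>hyp_plane. finite {q. hyp_dist (pos q) x \<le> r} \<and> card {q. hyp_dist (pos q) x \<le> r} \<le> B" for r
    proof -
      define K where "K = 2 * (cosh (max r 0) - 1)"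
      have K: "K \<ge> 0" by (simp add: K_def cosh_real_ge_1)
      \<comment> \<open>Positions near \<open>x\<close> have heights within a factor
        \<open>K + 2\<close> of \<open>Im x\<close> in either direction, so they occupy rows that
        differ by at most \<open>J\<close>. In row \<open>j\<close> they lie in a window of radius
        \<open>K + 2\<close> around \<open>Re x * 2 ^ j\<close>.\<close>
      obtain J :: nat where J: "(K + 2) * (K + 2) < 2 ^ J" using real_arch_pow[of 2 "(K + 2) * (K + 2)"] by auto
      define b where "b = nat \<lceil>2 * (K + 2)\<rceil> + 1"
      have "finite {q. hyp_dist (pos q) x \<le> r} \<and> card {q. hyp_dist (pos q) x \<le> r} \<le> (J + 1) * b"
        if x: "x \<in> hyp_plane" for x
      proof -
        have Imx: "Im x > 0" using x by (simp add: hyp_plane_def)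
        have close: "(cmod (pos q - x))\<^sup>2 \<le> K * (Im (pos q) * Im x)" if "hyp_dist (pos q) x \<le> r" for q
        proof -
          have "hyp_dist (pos q) x \<le> max r 0" using that by simp
          then show ?thesis unfolding K_def by (subst (asm) hyp_dist_le_iff[OF _ posH x]) simp_all
        qed
        define T where "T = snd ` {q. hyp_dist (pos q) x \<le> r}"
        define I where "I j = {i::nat. \<bar>real i - Re x * 2 ^ j\<bar> \<le> K + 2}" for j :: nat
        have T: "Im x * 2 ^ j \<le> K + 2" "1 \<le> (K + 2) * (Im x * 2 ^ j)" if jT: "j \<in> T" for j
        proof -
          obtain q where q: "j = snd q" "hyp_dist (pos q) x \<le> r" using jT by (auto simp: T_def)
          have "Im x \<le> (K + 2) * Im (pos q)" by (rule hyp_close_Im[OF posH x K close[OF q(2)]])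
          then show "Im x * 2 ^ j \<le> K + 2" by (simp add: pos_def q(1) field_simps)
          have "(cmod (x - pos q))\<^sup>2 \<le> K * (Im x * Im (pos q))"
            using close[OF q(2)] by (simp add: norm_minus_commute mult.commute)
          then have "Im (pos q) \<le> (K + 2) * Im x" by (rule hyp_close_Im[OF x posH K])
          then show "1 \<le> (K + 2) * (Im x * 2 ^ j)" by (simp add: pos_def q(1) field_simps)
        qed
        have "finite T \<and> card T \<le> J + 1"
        proof (rule card_nat_diam_le)
          fix i j assume ij: "i \<in> T" "j \<in> T"
          show "i \<le> j + J"
          proof (rule ccontr)
            assume "\<not> ?thesis"
            then have "(2::real) ^ (j + J) \<le> 2 ^ i" by (intro power_increasing) auto
            then have "Im x * 2 ^ j * 2 ^ J \<le> Im x * 2 ^ i" using Imx by (simp add: power_add)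
            also have "\<dots> \<le> K + 2" by (rule T(1)[OF ij(1)])
            finally have 1: "Im x * 2 ^ j * 2 ^ J \<le> K + 2" .
            have "2 ^ J * 1 \<le> 2 ^ J * ((K + 2) * (Im x * 2 ^ j))"
              using T(2)[OF ij(2)] by (intro mult_left_mono) auto
            also have "\<dots> = (K + 2) * (Im x * 2 ^ j * 2 ^ J)" by simp
            also have "\<dots> \<le> (K + 2) * (K + 2)" using 1 K by (intro mult_left_mono) auto
            finally show False using J by simp
          qed
        qed
        then have S: "finite (Sigma T I) \<and> card (Sigma T I) \<le> (J + 1) * b"
          unfolding I_def b_def using card_nat_near_le[of "K + 2"] K by (intro card_Sigma_le) auto
        have "(\<lambda>q. (snd q, fst q)) ` {q. hyp_dist (pos q) x \<le> r} \<subseteq> Sigma T I"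
        proof safe
          fix i j assume q: "hyp_dist (pos (i, j)) x \<le> r"
          show "snd (i, j) \<in> T" using q by (force simp: T_def)
          have "\<bar>real i / 2 ^ j - Re x\<bar> \<le> cmod (pos (i, j) - x)"
            using abs_Re_le_cmod[of "pos (i, j) - x"] by (simp add: pos_def)
          also have "\<dots> \<le> (K + 2) * Im (pos (i, j))" by (rule hyp_close_norm[OF posH x K close[OF q]])
          also have "\<dots> = (K + 2) / 2 ^ j" by (simp add: pos_def)
          finally have "\<bar>real i / 2 ^ j - Re x\<bar> * 2 ^ j \<le> K + 2" by (simp add: field_simps)
          moreover have "\<bar>real i / 2 ^ j - Re x\<bar> * 2 ^ j = \<bar>(real i / 2 ^ j - Re x) * 2 ^ j\<bar>"
            by (simp add: abs_mult)
          ultimately show "fst (i, j) \<in> I (snd (i, j))" by (simp add: I_def left_diff_distrib)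
        qed
        moreover have "inj_on (\<lambda>q. (snd q, fst q)) {q. hyp_dist (pos q) x \<le> r}"
          by (auto simp: inj_on_def prod_eq_iff)
        ultimately show ?thesis using S by (meson card_inj_on_le inj_on_finite order_trans)
      qed
      then show ?thesis by blast
    qed
  qed (rule that)
qed

section \<open>Growth of the wiring profiles\<close>

text \<open>The side \<open>s\<close> of the cells exceeds the displacement of \<open>f\<close>
  along an edge, so adjacent vertices lie in equal or touching cells. A cell has bounded diameter
  and therefore contains boundedly many vertices.\<close>

lemma plane_coordinates:
  assumes "is_graph Y" "bounded_degree Y" "graph_quasi_isometric_to Y (UNIV :: (real^2) set) dist"
  obtains c :: "'y \<Rightarrow> int \<times> int" and M :: nat
  where "\<And>u v. {u, v} \<in> edges Y \<Longrightarrow> \<bar>fst (c u) - fst (c v)\<bar> \<le> 1 \<and> \<bar>snd (c u) - snd (c v)\<bar> \<le> 1"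
    and "\<And>I p. I \<subseteq> verts Y \<Longrightarrow> card {z \<in> I. c z = p} \<le> M"
proof -
  obtain f :: "'y \<Rightarrow> real^2" where walk: "\<And>l::nat. \<exists>r\<ge>0. \<forall>w y. is_walk Y w \<longrightarrow> length w \<le> l \<longrightarrow> y \<in> set w \<longrightarrow>
        dist (f (hd w)) (f y) \<le> r"
    and ball: "\<And>r. \<exists>B::nat. \<forall>A\<subseteq>verts Y. (\<forall>x\<in>A. \<forall>y\<in>A. dist (f x) (f y) \<le> r) \<longrightarrow> finite A \<and> card A \<le> B"
    by (rule quasi_isometry_coarse[OF assms]) blast
  obtain r where r: "r \<ge> 0" "\<And>w y. is_walk Y w \<Longrightarrow> length w \<le> 2 \<Longrightarrow> y \<in> set w \<Longrightarrow> dist (f (hd w)) (f y) \<le> r"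
    using walk[of 2] by blast
  define s where "s = r + 1"
  have s: "s > 0" using r(1) by (simp add: s_def)
  obtain M :: nat where M: "\<And>A. A \<subseteq> verts Y \<Longrightarrow> (\<forall>x\<in>A. \<forall>y\<in>A. dist (f x) (f y) \<le> 2 * s) \<Longrightarrow> card A \<le> M"
    using ball[of "2 * s"] by blast
  define c where "c z = (\<lfloor>f z $ 1 / s\<rfloor>, \<lfloor>f z $ 2 / s\<rfloor>)" for z
  show thesis
  proof (rule that[of c M])
    fix u v assume uv: "{u, v} \<in> edges Y"
    then have "is_walk Y [u, v]" using assms(1) by (auto simp: is_walk_def is_graph_def)
    then have "dist (f u) (f v) \<le> s" using r(2)[of "[u, v]" v] by (simp add: s_def)
    then have "\<bar>(f u - f v) $ i\<bar> \<le> s" for i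
      using component_le_norm_cart[of "f u - f v" i] by (simp add: dist_norm)
    then have "\<bar>f u $ i / s - f v $ i / s\<bar> \<le> 1" for i
      using s by (simp add: diff_divide_distrib[symmetric] abs_divide)
    moreover have "\<bar>\<lfloor>a\<rfloor> - \<lfloor>b\<rfloor>\<bar> \<le> 1" if "\<bar>a - b\<bar> \<le> 1" for a b :: real
    proof -
      have "a \<le> b + 1" "b \<le> a + 1" using that by linarith+
      from floor_mono[OF this(1)] floor_mono[OF this(2)] show ?thesis by simp
    qed
    ultimately show "\<bar>fst (c u) - fst (c v)\<bar> \<le> 1 \<and> \<bar>snd (c u) - snd (c v)\<bar> \<le> 1" by (simp add: c_def)
  next
    fix I p assume I: "I \<subseteq> verts Y"
    have close: "\<bar>a - b\<bar> \<le> s" if "\<lfloor>a / s\<rfloor> = \<lfloor>b / s\<rfloor>" for a b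
    proof -
      have "\<bar>a / s - b / s\<bar> \<le> 1" using that by linarith
      then show ?thesis using s by (simp add: diff_divide_distrib[symmetric] abs_divide)
    qed
    show "card {z \<in> I. c z = p} \<le> M"
    proof (rule M, use I in blast, intro ballI)
      fix x y assume "x \<in> {z \<in> I. c z = p}" "y \<in> {z \<in> I. c z = p}"
      then have "c x = c y" by simp
      then have "\<bar>(f x - f y) $ 1\<bar> \<le> s" "\<bar>(f x - f y) $ 2\<bar> \<le> s" using close by (auto simp: c_def)
      then show "dist (f x) (f y) \<le> 2 * s"
        using norm_le_l1_cart[of "f x - f y"] by (simp add: dist_norm sum_2)
    qed
  qed
qed

text \<open>Real parts are divided by \<open>K + 2\<close>, which brings the horizontal displacement
  along an edge below the height of an endpoint. \<open>\<eta>\<close> bounds the ratio of adjacent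
  heights, and is at least 8 as \<open>half_plane_separation\<close> requires.\<close>

lemma half_plane_coordinates:
  assumes "is_graph Z" "bounded_degree Z" "graph_quasi_isometric_to Z hyp_plane hyp_dist"
  obtains x y :: "'z \<Rightarrow> real" and \<eta> :: real and M :: nat
  where "\<eta> \<ge> 8" "\<And>z. z \<in> verts Z \<Longrightarrow> y z > 0"
    and "\<And>u v. {u, v} \<in> edges Z \<Longrightarrow> \<bar>x u - x v\<bar> \<le> y u \<and> y v \<le> \<eta> * y u"
    and "\<And>I s x0. I \<subseteq> verts Z \<Longrightarrow> s > 0 \<Longrightarrow>
      card {z \<in> I. s / \<eta> < y z \<and> y z \<le> s \<and> \<bar>x z - x0\<bar> \<le> 2 * s} \<le> M"
proof -
  obtain f :: "'z \<Rightarrow> complex" where f: "f \<in> verts Z \<rightarrow> hyp_plane"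
    and walk: "\<And>l::nat. \<exists>r\<ge>0. \<forall>w y. is_walk Z w \<longrightarrow> length w \<le> l \<longrightarrow> y \<in> set w \<longrightarrow>
        hyp_dist (f (hd w)) (f y) \<le> r"
    and ball: "\<And>r. \<exists>B::nat. \<forall>A\<subseteq>verts Z. (\<forall>x\<in>A. \<forall>y\<in>A. hyp_dist (f x) (f y) \<le> r) \<longrightarrow> finite A \<and> card A \<le> B"
    by (rule quasi_isometry_coarse[OF assms]) blast
  have fH: "f z \<in> hyp_plane" if "z \<in> verts Z" for z using f that by blast
  obtain r where r: "r \<ge> 0" "\<And>w y. is_walk Z w \<Longrightarrow> length w \<le> 2 \<Longrightarrow> y \<in> set w \<Longrightarrow> hyp_dist (f (hd w)) (f y) \<le> r"
    using walk[of 2] by blast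
  define K where "K = 2 * (cosh r - 1)"
  have K: "K \<ge> 0" by (simp add: K_def cosh_real_ge_1)
  define \<eta> where "\<eta> = max 8 (K + 2)"
  define x where "x z = Re (f z) / (K + 2)" for z
  define y where "y z = Im (f z)" for z
  have ypos: "y z > 0" if "z \<in> verts Z" for z using fH[OF that] by (simp add: y_def hyp_plane_def)
  \<comment> \<open>For two points of a box the real parts differ by at most
    \<open>(K + 2) * (4 * s)\<close> and the imaginary parts by at most \<open>s\<close>, while
    \<open>s\<^sup>2 \<le> \<eta>\<^sup>2 * (y u * y v)\<close>. This makes \<open>K'\<close> their
    closeness constant.\<close>
  define K' where "K' = (16 * (K + 2)\<^sup>2 + 1) * \<eta>\<^sup>2"
  obtain M :: nat where M: "\<And>A. A \<subseteq> verts Z \<Longrightarrow>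
      (\<forall>x\<in>A. \<forall>y\<in>A. hyp_dist (f x) (f y) \<le> arcosh (1 + K' / 2)) \<Longrightarrow> card A \<le> M"
    using ball[of "arcosh (1 + K' / 2)"] by blast
  show thesis
  proof (rule that[of \<eta> y x M])
    show "\<eta> \<ge> 8" by (simp add: \<eta>_def)
    show "y z > 0" if "z \<in> verts Z" for z using that by (rule ypos)
    fix u v assume uv: "{u, v} \<in> edges Z"
    then have V: "u \<in> verts Z" "v \<in> verts Z" using assms(1) by (auto simp: is_graph_def)
    have "is_walk Z [u, v]" using uv V by (simp add: is_walk_def)
    then have "hyp_dist (f u) (f v) \<le> r" using r(2)[of "[u, v]" v] by simp
    then have close: "(cmod (f u - f v))\<^sup>2 \<le> K * (Im (f u) * Im (f v))"
      using hyp_dist_le_iff[OF r(1) fH[OF V(1)] fH[OF V(2)]] by (simp add: K_def)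
    have "\<bar>Re (f u) - Re (f v)\<bar> \<le> cmod (f u - f v)" using abs_Re_le_cmod[of "f u - f v"] by simp
    also have "\<dots> \<le> (K + 2) * y u"
      unfolding y_def by (rule hyp_close_norm[OF fH[OF V(1)] fH[OF V(2)] K close])
    finally have "\<bar>Re (f u) - Re (f v)\<bar> / (K + 2) \<le> y u" using K by (simp add: field_simps)
    then have "\<bar>x u - x v\<bar> \<le> y u"
      using K by (simp add: x_def diff_divide_distrib[symmetric] abs_divide)
    moreover have "y v \<le> (K + 2) * y u"
      unfolding y_def by (rule hyp_close_Im[OF fH[OF V(1)] fH[OF V(2)] K close])
    moreover have "(K + 2) * y u \<le> \<eta> * y u" using ypos[OF V(1)] by (simp add: \<eta>_def)
    ultimately show "\<bar>x u - x v\<bar> \<le> y u \<and> y v \<le> \<eta> * y u" by linarith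
  next
    fix I and s x0 :: real assume I: "I \<subseteq> verts Z" and s: "s > 0"
    show "card {z \<in> I. s / \<eta> < y z \<and> y z \<le> s \<and> \<bar>x z - x0\<bar> \<le> 2 * s} \<le> M"
    proof (rule M, use I in blast, intro ballI)
      fix u v assume "u \<in> {z \<in> I. s / \<eta> < y z \<and> y z \<le> s \<and> \<bar>x z - x0\<bar> \<le> 2 * s}"
        "v \<in> {z \<in> I. s / \<eta> < y z \<and> y z \<le> s \<and> \<bar>x z - x0\<bar> \<le> 2 * s}"
      then have uv: "u \<in> I" "v \<in> I" "s / \<eta> < y u" "y u \<le> s" "\<bar>x u - x0\<bar> \<le> 2 * s"
        "s / \<eta> < y v" "y v \<le> s" "\<bar>x v - x0\<bar> \<le> 2 * s" by auto
      have V: "u \<in> verts Z" "v \<in> verts Z" using uv I by auto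
      have \<eta>: "\<eta> > 0" by (simp add: \<eta>_def)
      have "s \<le> \<eta> * y u" "s \<le> \<eta> * y v" using uv(3,6) \<eta> by (auto simp: field_simps)
      then have "s * s \<le> (\<eta> * y u) * (\<eta> * y v)" using s \<eta> by (intro mult_mono) auto
      then have ss: "s\<^sup>2 \<le> \<eta>\<^sup>2 * (y u * y v)" by (simp add: power2_eq_square mult_ac)
      have "\<bar>x u - x v\<bar> \<le> 4 * s" using uv(5,8) by linarith
      then have "\<bar>Re (f u) - Re (f v)\<bar> \<le> (K + 2) * (4 * s)"
        using K by (simp add: x_def diff_divide_distrib[symmetric] abs_divide field_simps)
      then have "(Re (f u) - Re (f v))\<^sup>2 \<le> ((K + 2) * (4 * s))\<^sup>2"
        by (metis abs_ge_zero power2_abs power_mono)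
      moreover have "\<bar>Im (f u) - Im (f v)\<bar> \<le> s"
        using uv(4,7) ypos[OF V(1)] ypos[OF V(2)] by (auto simp: y_def)
      then have "(Im (f u) - Im (f v))\<^sup>2 \<le> s\<^sup>2" by (metis abs_ge_zero power2_abs power_mono)
      ultimately have "(cmod (f u - f v))\<^sup>2 \<le> ((K + 2) * (4 * s))\<^sup>2 + s\<^sup>2" by (simp add: cmod_power2)
      also have "\<dots> = (16 * (K + 2)\<^sup>2 + 1) * s\<^sup>2" by (simp add: power2_eq_square algebra_simps)
      also have "\<dots> \<le> (16 * (K + 2)\<^sup>2 + 1) * (\<eta>\<^sup>2 * (y u * y v))"
        using ss by (intro mult_left_mono) auto
      finally have "(cmod (f u - f v))\<^sup>2 \<le> K' * (Im (f u) * Im (f v))" by (simp add: K'_def y_def mult_ac)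
      then show "hyp_dist (f u) (f v) \<le> arcosh (1 + K' / 2)"
        by (intro hyp_dist_leI fH V) (auto simp: K'_def)
    qed
  qed
qed

section \<open>Lower bounds for the volume of a wiring\<close>

text \<open>One constant serves all graphs \<open>G\<close>. \<open>E\<close> collects the 3 of the
  cut expander, the multiplicity \<open>k\<close> and the degree \<open>D\<close>. The second term
  of \<open>C\<close> covers the case that \<open>W\<close> is so small that a single cell could
  carry 1/64 of it; then \<open>r \<le> card W\<close> bounds \<open>r\<close>.\<close>

lemma plane_wiring_lower:
  fixes Y :: "'y graph"
  assumes Y: "is_graph Y" "bounded_degree Y" "graph_quasi_isometric_to Y (UNIV :: (real^2) set) dist"
  shows "\<exists>C::nat. \<forall>(G::'a graph) W r f. is_graph G \<longrightarrow> finite (verts G) \<longrightarrow> cut_expander G W r \<longrightarrow>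
    r \<le> card W \<longrightarrow> coarse_wiring k G Y f \<longrightarrow> r\<^sup>2 \<le> C * volume G Y f + C"
proof -
  obtain D where D: "degree_le Y D" using Y(2) by (auto simp: bounded_degree_def)
  obtain c :: "'y \<Rightarrow> int \<times> int" and M :: nat
    where step: "\<And>u v. {u, v} \<in> edges Y \<Longrightarrow> \<bar>fst (c u) - fst (c v)\<bar> \<le> 1 \<and> \<bar>snd (c u) - snd (c v)\<bar> \<le> 1"
    and M: "\<And>I p. I \<subseteq> verts Y \<Longrightarrow> card {z \<in> I. c z = p} \<le> M"
    by (rule plane_coordinates[OF Y]) blast
  define E where "E = 3 * (k * D)"
  define C where "C = max (8 * M * E\<^sup>2) ((64 * (k * M))\<^sup>2)"
  show ?thesis
  proof (intro exI allI impI)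
    fix G :: "'a graph" and W r f
    assume G: "is_graph G" "finite (verts G)" and exp: "cut_expander G W r" and rW: "r \<le> card W"
      and f: "coarse_wiring k G Y f"
    obtain g I where I: "finite I" "I \<subseteq> verts Y" "card I = volume G Y f" "g ` verts G \<subseteq> I"
      and fib: "\<And>x. card {v \<in> verts G. g v = x} \<le> k"
      and cut: "\<And>R S. (\<And>x y. {x, y} \<in> edges Y \<Longrightarrow> x \<in> I \<Longrightarrow> y \<in> I \<Longrightarrow> x \<in> R \<Longrightarrow> y \<notin> R \<Longrightarrow> x \<in> S \<or> y \<in> S)
        \<Longrightarrow> card (cut_edges G {v. g v \<in> R}) \<le> k * (D * card (I \<inter> S))"
      by (rule coarse_wiring_cut[OF G Y(1) D f]) blast
    have W: "W \<subseteq> verts G" "finite W" using exp G(2) finite_subset by (auto simp: cut_expander_def)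
    have F: "card {v \<in> W. c (g v) = p} \<le> k * M" for p
    proof -
      have fibW: "card {v \<in> W. g v = z} \<le> k" for z
        by (rule order_trans[OF card_mono fib[of z]]) (use G(2) W in auto)
      have "card {v \<in> W. g v \<in> {z \<in> I. c z = p}} \<le> k * card {z \<in> I. c z = p}"
        by (rule card_fibres_le) (use I(1) W(2) fibW in auto)
      also have "{v \<in> W. g v \<in> {z \<in> I. c z = p}} = {v \<in> W. c (g v) = p}" using I(4) W(1) by auto
      also have "k * card {z \<in> I. c z = p} \<le> k * M" using M[OF I(2)] by simp
      finally show ?thesis .
    qed
    show "r\<^sup>2 \<le> C * volume G Y f + C"
    proof (cases "64 * (k * M) < card W")
      case True
      have "r\<^sup>2 \<le> 8 * M * E\<^sup>2 * card I"
      proof (rule plane_separation[OF W(2) I(1) F True M[OF I(2)]])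
        fix x0 x1 y0 y1
        define R where "R = {z. c z \<in> int_box x0 x1 y0 y1}"
        define S where "S = {z. c z \<in> int_box (x0 - 1) (x1 + 1) (y0 - 1) (y1 + 1) - int_box x0 x1 y0 y1}"
        assume "card W \<le> 64 * card {v \<in> W. c (g v) \<in> int_box x0 x1 y0 y1}"
          "card W \<le> 64 * card {v \<in> W. c (g v) \<notin> int_box x0 x1 y0 y1}"
        moreover have "{v \<in> W. c (g v) \<in> int_box x0 x1 y0 y1} = W \<inter> {v. g v \<in> R}"
          "{v \<in> W. c (g v) \<notin> int_box x0 x1 y0 y1} = W - {v. g v \<in> R}" by (auto simp: R_def)
        ultimately have "r \<le> 3 * card (cut_edges G {v. g v \<in> R})"
          using exp unfolding cut_expander_def by simp
        also have "card (cut_edges G {v. g v \<in> R}) \<le> k * (D * card (I \<inter> S))"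
        proof (rule cut)
          fix u v assume uv: "{u, v} \<in> edges Y" "u \<in> R" "v \<notin> R"
          have "v \<in> S" using uv(2,3) step[OF uv(1)]
            by (cases "c u"; cases "c v") (auto simp: R_def S_def int_box_def)
          then show "u \<in> S \<or> v \<in> S" by simp
        qed
        also have "I \<inter> S = {z \<in> I. c z \<in> int_box (x0 - 1) (x1 + 1) (y0 - 1) (y1 + 1) - int_box x0 x1 y0 y1}"
          by (auto simp: S_def)
        finally show "r \<le> E * card {z \<in> I. c z \<in> int_box (x0 - 1) (x1 + 1) (y0 - 1) (y1 + 1) - int_box x0 x1 y0 y1}"
          by (simp add: E_def mult.assoc)
      qed
      also have "\<dots> \<le> C * card I" by (intro mult_right_mono) (auto simp: C_def)
      finally show ?thesis by (simp add: I(3))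
    next
      case False
      then have "r\<^sup>2 \<le> (64 * (k * M))\<^sup>2" using rW by (intro power_mono) auto
      also have "\<dots> \<le> C" by (simp add: C_def)
      finally show ?thesis by simp
    qed
  qed
qed

text \<open>The logarithm of the volume appears as the exponent \<open>j\<close>, which is the
  number of halvings in the search for thin vertical lines; there are two such lines and one top
  layer. The second term of \<open>C\<close> again covers small \<open>W\<close>.\<close>

lemma hyp_plane_wiring_lower:
  fixes Z :: "'z graph"
  assumes Z: "is_graph Z" "bounded_degree Z" "graph_quasi_isometric_to Z hyp_plane hyp_dist"
  shows "\<exists>C::nat. \<forall>(G::'a graph) W r f j. is_graph G \<longrightarrow> finite (verts G) \<longrightarrow> cut_expander G W r \<longrightarrow>
    r \<le> card W \<longrightarrow> coarse_wiring k G Z f \<longrightarrow> volume G Z f < 2 ^ j \<longrightarrow> r \<le> C * (2 * j + 1)"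
proof -
  obtain D where D: "degree_le Z D" using Z(2) by (auto simp: bounded_degree_def)
  obtain x y :: "'z \<Rightarrow> real" and \<eta> :: real and M :: nat
    where \<eta>: "\<eta> \<ge> 8" and ypos: "\<And>z. z \<in> verts Z \<Longrightarrow> y z > 0"
    and step: "\<And>u v. {u, v} \<in> edges Z \<Longrightarrow> \<bar>x u - x v\<bar> \<le> y u \<and> y v \<le> \<eta> * y u"
    and M: "\<And>I s x0. I \<subseteq> verts Z \<Longrightarrow> s > 0 \<Longrightarrow>
      card {z \<in> I. s / \<eta> < y z \<and> y z \<le> s \<and> \<bar>x z - x0\<bar> \<le> 2 * s} \<le> M"
    by (rule half_plane_coordinates[OF Z]) blast
  define E where "E = 3 * (k * D)"
  define C where "C = max (E * M) (64 * (k * M))"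
  show ?thesis
  proof (intro exI allI impI)
    fix G :: "'a graph" and W r f and j :: nat
    assume G: "is_graph G" "finite (verts G)" and exp: "cut_expander G W r" and rW: "r \<le> card W"
      and f: "coarse_wiring k G Z f" and j: "volume G Z f < 2 ^ j"
    obtain g I where I: "finite I" "I \<subseteq> verts Z" "card I = volume G Z f" "g ` verts G \<subseteq> I"
      and fib: "\<And>x. card {v \<in> verts G. g v = x} \<le> k"
      and cut: "\<And>R S. (\<And>x y. {x, y} \<in> edges Z \<Longrightarrow> x \<in> I \<Longrightarrow> y \<in> I \<Longrightarrow> x \<in> R \<Longrightarrow> y \<notin> R \<Longrightarrow> x \<in> S \<or> y \<in> S)
        \<Longrightarrow> card (cut_edges G {v. g v \<in> R}) \<le> k * (D * card (I \<inter> S))"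
      by (rule coarse_wiring_cut[OF G Z(1) D f]) blast
    have W: "W \<subseteq> verts G" "finite W" using exp G(2) finite_subset by (auto simp: cut_expander_def)
    have F: "card {v \<in> W. s / \<eta> < y (g v) \<and> y (g v) \<le> s \<and> \<bar>x (g v) - x0\<bar> \<le> 2 * s} \<le> k * M"
      if s: "s > 0" for s x0
    proof -
      define T where "T = {z \<in> I. s / \<eta> < y z \<and> y z \<le> s \<and> \<bar>x z - x0\<bar> \<le> 2 * s}"
      have fibW: "card {v \<in> W. g v = z} \<le> k" for z
        by (rule order_trans[OF card_mono fib[of z]]) (use G(2) W in auto)
      have "card {v \<in> W. g v \<in> T} \<le> k * card T"
        by (rule card_fibres_le) (use I(1) W(2) fibW in \<open>auto simp: T_def\<close>)
      also have "{v \<in> W. g v \<in> T} = {v \<in> W. s / \<eta> < y (g v) \<and> y (g v) \<le> s \<and> \<bar>x (g v) - x0\<bar> \<le> 2 * s}"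
        using I(4) W(1) by (auto simp: T_def)
      also have "k * card T \<le> k * M" using M[OF I(2) s] by (simp add: T_def)
      finally show ?thesis .
    qed
    have "r \<le> C * 1" if "\<not> 64 * (k * M) < card W" using rW that by (simp add: C_def)
    moreover have "r \<le> C * (2 * j + 1)" if big: "64 * (k * M) < card W"
    proof -
      have "r \<le> E * (M * (2 * j + 1))"
      proof (rule half_plane_separation[OF W(2) I(1) \<eta> _ F big M[OF I(2)]])
        show "y (g v) > 0" if "v \<in> W" for v using ypos that I(2,4) W(1) by blast
        show "card I < 2 ^ j" using j I(3) by simp
        fix s \<theta> \<theta>' :: real
        assume s: "s > 0"
        define R where "R = {z. y z \<le> s \<and> \<theta> \<le> x z \<and> x z < \<theta>'}"
        define S where "S = {z. y z \<le> s \<and> (\<bar>x z - \<theta>\<bar> \<le> y z \<or> \<bar>x z - \<theta>'\<bar> \<le> y z \<or>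
          s / \<eta> < y z \<and> \<theta> \<le> x z \<and> x z < \<theta>')}"
        assume "card W \<le> 64 * card {v \<in> W. y (g v) \<le> s \<and> \<theta> \<le> x (g v) \<and> x (g v) < \<theta>'}"
          "card W \<le> 64 * card {v \<in> W. \<not> (y (g v) \<le> s \<and> \<theta> \<le> x (g v) \<and> x (g v) < \<theta>')}"
        moreover have "{v \<in> W. y (g v) \<le> s \<and> \<theta> \<le> x (g v) \<and> x (g v) < \<theta>'} = W \<inter> {v. g v \<in> R}"
          "{v \<in> W. \<not> (y (g v) \<le> s \<and> \<theta> \<le> x (g v) \<and> x (g v) < \<theta>')} = W - {v. g v \<in> R}"
          by (auto simp: R_def)
        ultimately have "r \<le> 3 * card (cut_edges G {v. g v \<in> R})"
          using exp unfolding cut_expander_def by simp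
        also have "card (cut_edges G {v. g v \<in> R}) \<le> k * (D * card (I \<inter> S))"
        proof (rule cut)
          fix u v assume uv: "{u, v} \<in> edges Z" "u \<in> R" "v \<notin> R"
          have st: "\<bar>x u - x v\<bar> \<le> y u" "y v \<le> \<eta> * y u" using step[OF uv(1)] by auto
          have u: "y u \<le> s" "\<theta> \<le> x u" "x u < \<theta>'" using uv(2) by (auto simp: R_def)
          \<comment> \<open>An edge leaves the region through the top, and then \<open>u\<close> is
            higher than \<open>s / \<eta>\<close>, or across a vertical side, and then
            \<open>u\<close> is within \<open>y u\<close> of that side.\<close>
          consider "s < y v" | "x v < \<theta>" | "\<theta>' \<le> x v" using uv(3) by (fastforce simp: R_def)
          then have "u \<in> S"
          proof cases
            case 1
            then have "s < \<eta> * y u" using st by linarith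
            then have "s / \<eta> < y u" using \<eta> by (simp add: field_simps)
            then show ?thesis using u by (simp add: S_def)
          next
            case 2
            then have "\<bar>x u - \<theta>\<bar> \<le> y u" using u st by linarith
            then show ?thesis using u by (simp add: S_def)
          next
            case 3
            then have "\<bar>x u - \<theta>'\<bar> \<le> y u" using u st by linarith
            then show ?thesis using u by (simp add: S_def)
          qed
          then show "u \<in> S \<or> v \<in> S" by simp
        qed
        also have "I \<inter> S = {z \<in> I. y z \<le> s \<and> (\<bar>x z - \<theta>\<bar> \<le> y z \<or> \<bar>x z - \<theta>'\<bar> \<le> y z \<or>
          s / \<eta> < y z \<and> \<theta> \<le> x z \<and> x z < \<theta>')}" by (auto simp: S_def)
        finally show "r \<le> E * card {z \<in> I. y z \<le> s \<and> (\<bar>x z - \<theta>\<bar> \<le> y z \<or> \<bar>x z - \<theta>'\<bar> \<le> y z \<or>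
          s / \<eta> < y z \<and> \<theta> \<le> x z \<and> x z < \<theta>')}" by (simp add: E_def mult.assoc)
      qed
      also have "\<dots> = (E * M) * (2 * j + 1)" by (simp only: mult.assoc)
      also have "\<dots> \<le> C * (2 * j + 1)" by (intro mult_right_mono) (auto simp: C_def)
      finally show ?thesis .
    qed
    ultimately show "r \<le> C * (2 * j + 1)" by fastforce
  qed
qed

section \<open>From single graphs to profiles\<close>

lemma expander_in_X_graph:
  assumes "d \<ge> 3" "r > 0"
  obtains G W where "subgraph G (X_graph d)" "finite (verts G)" "card (verts G) \<le> 33792 * r"
    "cut_expander G W r" "r \<le> card W"
proof -
  obtain \<pi> :: "nat \<Rightarrow> nat \<Rightarrow> nat" where perms: "\<forall>s<22. \<pi> s permutes {..<768 * r}"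
    and expand: "\<forall>B\<subseteq>{..<768 * r}. 12 * r \<le> card B \<longrightarrow> card B \<le> 756 * r \<longrightarrow>
      (\<exists>s<22. r < card (\<pi> s ` B - B))"
    using exists_expanding_permutations[OF assms(2)] by blast
  have \<pi>: "\<pi> s permutes {..<768 * r}" if "s < 22" for s using perms that by blast
  define G0 where "G0 = blowup_graph \<pi> (768 * r)"
  define W0 where "W0 = {..<768 * r} \<times> {0::nat}"
  have G0: "is_graph G0" "degree_le G0 3" "finite (verts G0)" "card (verts G0) = 44 * (768 * r)"
    unfolding G0_def by (rule blowup_graph; rule \<pi>; assumption)+
  have exp: "cut_expander G0 W0 r"
    unfolding G0_def W0_def by (rule cut_expander_blowup_graph) (use \<pi> expand in blast)+
  have "degree_le G0 d" using G0(2) assms(1) by (force simp: degree_le_def)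
  then obtain h where h: "inj_on h (verts G0)" "subgraph (map_graph h G0) (X_graph d)"
    using embed_in_X_graph[OF G0(1,3)] by blast
  have W0: "W0 \<subseteq> verts G0" using exp by (simp add: cut_expander_def)
  show thesis
  proof (rule that[OF h(2)])
    show "finite (verts (map_graph h G0))" using G0(3) by (simp add: map_graph_def)
    \<comment> \<open>33792 = 44 * 768.\<close>
    show "card (verts (map_graph h G0)) \<le> 33792 * r"
      using G0(4) h(1) by (simp add: map_graph_def card_image)
    show "cut_expander (map_graph h G0) (h ` W0) r" by (rule cut_expander_map_graph[OF G0(1,3) h(1) exp])
    have "card (h ` W0) = card W0" using h(1) W0 by (meson card_image inj_on_subset)
    then show "r \<le> card (h ` W0)" by (simp add: W0_def card_cartesian_product)
  qed
qed

lemma wir_cases: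
  obtains "wir k G H = \<infinity>" | f where "coarse_wiring k G H f" "wir k G H = enat (volume G H f)"
proof (cases "{f. coarse_wiring k G H f} = {}")
  case True
  then have "wir k G H = \<infinity>" by (simp add: wir_def top_enat_def)
  then show thesis by (rule that(1))
next
  case False
  then obtain f where "enat (volume G H f) \<in> (\<lambda>f. enat (volume G H f)) ` {f. coarse_wiring k G H f}"
    by blast
  then have "wir k G H \<in> (\<lambda>f. enat (volume G H f)) ` {f. coarse_wiring k G H f}"
    unfolding wir_def by (rule wellorder_InfI)
  then show thesis using that(2) by blast
qed

lemma wir_le_wir_profile:
  assumes "subgraph G X" "finite (verts G)" "card (verts G) \<le> n"
  shows "wir k G Y \<le> wir_profile k X Y n"
  unfolding wir_profile_def by (rule SUP_upper) (use assms in simp)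

lemma wir_profile_le:
  assumes "\<And>G :: (nat graph \<times> nat) graph. is_graph G \<Longrightarrow> finite (verts G) \<Longrightarrow> degree_le G d \<Longrightarrow> card (verts G) \<le> n \<Longrightarrow>
    wir k G Y \<le> enat N"
  shows "ereal_of_enat (wir_profile k (X_graph d) Y n) \<le> ereal (real N)"
proof -
  have "wir_profile k (X_graph d) Y n \<le> enat N"
    unfolding wir_profile_def
  proof (rule SUP_least)
    fix G assume "G \<in> {G. subgraph G (X_graph d) \<and> finite (verts G) \<and> card (verts G) \<le> n}"
    then have G: "subgraph G (X_graph d)" "finite (verts G)" "card (verts G) \<le> n" by auto
    show "wir k G Y \<le> enat N"
      by (rule assms) (use G X_graph_subgraph_degree_le[OF G(1,2)] in \<open>simp_all add: subgraph_def\<close>)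
  qed
  then have "ereal_of_enat (wir_profile k (X_graph d) Y n) \<le> ereal_of_enat (enat N)"
    by (simp only: ereal_of_enat_le_iff)
  then show ?thesis by simp
qed

text \<open>One test graph for each \<open>n\<close> bounds the profile from below. If it has no
  coarse wiring, the right-hand side must be infinite, which takes \<open>C > 0\<close>. The value
  at 0 is treated apart because expanders are available only for positive \<open>r\<close>.\<close>

lemma growth_le_wir_profile:
  assumes C: "C > 0"
    and lower: "\<And>n. n > 0 \<Longrightarrow> \<exists>G. subgraph G X \<and> finite (verts G) \<and> card (verts G) \<le> C * n \<and>
      (\<forall>f. coarse_wiring k G Y f \<longrightarrow> F n \<le> real C * real (volume G Y f) + real C)"
    and F0: "F 0 \<le> real C"
  shows "growth_le (\<lambda>n. ereal (F n)) (\<lambda>n. ereal_of_enat (wir_profile k X Y n))"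
  unfolding growth_le_def
proof (intro exI[of _ C] allI)
  fix n
  show "ereal (F n) \<le> ereal (real C) * ereal_of_enat (wir_profile k X Y (C * n)) + ereal (real C)"
  proof (cases "n = 0")
    case True
    have "0 \<le> ereal (real C) * ereal_of_enat (wir_profile k X Y (C * n))"
      by (intro ereal_0_le_mult ereal_of_enat_nonneg) simp
    then show ?thesis using F0 True by (metis add_increasing ereal_less_eq(3))
  next
    case False
    then obtain G where G: "subgraph G X" "finite (verts G)" "card (verts G) \<le> C * n"
      "\<And>f. coarse_wiring k G Y f \<Longrightarrow> F n \<le> real C * real (volume G Y f) + real C"
      using lower[of n] by blast
    have "ereal (F n) \<le> ereal (real C) * ereal_of_enat (wir k G Y) + ereal (real C)"
    proof (cases rule: wir_cases[of k G Y])
      case 1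
      then show ?thesis using C by simp
    next
      case (2 f)
      then show ?thesis using G(4) by simp
    qed
    also have "\<dots> \<le> ereal (real C) * ereal_of_enat (wir_profile k X Y (C * n)) + ereal (real C)"
      using wir_le_wir_profile[OF G(1-3)] by (intro add_right_mono ereal_mult_left_mono) simp_all
    finally show ?thesis .
  qed
qed

lemma plane_growth_upper:
  assumes "is_graph Y" "grid_net Y 1 \<psi> N l B" "B * (d + 1) \<le> k"
  shows "growth_le (\<lambda>n. ereal_of_enat (wir_profile k (X_graph d) Y n)) (\<lambda>n. ereal (real n ^ 2))"
  unfolding growth_le_def
proof (intro exI allI)
  fix n :: nat
  \<comment> \<open>The factor 2 comes from
    \<open>(n + 1) * (n + 1) \<le> 2 * n\<^sup>2 + 2\<close>; the final 1 makes \<open>C\<close>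
    positive, so that passing from \<open>n\<close> to \<open>C * n\<close> does not decrease the
    bound.\<close>
  define C where "C = 2 * l * (d + 1) + 1"
  have sq: "(n + 1) * (n + 1) \<le> 2 * n\<^sup>2 + 2"
  proof -
    have "2 * n \<le> n\<^sup>2 + 1" by (cases n) (simp_all add: power2_eq_square)
    then show ?thesis by (simp add: power2_eq_square)
  qed
  have "n * d + 1 \<le> (n + 1) * (d + 1)" by simp
  then have "l * ((n * 1 ^ (n * d) + 1) * (n * d + 1)) \<le> l * ((n + 1) * ((n + 1) * (d + 1)))"
    by (intro mult_le_mono) simp_all
  also have "\<dots> = (n + 1) * (n + 1) * (l * (d + 1))" by (simp only: mult_ac)
  also have "\<dots> \<le> (2 * n\<^sup>2 + 2) * (l * (d + 1))" using sq by (rule mult_le_mono1)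
  also have "\<dots> = (C - 1) * (n\<^sup>2 + 1)" by (simp add: C_def algebra_simps)
  also have "\<dots> \<le> C * (n\<^sup>2 + 1)" by (rule mult_le_mono1) simp
  also have "\<dots> = C * n\<^sup>2 + C" by simp
  also have "\<dots> \<le> C * (C * n)\<^sup>2 + C"
    by (intro add_mono mult_le_mono power_mono) (simp_all add: C_def)
  finally have le: "real (l * ((n * 1 ^ (n * d) + 1) * (n * d + 1))) \<le> real (C * (C * n)\<^sup>2 + C)"
    by (rule of_nat_mono)
  have "ereal_of_enat (wir_profile k (X_graph d) Y n) \<le> ereal (real (l * ((n * 1 ^ (n * d) + 1) * (n * d + 1))))"
    by (rule wir_profile_le, rule wir_le_of_grid_net[OF assms(1,2)]) (use assms(3) in auto)
  also have "\<dots> \<le> ereal (real (C * (C * n)\<^sup>2 + C))" using le by (simp only: ereal_less_eq)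
  finally show "ereal_of_enat (wir_profile k (X_graph d) Y n)
      \<le> ereal (real C) * ereal (real (C * n) ^ 2) + ereal (real C)"
    by simp
qed

lemma hyp_plane_growth_upper:
  assumes "is_graph Z" "grid_net Z 2 \<psi> N l B" "B * (d + 1) \<le> k"
  shows "growth_le (\<lambda>n. ereal_of_enat (wir_profile k (X_graph d) Z n)) (\<lambda>n. ereal (exp (real n)))"
  unfolding growth_le_def
proof (intro exI allI)
  fix n :: nat
  define m where "m = n * d"
  \<comment> \<open>\<open>2 * l\<close> is the leading factor and \<open>2 * d + 1\<close> the
    growth of the exponent, since \<open>n + m + m = (2 * d + 1) * n\<close>; the sum is large
    enough for both purposes.\<close>
  define C where "C = 2 * l + (2 * d + 1)"
  have pow: "i + 1 \<le> 2 ^ i" "i \<le> 2 ^ i" for i :: nat using less_exp[of i] by linarith+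
  have "n * 2 ^ m + 1 \<le> 2 ^ n * 2 ^ m + 2 ^ n * 2 ^ m"
    using pow(2)[of n] by (intro add_mono mult_le_mono1) simp_all
  then have "(n * 2 ^ m + 1) * (m + 1) \<le> (2 * (2 ^ n * 2 ^ m)) * 2 ^ m"
    using pow(1)[of m] by (intro mult_le_mono) simp_all
  then have "l * ((n * 2 ^ m + 1) * (m + 1)) \<le> l * ((2 * (2 ^ n * 2 ^ m)) * 2 ^ m)"
    by (rule mult_le_mono2)
  also have "\<dots> = 2 * l * 2 ^ (n + m + m)" by (simp add: power_add)
  finally have "real (l * ((n * 2 ^ m + 1) * (m + 1))) \<le> real (2 * l * 2 ^ (n + m + m))" by (rule of_nat_mono)
  also have "\<dots> \<le> real C * exp (real (C * n))"
  proof -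
    have "(2::real) ^ (n + m + m) \<le> exp 1 ^ (n + m + m)" using exp_ge_add_one_self[of 1] by (intro power_mono) auto
    also have "\<dots> = exp (real (n + m + m))" by (simp add: exp_of_nat_mult[symmetric])
    also have "\<dots> \<le> exp (real (C * n))" unfolding exp_le_cancel_iff
      by (rule of_nat_mono) (simp add: C_def m_def algebra_simps)
    finally have "(2::real) ^ (n + m + m) \<le> exp (real (C * n))" .
    then have "real (2 * l) * 2 ^ (n + m + m) \<le> real C * exp (real (C * n))"
      by (intro mult_mono) (simp_all add: C_def)
    then show ?thesis by simp
  qed
  finally have le: "real (l * ((n * 2 ^ m + 1) * (m + 1))) \<le> real C * exp (real (C * n)) + real C" by simp
  have "ereal_of_enat (wir_profile k (X_graph d) Z n) \<le> ereal (real (l * ((n * 2 ^ (n * d) + 1) * (n * d + 1))))"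
    by (rule wir_profile_le, rule wir_le_of_grid_net[OF assms(1,2)]) (use assms(3) in auto)
  also have "\<dots> \<le> ereal (real C * exp (real (C * n)) + real C)"
    using le unfolding m_def by (simp only: ereal_less_eq)
  finally show "ereal_of_enat (wir_profile k (X_graph d) Z n)
      \<le> ereal (real C) * ereal (exp (real (C * n))) + ereal (real C)"
    by simp
qed

lemma plane_growth_lower:
  assumes "d \<ge> 3" "is_graph Y" "bounded_degree Y"
    "graph_quasi_isometric_to Y (UNIV :: (real^2) set) dist"
  shows "growth_le (\<lambda>n. ereal (real n ^ 2)) (\<lambda>n. ereal_of_enat (wir_profile k (X_graph d) Y n))"
proof -
  obtain C0 :: nat where C0: "\<And>(G::(nat graph \<times> nat) graph) W r f. is_graph G \<Longrightarrow> finite (verts G) \<Longrightarrow>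
      cut_expander G W r \<Longrightarrow> r \<le> card W \<Longrightarrow> coarse_wiring k G Y f \<Longrightarrow> r\<^sup>2 \<le> C0 * volume G Y f + C0"
    using plane_wiring_lower[OF assms(2-4), of k] by metis
  define C where "C = C0 + 33792"
  show ?thesis
  proof (rule growth_le_wir_profile[where C = C])
    fix n :: nat assume n: "n > 0"
    obtain G W where G: "subgraph G (X_graph d)" "finite (verts G)" "card (verts G) \<le> 33792 * n"
      "cut_expander G W n" "n \<le> card W" by (rule expander_in_X_graph[OF assms(1) n])
    have "real n ^ 2 \<le> real C * real (volume G Y f) + real C" if f: "coarse_wiring k G Y f" for f
    proof -
      have "n\<^sup>2 \<le> C0 * volume G Y f + C0"
        using G(1) by (intro C0[OF _ G(2,4,5) f]) (simp add: subgraph_def)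
      also have "\<dots> \<le> C * volume G Y f + C" by (intro add_mono mult_le_mono1) (simp_all add: C_def)
      finally have "real (n\<^sup>2) \<le> real (C * volume G Y f + C)" by (rule of_nat_mono)
      then show ?thesis by simp
    qed
    moreover have "card (verts G) \<le> C * n"
      using G(3) by (rule order_trans) (simp add: C_def)
    ultimately show "\<exists>G. subgraph G (X_graph d) \<and> finite (verts G) \<and> card (verts G) \<le> C * n \<and>
        (\<forall>f. coarse_wiring k G Y f \<longrightarrow> real n ^ 2 \<le> real C * real (volume G Y f) + real C)"
      using G(1,2) by blast
  qed (simp_all add: C_def)
qed

lemma hyp_plane_growth_lower:
  assumes "d \<ge> 3" "is_graph Z" "bounded_degree Z" "graph_quasi_isometric_to Z hyp_plane hyp_dist"
  shows "growth_le (\<lambda>n. ereal (exp (sqrt (real n)))) (\<lambda>n. ereal_of_enat (wir_profile k (X_graph d) Z n))"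
proof -
  obtain C0 :: nat where C0: "\<And>(G::(nat graph \<times> nat) graph) W r f j. is_graph G \<Longrightarrow> finite (verts G) \<Longrightarrow>
      cut_expander G W r \<Longrightarrow> r \<le> card W \<Longrightarrow> coarse_wiring k G Z f \<Longrightarrow> volume G Z f < 2 ^ j \<Longrightarrow>
      r \<le> C0 * (2 * j + 1)"
    using hyp_plane_wiring_lower[OF assms(2-4), of k] by metis
  \<comment> \<open>A wiring of the expander with parameter \<open>a * n\<close> and volume below
    \<open>2 ^ (2 * n)\<close> would give
    \<open>a * n \<le> C0 * (4 * n + 1) \<le> 5 * C0 * n\<close>, which this \<open>a\<close> just
    rules out.\<close>
  define a where "a = 5 * C0 + 1"
  define C where "C = 33792 * a"
  show ?thesis
  proof (rule growth_le_wir_profile[where C = C])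
    fix n :: nat assume n: "n > 0"
    have an: "a * n > 0" using n by (simp add: a_def)
    obtain G W where G: "subgraph G (X_graph d)" "finite (verts G)" "card (verts G) \<le> 33792 * (a * n)"
      "cut_expander G W (a * n)" "a * n \<le> card W" by (rule expander_in_X_graph[OF assms(1) an])
    have "exp (sqrt (real n)) \<le> real C * real (volume G Z f) + real C" if f: "coarse_wiring k G Z f" for f
    proof -
      have "\<not> volume G Z f < 2 ^ (2 * n)"
      proof
        assume "volume G Z f < 2 ^ (2 * n)"
        then have "a * n \<le> C0 * (2 * (2 * n) + 1)"
          using G(1) by (intro C0[OF _ G(2,4,5) f]) (simp_all add: subgraph_def)
        also have "\<dots> \<le> C0 * (5 * n)" using n by (intro mult_le_mono2) simp
        finally show False using n by (simp add: a_def)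
      qed
      then have vol: "(2::real) ^ (2 * n) \<le> real (volume G Z f)" by simp
      \<comment> \<open>The volume is at least \<open>4 ^ n\<close> and thus at least
        \<open>exp n\<close>; the square root enters only here, through
        \<open>sqrt n \<le> n\<close>.\<close>
      have "exp (sqrt (real n)) \<le> 2 ^ (2 * n)"
      proof -
        have "sqrt (real n) \<le> real n" using n by (intro real_le_lsqrt) (simp_all add: power2_eq_square)
        then have "exp (sqrt (real n)) \<le> exp (real n)" by simp
        also have "\<dots> = exp 1 ^ n" by (simp add: exp_of_nat_mult[symmetric])
        also have "\<dots> \<le> 4 ^ n" using exp_le by (intro power_mono) auto
        also have "(4::real) ^ n = 2 ^ (2 * n)" by (simp add: power_mult)
        finally show ?thesis .
      qed
      from this vol have "exp (sqrt (real n)) \<le> real (volume G Z f)" by (rule order_trans)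
      also have "\<dots> \<le> real C * real (volume G Z f)"
      proof -
        have "1 * real (volume G Z f) \<le> real C * real (volume G Z f)"
          by (rule mult_right_mono) (simp_all add: C_def a_def)
        then show ?thesis by simp
      qed
      finally show ?thesis by simp
    qed
    moreover have "card (verts G) \<le> C * n" using G(3) by (simp add: C_def mult.assoc)
    ultimately show "\<exists>G. subgraph G (X_graph d) \<and> finite (verts G) \<and> card (verts G) \<le> C * n \<and>
        (\<forall>f. coarse_wiring k G Z f \<longrightarrow> exp (sqrt (real n)) \<le> real C * real (volume G Z f) + real C)"
      using G(1,2) by blast
  qed (simp_all add: C_def a_def)
qed

theorem theorem1p19:
  fixes d :: nat and Y :: "'y graph" and Z :: "'z graph"
  assumes "d \<ge> 3"
    and "is_graph Y" and "bounded_degree Y"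
    and "graph_quasi_isometric_to Y (UNIV :: (real^2) set) dist"
    and "is_graph Z" and "bounded_degree Z"
    and "graph_quasi_isometric_to Z hyp_plane hyp_dist"
  shows "\<exists>K::nat. \<forall>k\<ge>K.
    growth_eq (\<lambda>n. ereal_of_enat (wir_profile k (X_graph d) Y n))
              (\<lambda>n. ereal (real n ^ 2)) \<and>
    growth_le (\<lambda>n. ereal (exp (sqrt (real n))))
              (\<lambda>n. ereal_of_enat (wir_profile k (X_graph d) Z n)) \<and>
    growth_le (\<lambda>n. ereal_of_enat (wir_profile k (X_graph d) Z n))
              (\<lambda>n. ereal (exp (real n)))"
proof -
  obtain \<psi> N l B where netY: "grid_net Y 1 \<psi> N l B" by (rule plane_grid_net[OF assms(2-4)])
  obtain \<psi>' N' l' B' where netZ: "grid_net Z 2 \<psi>' N' l' B'" by (rule hyp_plane_grid_net[OF assms(5-7)])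
  show ?thesis
  \<comment> \<open>The threshold for \<open>k\<close> is read off from the grid nets: their overlap
    times the \<open>d + 1\<close> edges that may share a position.\<close>
  proof (intro exI allI impI conjI)
    fix k assume k: "max (B * (d + 1)) (B' * (d + 1)) \<le> k"
    show "growth_eq (\<lambda>n. ereal_of_enat (wir_profile k (X_graph d) Y n)) (\<lambda>n. ereal (real n ^ 2))"
      unfolding growth_eq_def using plane_growth_upper[OF assms(2) netY] plane_growth_lower[OF assms(1-4)] k
      by simp
    show "growth_le (\<lambda>n. ereal (exp (sqrt (real n)))) (\<lambda>n. ereal_of_enat (wir_profile k (X_graph d) Z n))"
      by (rule hyp_plane_growth_lower[OF assms(1,5-7)])
    show "growth_le (\<lambda>n. ereal_of_enat (wir_profile k (X_graph d) Z n)) (\<lambda>n. ereal (exp (real n)))"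
      by (rule hyp_plane_growth_upper[OF assms(5) netZ]) (use k in simp)
  qed
qed

end
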